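(* Let $(\mathcal X,\mathfrak S)$ be an almost hierarchically hyperbolic space. Then there exists a hierarchically hyperbolic space structure $\mathfrak R$ for $\mathcal X$ such that $\mathfrak S\subseteq\mathfrak R$, and if $W\in\mathfrak R-\mathfrak S$ then the hyperbolic space associated to $W$ is a single point.
   Context: Distances between sets are infima, and for $x\in\mathcal X$ we write $d_W(x,\cdot)$ for $d_W(\pi_W(x),\cdot)$. HHS. A hierarchically hyperbolic space $(\mathcal X,\mathfrak S)$ is a quasigeodesic metric space $(\mathcal X,d)$ (for some constants, any two points are joined by a quasigeodesic with those constants) with $\delta\ge0$, an index set $\mathfrak S$ (elements: domains), and $\delta$-hyperbolic spaces $(\mathcal CW,d_W)$, $W\in\mathfrak S$, such that: (1) Projections: for some $\xi,K\ge0$ there are maps $\pi_W\colon\mathcal X\to2^{\mathcal CW}$ sending points to sets of diameter at most $\xi$, each $(K,K)$-coarsely Lipschitz with $\pi_W(\mathcal X)$ $K$-quasiconvex. (2) Nesting: $\mathfrak S$ has a partial order $\sqsubseteq$ and is empty or has a unique $\sqsubseteq$-maximal element $S$, larger than all others. Put $\mathfrak S_W=\{V: V\sqsubseteq W\}$. For $V\sqsubsetneq W$ there is a specified subset $\rho^V_W\subset\mathcal CW$ with diameter at most $\xi$ and a map $\rho^W_V\colon\mathcal CW\to2^{\mathcal CV}$. (3) Orthogonality: $\mathfrak S$ has a symmetric anti-reflexive relation $\perp$. If $V\sqsubseteq W$ and $W\perp U$ then $V\perp U$. For each $T\in\mathfrak S$ and $U\in\mathfrak S_T$ with $\{V\in\mathfrak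 S_T: V\perp U\}\ne\emptyset$ there is $W\in\mathfrak S_T-\{T\}$ (a container) such that $V\perp U$, $V\sqsubseteq T$ imply $V\sqsubseteq W$. If $V\perp W$ then $V,W$ are not $\sqsubseteq$-comparable. (4) Transversality and consistency: $V,W$ are transverse, $V\pitchfork W$, if they are not orthogonal and neither is nested in the other. There is $\kappa_0\ge0$ such that if $V\pitchfork W$ there are sets $\rho^V_W\subseteq\mathcal CW$, $\rho^W_V\subseteq\mathcal CV$ of diameter at most $\xi$ with $\min\{d_W(x,\rho^V_W),d_V(x,\rho^W_V)\}\le\kappa_0$ for all $x\in\mathcal X$. If $V\sqsubsetneq W$ then $\min\{d_W(x,\rho^V_W),\operatorname{diam}_{\mathcal CV}(\pi_V(x)\cup\rho^W_V(\pi_W(x)))\}\le\kappa_0$ for all $x$. If $U\sqsubseteq V$, then $d_W(\rho^U_W,\rho^V_W)\le\kappa_0$ whenever $V\sqsubsetneq W$, or $V\pitchfork W$ and $W\not\perp U$. (5) Finite complexity: there is $n$ bounding the cardinality of any set of pairwise $\sqsubseteq$-comparable elements. (6) Large links: there are $\lambda\ge1$, $E\ge\max\{\xi,\kappa_0\}$ such that for $W\in\mathfrak S$, $x,x'\in\mathcal X$ and $N=\lambda d_W(\pi_W(x),\pi_W(x'))+\lambda$ there are $T_1,\dots,T_{\lfloor N\rfloor}\in\mathfrak S_W-\{W\}$ such that each $T\in\mathfrak S_W-\{W\}$ satisfies $T\in\mathfrak S_{T_i}$ for some $i$ or $d_T(\pi_T(x),\pi_T(x'))<E$; also $d_W(\pi_W(x),\rho^{T_i}_W)\le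 N$ for each $i$. (7) Bounded geodesic image: for $V\sqsubsetneq W$ and every geodesic $\gamma$ of $\mathcal CW$, either $\operatorname{diam}_{\mathcal CV}(\rho^W_V(\gamma))\le E$ or $\gamma$ meets the $E$-neighborhood of $\rho^V_W$. (8) Partial realization: there is $\alpha$ such that for every family $\{V_j\}$ of pairwise orthogonal elements and $p_j\in\pi_{V_j}(\mathcal X)$ there is $x\in\mathcal X$ with $d_{V_j}(x,p_j)\le\alpha$ for all $j$; $d_V(x,\rho^{V_j}_V)\le\alpha$ whenever $V_j\sqsubsetneq V$; and $d_W(x,\rho^{V_j}_W)\le\alpha$ whenever $W\pitchfork V_j$. (9) Uniqueness: for each $\kappa\ge0$ there is $\theta_u(\kappa)$ such that $d(x,y)\ge\theta_u(\kappa)$ implies $d_V(x,y)\ge\kappa$ for some $V\in\mathfrak S$. Almost HHS. $(\mathcal X,\mathfrak S)$ is an almost hierarchically hyperbolic space if it satisfies all of these axioms except (3), and instead of (3) satisfies: (3') Bounded pairwise orthogonality: $\mathfrak S$ has a symmetric and anti-reflexive relation $\perp$; if $V\sqsubseteq W$ and $W\perp U$ then $V\perp U$; if $V\perp W$ then $V,W$ are not $\sqsubseteq$-comparable; and the cardinality of any collection of pairwise orthogonal domains is uniformly bounded by $\xi$. An HHS structure $\mathfrak R$ for $\mathcal X$ is an index set $\mathfrak R$ with hyperbolic spaces, relations and projections making $(\mathcal X,\mathfrak R)$ an HHS. The inclusion $\mathfrak S\subseteq\mathfrak R$ is understood with the spaces, relations and projections of elements of $\mathfrak S$ retained. *)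

theory Defs
  imports "HOL-Analysis.Analysis"
begin

section \<open>Coarse geometry of metric spaces given by a carrier and a distance function\<close>

text \<open>The infimum distance between two sets. It is only applied to nonempty sets.\<close>

definition set_dist :: "('c \<Rightarrow> 'c \<Rightarrow> real) \<Rightarrow> 'c set \<Rightarrow> 'c set \<Rightarrow> real" where
  "set_dist d A B = (INF (a, b)\<in>A \<times> B. d a b)"

text \<open>``The diameter of A is at most r'', in a form that is also correct for unbounded sets
  (where a real-valued supremum would be meaningless) and for the empty set (if r is
  nonnegative).\<close>

definition diam_le :: "('c \<Rightarrow> 'c \<Rightarrow> real) \<Rightarrow> 'c set \<Rightarrow> real \<Rightarrow> bool" where
  "diam_le d A r \<longleftrightarrow> (\<forall>a\<in>A. \<forall>b\<in>A. d a b \<le> r)"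

text \<open>Paths are parametrised by nonempty, possibly unbounded intervals.\<close>

definition quasigeodesic ::
  "'c set \<Rightarrow> ('c \<Rightarrow> 'c \<Rightarrow> real) \<Rightarrow> real \<Rightarrow> real \<Rightarrow> real set \<Rightarrow> (real \<Rightarrow> 'c) \<Rightarrow> bool" where
  "quasigeodesic M d lam eps I c \<longleftrightarrow>
     is_interval I \<and> I \<noteq> {} \<and> c ` I \<subseteq> M \<and>
     (\<forall>s\<in>I. \<forall>t\<in>I. \<bar>s - t\<bar> / lam - eps \<le> d (c s) (c t) \<and> d (c s) (c t) \<le> lam * \<bar>s - t\<bar> + eps)"

definition quasigeodesic_space :: "'c set \<Rightarrow> ('c \<Rightarrow> 'c \<Rightarrow> real) \<Rightarrow> bool" where
  "quasigeodesic_space M d \<longleftrightarrow>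
     Metric_space M d \<and>
     (\<exists>lam\<ge>1. \<exists>eps\<ge>0. \<forall>x\<in>M. \<forall>y\<in>M. \<exists>a b c. a \<le> b \<and>
        quasigeodesic M d lam eps {a..b} c \<and> c a = x \<and> c b = y)"

definition geodesic ::
  "'c set \<Rightarrow> ('c \<Rightarrow> 'c \<Rightarrow> real) \<Rightarrow> real set \<Rightarrow> (real \<Rightarrow> 'c) \<Rightarrow> bool" where
  "geodesic M d I c \<longleftrightarrow>
     is_interval I \<and> I \<noteq> {} \<and> c ` I \<subseteq> M \<and> (\<forall>s\<in>I. \<forall>t\<in>I. d (c s) (c t) = \<bar>s - t\<bar>)"

definition geodesic_segment ::
  "'c set \<Rightarrow> ('c \<Rightarrow> 'c \<Rightarrow> real) \<Rightarrow> 'c \<Rightarrow> 'c \<Rightarrow> 'c set \<Rightarrow> bool" where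
  "geodesic_segment M d x y G \<longleftrightarrow>
     (\<exists>a b c. a \<le> b \<and> geodesic M d {a..b} c \<and> c a = x \<and> c b = y \<and> G = c ` {a..b})"

text \<open>A geodesic metric space all of whose geodesic triangles are \<open>\<delta>\<close>-slim.\<close>

definition hyperbolic_space :: "real \<Rightarrow> 'c set \<Rightarrow> ('c \<Rightarrow> 'c \<Rightarrow> real) \<Rightarrow> bool" where
  "hyperbolic_space \<delta> M d \<longleftrightarrow>
     Metric_space M d \<and>
     (\<forall>x\<in>M. \<forall>y\<in>M. \<exists>G. geodesic_segment M d x y G) \<and>
     (\<forall>x y z G1 G2 G3.
        geodesic_segment M d x y G1 \<and> geodesic_segment M d y z G2 \<and> geodesic_segment M d x z G3 \<longrightarrow>
        (\<forall>p\<in>G1. \<exists>q\<in>G2 \<union> G3. d p q \<le> \<delta>))"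

definition quasiconvex :: "real \<Rightarrow> 'c set \<Rightarrow> ('c \<Rightarrow> 'c \<Rightarrow> real) \<Rightarrow> 'c set \<Rightarrow> bool" where
  "quasiconvex K M d A \<longleftrightarrow>
     (\<forall>x\<in>A. \<forall>y\<in>A. \<forall>G. geodesic_segment M d x y G \<longrightarrow> (\<forall>p\<in>G. set_dist d {p} A \<le> K))"


section \<open>The data of a hierarchical structure\<close>

text \<open>
  The index set \<open>Dom\<close> of domains, the spaces \<open>(spc W, hdist W)\<close>, the relations \<open>\<sqsubseteq>\<close> (\<open>nest\<close>) and
  \<open>\<bottom>\<close> (\<open>orth\<close>), and the projections \<open>proj W = \<pi>\<^sub>W\<close>.
  \<open>rho V W\<close> is the subset \<open>\<rho>\<^sup>V\<^sub>W\<close> of \<open>spc W\<close>; it is meaningful if V is properly nested in W or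
  transverse to W. \<open>rho_map W V\<close> is the map \<open>\<rho>\<^sup>W\<^sub>V\<close> from \<open>spc W\<close> to subsets of \<open>spc V\<close>; it is
  meaningful if V is properly nested in W. Values outside \<open>Dom\<close> and \<open>spc W\<close> are irrelevant.
\<close>

record ('x, 'c, 'i) hierarchy =
  Dom :: "'i set"
  spc :: "'i \<Rightarrow> 'c set"
  hdist :: "'i \<Rightarrow> 'c \<Rightarrow> 'c \<Rightarrow> real"
  nest :: "'i \<Rightarrow> 'i \<Rightarrow> bool"
  orth :: "'i \<Rightarrow> 'i \<Rightarrow> bool"
  proj :: "'i \<Rightarrow> 'x \<Rightarrow> 'c set"
  rho :: "'i \<Rightarrow> 'i \<Rightarrow> 'c set"
  rho_map :: "'i \<Rightarrow> 'i \<Rightarrow> 'c \<Rightarrow> 'c set"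

definition pnest :: "('x, 'c, 'i) hierarchy \<Rightarrow> 'i \<Rightarrow> 'i \<Rightarrow> bool" where
  "pnest H V W \<longleftrightarrow> nest H V W \<and> V \<noteq> W"

definition transverse :: "('x, 'c, 'i) hierarchy \<Rightarrow> 'i \<Rightarrow> 'i \<Rightarrow> bool" where
  "transverse H V W \<longleftrightarrow> \<not> orth H V W \<and> \<not> nest H V W \<and> \<not> nest H W V"

definition nested_in :: "('x, 'c, 'i) hierarchy \<Rightarrow> 'i \<Rightarrow> 'i set" where
  "nested_in H W = {V \<in> Dom H. nest H V W}"

definition pt_dist :: "('x, 'c, 'i) hierarchy \<Rightarrow> 'i \<Rightarrow> 'x \<Rightarrow> 'c set \<Rightarrow> real" where
  "pt_dist H W x A = set_dist (hdist H W) (proj H W x) A"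


section \<open>The axioms\<close>

text \<open>Set-valued maps into \<open>2\<^sup>A\<close> and the sets \<open>\<rho>\<^sup>V\<^sub>W\<close> have nonempty values, as is needed for the
  distances to them to make sense.\<close>

definition projections_ax ::
  "real \<Rightarrow> real \<Rightarrow> ('x::metric_space, 'c, 'i) hierarchy \<Rightarrow> bool" where
  "projections_ax \<xi> K H \<longleftrightarrow>
     (\<forall>W\<in>Dom H.
        (\<forall>x. proj H W x \<subseteq> spc H W \<and> proj H W x \<noteq> {} \<and> diam_le (hdist H W) (proj H W x) \<xi>) \<and>
        (\<forall>x y. pt_dist H W x (proj H W y) \<le> K * dist x y + K) \<and>
        quasiconvex K (spc H W) (hdist H W) (\<Union>x. proj H W x))"

definition nesting_ax :: "real \<Rightarrow> ('x, 'c, 'i) hierarchy \<Rightarrow> bool" where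
  "nesting_ax \<xi> H \<longleftrightarrow>
     reflp_on (Dom H) (nest H) \<and> antisymp_on (Dom H) (nest H) \<and> transp_on (Dom H) (nest H) \<and>
     (Dom H = {} \<or> (\<exists>S\<in>Dom H. \<forall>W\<in>Dom H. nest H W S)) \<and>
     (\<forall>V\<in>Dom H. \<forall>W\<in>Dom H. pnest H V W \<longrightarrow>
        rho H V W \<subseteq> spc H W \<and> rho H V W \<noteq> {} \<and> diam_le (hdist H W) (rho H V W) \<xi> \<and>
        (\<forall>p\<in>spc H W. rho_map H W V p \<subseteq> spc H V \<and> rho_map H W V p \<noteq> {}))"

text \<open>The part of the orthogonality axiom common to both notions.\<close>

definition orthogonality_basic :: "('x, 'c, 'i) hierarchy \<Rightarrow> bool" where
  "orthogonality_basic H \<longleftrightarrow>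
     symp_on (Dom H) (orth H) \<and> irreflp_on (Dom H) (orth H) \<and>
     (\<forall>V\<in>Dom H. \<forall>W\<in>Dom H. \<forall>U\<in>Dom H. nest H V W \<and> orth H W U \<longrightarrow> orth H V U) \<and>
     (\<forall>V\<in>Dom H. \<forall>W\<in>Dom H. orth H V W \<longrightarrow> \<not> nest H V W \<and> \<not> nest H W V)"

definition containers_ax :: "('x, 'c, 'i) hierarchy \<Rightarrow> bool" where
  "containers_ax H \<longleftrightarrow>
     (\<forall>T\<in>Dom H. \<forall>U\<in>nested_in H T. {V \<in> nested_in H T. orth H V U} \<noteq> {} \<longrightarrow>
        (\<exists>W\<in>nested_in H T - {T}. \<forall>V\<in>Dom H. orth H V U \<and> nest H V T \<longrightarrow> nest H V W))"

definition bounded_orthogonality_ax :: "real \<Rightarrow> ('x, 'c, 'i) hierarchy \<Rightarrow> bool" where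
  "bounded_orthogonality_ax \<xi> H \<longleftrightarrow>
     (\<forall>\<V>. \<V> \<subseteq> Dom H \<and> pairwise (orth H) \<V> \<longrightarrow> finite \<V> \<and> real (card \<V>) \<le> \<xi>)"

definition consistency_ax :: "real \<Rightarrow> real \<Rightarrow> ('x, 'c, 'i) hierarchy \<Rightarrow> bool" where
  "consistency_ax \<xi> \<kappa>0 H \<longleftrightarrow>
     (\<forall>V\<in>Dom H. \<forall>W\<in>Dom H. transverse H V W \<longrightarrow>
        rho H V W \<subseteq> spc H W \<and> rho H V W \<noteq> {} \<and> diam_le (hdist H W) (rho H V W) \<xi> \<and>
        rho H W V \<subseteq> spc H V \<and> rho H W V \<noteq> {} \<and> diam_le (hdist H V) (rho H W V) \<xi> \<and>
        (\<forall>x. min (pt_dist H W x (rho H V W)) (pt_dist H V x (rho H W V)) \<le> \<kappa>0)) \<and>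
     (\<forall>V\<in>Dom H. \<forall>W\<in>Dom H. pnest H V W \<longrightarrow>
        (\<forall>x. pt_dist H W x (rho H V W) \<le> \<kappa>0 \<or>
             diam_le (hdist H V) (proj H V x \<union> (\<Union>p\<in>proj H W x. rho_map H W V p)) \<kappa>0)) \<and>
     (\<forall>U\<in>Dom H. \<forall>V\<in>Dom H. \<forall>W\<in>Dom H.
        nest H U V \<and> (pnest H V W \<or> transverse H V W \<and> \<not> orth H W U) \<longrightarrow>
        set_dist (hdist H W) (rho H U W) (rho H V W) \<le> \<kappa>0)"

definition finite_complexity_ax :: "nat \<Rightarrow> ('x, 'c, 'i) hierarchy \<Rightarrow> bool" where
  "finite_complexity_ax n H \<longleftrightarrow>
     (\<forall>\<C>. \<C> \<subseteq> Dom H \<and> pairwise (\<lambda>V W. nest H V W \<or> nest H W V) \<C> \<longrightarrow> finite \<C> \<and> card \<C> \<le> n)"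

text \<open>The domains \<open>T\<^sub>1, \<dots>, T\<^sub>\<lfloor>\<^sub>N\<^sub>\<rfloor>\<close> are not required to be distinct, and there are none of them if W is
  \<open>\<sqsubseteq>\<close>-minimal; hence they are given as a set with at most \<open>\<lfloor>N\<rfloor>\<close> elements.\<close>

definition large_links_ax :: "real \<Rightarrow> real \<Rightarrow> ('x, 'c, 'i) hierarchy \<Rightarrow> bool" where
  "large_links_ax lam E H \<longleftrightarrow>
     (\<forall>W\<in>Dom H. \<forall>x x'.
        let N = lam * pt_dist H W x (proj H W x') + lam in
        \<exists>\<T>. \<T> \<subseteq> nested_in H W - {W} \<and> finite \<T> \<and> int (card \<T>) \<le> \<lfloor>N\<rfloor> \<and>
           (\<forall>T\<in>nested_in H W - {W}.
              (\<exists>T'\<in>\<T>. T \<in> nested_in H T') \<or> pt_dist H T x (proj H T x') < E) \<and>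
           (\<forall>T'\<in>\<T>. pt_dist H W x (rho H T' W) \<le> N))"

definition bounded_geodesic_image_ax :: "real \<Rightarrow> ('x, 'c, 'i) hierarchy \<Rightarrow> bool" where
  "bounded_geodesic_image_ax E H \<longleftrightarrow>
     (\<forall>V\<in>Dom H. \<forall>W\<in>Dom H. pnest H V W \<longrightarrow>
        (\<forall>I c. geodesic (spc H W) (hdist H W) I c \<longrightarrow>
           diam_le (hdist H V) (\<Union>p\<in>c ` I. rho_map H W V p) E \<or>
           (\<exists>p\<in>c ` I. set_dist (hdist H W) {p} (rho H V W) \<le> E)))"

text \<open>As orthogonality is anti-reflexive, a family of pairwise orthogonal domains is the same as
  a set of pairwise orthogonal domains.\<close>

definition partial_realization_ax :: "real \<Rightarrow> ('x, 'c, 'i) hierarchy \<Rightarrow> bool" where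
  "partial_realization_ax \<alpha> H \<longleftrightarrow>
     (\<forall>\<V> p. \<V> \<subseteq> Dom H \<and> pairwise (orth H) \<V> \<and> (\<forall>V\<in>\<V>. p V \<in> (\<Union>x. proj H V x)) \<longrightarrow>
        (\<exists>x. \<forall>V\<in>\<V>.
           pt_dist H V x {p V} \<le> \<alpha> \<and>
           (\<forall>W\<in>Dom H. pnest H V W \<longrightarrow> pt_dist H W x (rho H V W) \<le> \<alpha>) \<and>
           (\<forall>W\<in>Dom H. transverse H W V \<longrightarrow> pt_dist H W x (rho H V W) \<le> \<alpha>)))"

definition uniqueness_ax :: "(real \<Rightarrow> real) \<Rightarrow> ('x::metric_space, 'c, 'i) hierarchy \<Rightarrow> bool" where
  "uniqueness_ax \<theta> H \<longleftrightarrow>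
     (\<forall>\<kappa>\<ge>0. \<forall>x y. dist x y \<ge> \<theta> \<kappa> \<longrightarrow> (\<exists>V\<in>Dom H. pt_dist H V x (proj H V y) \<ge> \<kappa>))"

text \<open>Everything except the orthogonality axiom. The constant \<open>\<xi>\<close> is exposed because it also
  occurs in the bounded pairwise orthogonality axiom.\<close>

definition hierarchy_axioms :: "real \<Rightarrow> ('x::metric_space, 'c, 'i) hierarchy \<Rightarrow> bool" where
  "hierarchy_axioms \<xi> H \<longleftrightarrow>
     quasigeodesic_space (UNIV :: 'x set) dist \<and> \<xi> \<ge> 0 \<and>
     (\<exists>\<delta>\<ge>0. \<forall>W\<in>Dom H. hyperbolic_space \<delta> (spc H W) (hdist H W)) \<and>
     (\<exists>K\<ge>0. projections_ax \<xi> K H) \<and>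
     nesting_ax \<xi> H \<and>
     (\<exists>n. finite_complexity_ax n H) \<and>
     (\<exists>\<kappa>0\<ge>0. consistency_ax \<xi> \<kappa>0 H \<and>
        (\<exists>lam\<ge>1. \<exists>E. E \<ge> max \<xi> \<kappa>0 \<and> large_links_ax lam E H \<and> bounded_geodesic_image_ax E H)) \<and>
     (\<exists>\<alpha>. partial_realization_ax \<alpha> H) \<and>
     (\<exists>\<theta>. uniqueness_ax \<theta> H)"

definition HHS :: "('x::metric_space, 'c, 'i) hierarchy \<Rightarrow> bool" where
  "HHS H \<longleftrightarrow> orthogonality_basic H \<and> containers_ax H \<and> (\<exists>\<xi>. hierarchy_axioms \<xi> H)"

definition almost_HHS :: "('x::metric_space, 'c, 'i) hierarchy \<Rightarrow> bool" where
  "almost_HHS H \<longleftrightarrow>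
     orthogonality_basic H \<and> (\<exists>\<xi>. hierarchy_axioms \<xi> H \<and> bounded_orthogonality_ax \<xi> H)"

text \<open>Inclusion of structures along an injection \<open>\<iota>\<close> of index sets: the spaces, relations and
  projections (both \<open>\<pi>\<close> and \<open>\<rho>\<close>) of the domains of the smaller structure are retained.\<close>

definition includes_along ::
  "('i \<Rightarrow> 'j) \<Rightarrow> ('x, 'c, 'i) hierarchy \<Rightarrow> ('x, 'c, 'j) hierarchy \<Rightarrow> bool" where
  "includes_along \<iota> H R \<longleftrightarrow>
     inj_on \<iota> (Dom H) \<and> \<iota> ` Dom H \<subseteq> Dom R \<and>
     (\<forall>W\<in>Dom H.
        spc R (\<iota> W) = spc H W \<and>
        (\<forall>p\<in>spc H W. \<forall>q\<in>spc H W. hdist R (\<iota> W) p q = hdist H W p q) \<and>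
        proj R (\<iota> W) = proj H W) \<and>
     (\<forall>V\<in>Dom H. \<forall>W\<in>Dom H.
        (nest R (\<iota> V) (\<iota> W) \<longleftrightarrow> nest H V W) \<and>
        (orth R (\<iota> V) (\<iota> W) \<longleftrightarrow> orth H V W) \<and>
        (pnest H V W \<or> transverse H V W \<longrightarrow> rho R (\<iota> V) (\<iota> W) = rho H V W) \<and>
        (pnest H V W \<longrightarrow> (\<forall>p\<in>spc H W. rho_map R (\<iota> W) (\<iota> V) p = rho_map H W V p)))"

end

theory Submission
  imports Defs
begin

text \<open>
  The domains to be added are given by pairs \<open>D = (T, X)\<close>, where \<open>X\<close> is a pairwise orthogonal set
  of domains nested in \<open>T\<close>; such a \<open>D\<close> is a container for the domains that are nested in \<open>T\<close> and
  orthogonal to every element of \<open>X\<close>. Nesting and orthogonality of pairs are defined by conditions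
  on \<open>T\<close> and \<open>X\<close>, because comparing the sets of contained domains would not yield finite
  complexity. The delicate axioms are partial realization and large links for a pair: both need
  a gate, that is, a point with coordinates \<open>\<rho>\<^sup>D\<^sub>W\<close> wherever these are defined and otherwise the
  coordinates of a given point. Its existence is an instance of the realization theorem for
  consistent tuples, which only needs bounded pairwise orthogonality instead of containers:
  as long as a point realizing a pairwise orthogonal family of domains is far from the tuple
  somewhere, the family can be enlarged, or one of its elements replaced by a smaller domain, and
  this happens boundedly often.
\<close>

section \<open>Pairs representing containers\<close>

text \<open>Each new space is a point, so the substance lies in the sets that a pair receives in the
  old spaces. They are borrowed from \<open>T\<close> or from an element of \<open>X\<close>, and
  any two admissible choices agree coarsely because one point realizes orthogonal domains together.
  The obstacle in the realization theorem is that a domain where the tuple is missed cannot simply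
  join the family: a point realizing it may miss the tuple in yet another domain, one that beats it.
  This process stops because an infinite sequence of beaters would supply two points that are far
  apart in every member between them, yet boundedly close in each domain properly containing the
  first of these members; large links then bound the number of members by induction on rank.\<close>

locale orthogonality_poset =
  fixes Dom :: "'i set" and nest orth :: "'i \<Rightarrow> 'i \<Rightarrow> bool"
  assumes nest_dom: "nest V W \<Longrightarrow> V \<in> Dom \<and> W \<in> Dom"
    and nest_refl: "V \<in> Dom \<Longrightarrow> nest V V"
    and nest_antisym: "nest V W \<Longrightarrow> nest W V \<Longrightarrow> V = W"
    and nest_trans: "nest U V \<Longrightarrow> nest V W \<Longrightarrow> nest U W"
    and orth_dom: "orth V W \<Longrightarrow> V \<in> Dom \<and> W \<in> Dom"
    and orth_sym: "orth V W \<Longrightarrow> orth W V"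
    and orth_irrefl: "\<not> orth V V"
    and orth_nest: "nest V W \<Longrightarrow> orth W U \<Longrightarrow> orth V U"
begin

lemma orth_nest2: "nest V W \<Longrightarrow> orth U W \<Longrightarrow> orth U V"
  using orth_nest orth_sym by blast

lemma orth_not_nest: "orth V W \<Longrightarrow> \<not> nest V W"
  using orth_nest orth_irrefl orth_sym by blast

text \<open>\<open>V\<close> is properly nested in or transverse to \<open>W\<close>, that is, \<open>\<rho>\<^sup>V\<^sub>W\<close> is meaningful.\<close>

definition rel :: "'i \<Rightarrow> 'i \<Rightarrow> bool" where
  "rel V W \<longleftrightarrow> V \<in> Dom \<and> W \<in> Dom \<and> \<not> orth V W \<and> \<not> nest W V"

lemma rel_not_orth: "rel V W \<Longrightarrow> \<not> orth V W" "rel V W \<Longrightarrow> \<not> orth W V"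
  using orth_sym by (auto simp: rel_def)

lemma rel_dom: "rel V W \<Longrightarrow> V \<in> Dom" "rel V W \<Longrightarrow> W \<in> Dom"
  by (auto simp: rel_def)

lemma rel_neq: "rel V W \<Longrightarrow> V \<noteq> W"
  using nest_refl by (auto simp: rel_def)

lemma rel_below: "nest U V \<Longrightarrow> rel V W \<Longrightarrow> \<not> orth U W \<Longrightarrow> rel U W"
  unfolding rel_def using nest_dom nest_trans by blast

lemma rel_if_proper: "nest V W \<Longrightarrow> V \<noteq> W \<Longrightarrow> rel V W"
  unfolding rel_def using nest_dom nest_antisym orth_not_nest by blast

subsection \<open>Candidate containers\<close>

text \<open>A pair \<open>(T, X)\<close> stands for the set of all domains nested in \<open>T\<close> and orthogonal to every
  element of \<open>X\<close>; the domain \<open>T\<close> itself is the pair \<open>(T, {})\<close>.\<close>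

definition pairs :: "('i \<times> 'i set) set" where
  "pairs = {(T, X). T \<in> Dom \<and> (\<forall>x\<in>X. nest x T) \<and> pairwise orth X \<and>
     (\<exists>Q. nest Q T \<and> (\<forall>x\<in>X. orth Q x))}"

text \<open>The condition guarantees that every domain contained in \<open>A\<close> is contained in
  \<open>B\<close>: it is orthogonal to \<open>y\<close> because it lies below \<open>fst A\<close>,
  or because it is orthogonal to some \<open>x\<close> above \<open>y\<close>. Being a condition on
  \<open>X\<close> itself, it lets a weight of \<open>X\<close> serve as a rank.\<close>

definition pair_nest :: "'i \<times> 'i set \<Rightarrow> 'i \<times> 'i set \<Rightarrow> bool" where
  "pair_nest A B \<longleftrightarrow> nest (fst A) (fst B) \<and>
     (\<forall>y\<in>snd B. orth y (fst A) \<or> (\<exists>x\<in>snd A. nest y x))"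

text \<open>Each alternative forces the domains contained in \<open>A\<close> to be orthogonal to
  those contained in \<open>B\<close>. In the last two, one first component lies below an element to
  which everything in the other pair is orthogonal.\<close>

definition pair_orth :: "'i \<times> 'i set \<Rightarrow> 'i \<times> 'i set \<Rightarrow> bool" where
  "pair_orth A B \<longleftrightarrow> orth (fst A) (fst B) \<or>
     (\<exists>x\<in>snd A. nest (fst B) x) \<or> (\<exists>y\<in>snd B. nest (fst A) y)"

lemma pairs_singleton: "(T, {}) \<in> pairs \<longleftrightarrow> T \<in> Dom"
  using nest_refl by (auto simp: pairs_def)

lemma pairs_fst: "A \<in> pairs \<Longrightarrow> fst A \<in> Dom"
  by (auto simp: pairs_def)

lemma pairs_snd: "A \<in> pairs \<Longrightarrow> x \<in> snd A \<Longrightarrow> nest x (fst A)"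
  by (auto simp: pairs_def)

lemma pairs_snd_pairwise: "A \<in> pairs \<Longrightarrow> pairwise orth (snd A)"
  by (auto simp: pairs_def)

lemma pairs_snd_proper:
  assumes A: "A \<in> pairs" and x: "x \<in> snd A" shows "\<not> nest (fst A) x"
proof
  assume "nest (fst A) x"
  moreover obtain Q where "nest Q (fst A)" "orth Q x"
    using A x by (auto simp: pairs_def)
  ultimately show False using nest_trans orth_not_nest by blast
qed

lemma pairs_member:
  assumes "A \<in> pairs" obtains Q where "pair_nest (Q, {}) A" "Q \<in> Dom"
proof -
  from assms obtain Q where Q: "nest Q (fst A)" "\<forall>x\<in>snd A. orth Q x"
    by (auto simp: pairs_def)
  then show ?thesis using that[of Q] orth_sym nest_dom by (auto simp: pair_nest_def)
qed

lemma pair_nest_singletons: "pair_nest (V, {}) (W, {}) \<longleftrightarrow> nest V W"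
  by (auto simp: pair_nest_def)

lemma pair_orth_singletons: "pair_orth (V, {}) (W, {}) \<longleftrightarrow> orth V W"
  by (auto simp: pair_orth_def)

lemma pair_nest_singleton_iff:
  "pair_nest (W, {}) A \<longleftrightarrow> nest W (fst A) \<and> (\<forall>y\<in>snd A. orth y W)"
  by (auto simp: pair_nest_def)

lemma pair_orth_singleton_iff:
  "pair_orth A (W, {}) \<longleftrightarrow> orth (fst A) W \<or> (\<exists>x\<in>snd A. nest W x)"
  by (auto simp: pair_orth_def)

lemma pair_nest_refl: "A \<in> pairs \<Longrightarrow> pair_nest A A"
  unfolding pair_nest_def by (meson nest_dom nest_refl pairs_fst pairs_snd)

lemma pair_nest_trans:
  assumes "pair_nest A B" "pair_nest B C" shows "pair_nest A C"
proof -
  have "orth z (fst A) \<or> (\<exists>x\<in>snd A. nest z x)" if z: "z \<in> snd C" for z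
  proof -
    consider "orth z (fst B)" | y where "y \<in> snd B" "nest z y"
      using assms(2) z by (auto simp: pair_nest_def)
    then show ?thesis
    proof cases
      case 1
      then show ?thesis using assms(1) orth_nest2 by (auto simp: pair_nest_def)
    next
      case (2 y)
      then consider "orth y (fst A)" | x where "x \<in> snd A" "nest y x"
        using assms(1) by (auto simp: pair_nest_def)
      then show ?thesis
        using 2 orth_nest nest_trans by cases blast+
    qed
  qed
  then show ?thesis using assms nest_trans by (auto simp: pair_nest_def)
qed

lemma pair_nest_same_fst:
  assumes "A \<in> pairs" "B \<in> pairs" "pair_nest A B" "fst A = fst B" "y \<in> snd B"
  shows "\<exists>x\<in>snd A. nest y x"
proof -
  have "\<not> orth y (fst A)" using assms(4) pairs_snd[OF assms(2,5)] orth_not_nest by auto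
  then show ?thesis using assms(3,5) by (auto simp: pair_nest_def)
qed

lemma pair_nest_antisym:
  assumes A: "A \<in> pairs" and B: "B \<in> pairs" and AB: "pair_nest A B" and BA: "pair_nest B A"
  shows "A = B"
proof -
  have eq: "fst A = fst B"
    using AB BA nest_antisym by (auto simp: pair_nest_def)
  have sub: "snd B \<subseteq> snd A"
    if A: "A \<in> pairs" and B: "B \<in> pairs" and AB: "pair_nest A B" and BA: "pair_nest B A"
      and eq: "fst A = fst B" for A B
  proof
    fix y assume y: "y \<in> snd B"
    obtain x where x: "x \<in> snd A" "nest y x" using pair_nest_same_fst[OF A B AB eq y] by blast
    obtain y' where y': "y' \<in> snd B" "nest x y'"
      using pair_nest_same_fst[OF B A BA _ x(1)] eq by auto
    \<comment> \<open>Here \<open>y\<close> lies below \<open>x\<close> and \<open>x\<close> below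
      \<open>y'\<close>, while distinct elements of \<open>snd B\<close> are orthogonal and hence
      incomparable.\<close>
    have "y' = y"
      using pairs_snd_pairwise[OF B] y y' x nest_trans orth_not_nest by (metis pairwiseD)
    then have "x = y" using x y' nest_antisym by blast
    then show "y \<in> snd A" using x by simp
  qed
  have "snd A = snd B" using sub[OF A B AB BA eq] sub[OF B A BA AB] eq by auto
  then show ?thesis using eq by (simp add: prod_eq_iff)
qed

lemma pair_orth_sym: "pair_orth A B \<Longrightarrow> pair_orth B A"
  using orth_sym by (auto simp: pair_orth_def)

lemma pair_orth_irrefl: "A \<in> pairs \<Longrightarrow> \<not> pair_orth A A"
  using orth_irrefl pairs_snd_proper by (auto simp: pair_orth_def)

lemma pair_orth_nest:
  assumes AB: "pair_nest A B" and BC: "pair_orth B C" shows "pair_orth A C"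
proof -
  consider "orth (fst B) (fst C)" | y where "y \<in> snd B" "nest (fst C) y"
    | z where "z \<in> snd C" "nest (fst B) z"
    using BC by (auto simp: pair_orth_def)
  then show ?thesis
  proof cases
    case 1
    then show ?thesis using AB orth_nest by (auto simp: pair_nest_def pair_orth_def)
  next
    case (2 y)
    then consider "orth y (fst A)" | x where "x \<in> snd A" "nest y x"
      using AB by (auto simp: pair_nest_def)
    then show ?thesis
    proof cases
      case 1
      then show ?thesis using orth_nest[OF 2(2)] orth_sym by (auto simp: pair_orth_def)
    next
      case (2 x)
      then show ?thesis using nest_trans[OF \<open>nest (fst C) y\<close>] by (auto simp: pair_orth_def)
    qed
  next
    case (3 z)
    then have "nest (fst A) z" using AB nest_trans by (auto simp: pair_nest_def)
    then show ?thesis using 3 by (auto simp: pair_orth_def)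
  qed
qed

lemma pair_orth_not_nest: "A \<in> pairs \<Longrightarrow> B \<in> pairs \<Longrightarrow> pair_orth A B \<Longrightarrow> \<not> pair_nest A B"
  using pair_orth_nest pair_orth_sym pair_orth_irrefl by blast

text \<open>The container of \<open>U\<close> in \<open>A = (T, X)\<close> is \<open>(T, X \<union> {Q})\<close> for an arbitrary domain \<open>Q\<close>
  nested in \<open>U\<close>, since everything orthogonal to \<open>U\<close> is orthogonal to \<open>Q\<close>.\<close>

lemma pair_container:
  assumes A: "A \<in> pairs" and U: "U \<in> pairs" and UA: "pair_nest U A"
    and V: "V \<in> pairs" "pair_nest V A" "pair_orth V U"
  shows "\<exists>C\<in>pairs. pair_nest C A \<and> C \<noteq> A \<and> snd C \<noteq> {} \<and>
    (\<forall>V\<in>pairs. pair_nest V A \<and> pair_orth V U \<longrightarrow> pair_nest V C)"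
proof -
  obtain Q where Q: "pair_nest (Q, {}) U" "Q \<in> Dom" using pairs_member[OF U] .
  have QA: "nest Q (fst A)" "\<forall>x\<in>snd A. orth x Q"
    using pair_nest_trans[OF Q(1) UA] by (auto simp: pair_nest_singleton_iff)
  define C where "C = (fst A, insert Q (snd A))"
  have VQ: "orth Q (fst V) \<or> (\<exists>y\<in>snd V. nest Q y)"
    if "pair_orth V U" for V
    using pair_orth_nest[OF Q(1) pair_orth_sym[OF that]]
    by (auto simp: pair_orth_def)
  have nestC: "pair_nest V C" if "pair_nest V A" "pair_orth V U" for V
    using that VQ[OF that(2)] by (auto simp: C_def pair_nest_def)
  \<comment> \<open>A domain contained in \<open>V\<close> is nested in \<open>fst A\<close> and
    orthogonal to the enlarged set, which is the nonemptiness that membership of \<open>C\<close> in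
    \<open>pairs\<close> demands.\<close>
  obtain P where P: "pair_nest (P, {}) V" using pairs_member[OF V(1)] .
  have "orth Q P"
    using pair_orth_nest[OF P pair_orth_sym[OF pair_orth_nest[OF Q(1) pair_orth_sym[OF V(3)]]]]
      orth_sym by (auto simp: pair_orth_def)
  moreover have "nest P (fst A)" "\<forall>x\<in>snd A. orth x P"
    using pair_nest_trans[OF P V(2)] by (auto simp: pair_nest_singleton_iff)
  ultimately have "C \<in> pairs"
    using A QA orth_sym unfolding C_def pairs_def
    by (auto simp: pairwise_insert)
  moreover have "pair_nest C A"
    using nest_refl[OF pairs_fst[OF A]] nest_refl nest_dom pairs_snd[OF A]
    by (fastforce simp: C_def pair_nest_def)
  moreover have "C \<noteq> A"
    using QA orth_irrefl by (auto simp: C_def prod_eq_iff)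
  ultimately show ?thesis using nestC by (auto simp: C_def)
qed

subsection \<open>The relative projection of a pair\<close>

definition pair_rel :: "'i \<times> 'i set \<Rightarrow> 'i \<Rightarrow> bool" where
  "pair_rel A W \<longleftrightarrow> W \<in> Dom \<and> \<not> pair_orth A (W, {}) \<and> \<not> pair_nest (W, {}) A"

lemma pair_rel_singleton: "V \<in> Dom \<Longrightarrow> pair_rel (V, {}) W \<longleftrightarrow> rel V W"
  by (auto simp: pair_rel_def rel_def pair_orth_singletons pair_nest_singletons)

text \<open>In the second case, \<open>pair_rel\<close> guarantees a candidate, and the choice does not matter since
  the relative projections of orthogonal domains are close to each other.\<close>

definition pair_rep :: "'i \<times> 'i set \<Rightarrow> 'i \<Rightarrow> 'i" where
  "pair_rep A W = (if rel (fst A) W then fst A else (SOME x. x \<in> snd A \<and> rel x W))"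

lemma pair_rep_singleton: "rel V W \<Longrightarrow> pair_rep (V, {}) W = V"
  by (simp add: pair_rep_def)

text \<open>If \<open>rel (fst A) W\<close> fails, then \<open>W\<close> lies below
  \<open>fst A\<close>, as orthogonality to \<open>fst A\<close> is excluded. Since \<open>W\<close>
  is not contained in \<open>A\<close>, some \<open>x\<close> in \<open>snd A\<close> is not
  orthogonal to \<open>W\<close>; and \<open>W\<close> is not below \<open>x\<close>, since that
  would make it orthogonal to \<open>A\<close>.\<close>

lemma pair_rep_cases:
  assumes "A \<in> pairs" "pair_rel A W"
  obtains "rel (fst A) W" "pair_rep A W = fst A"
  | "\<not> rel (fst A) W" "nest W (fst A)" "pair_rep A W \<in> snd A" "rel (pair_rep A W) W"
proof (cases "rel (fst A) W")
  case True
  then show ?thesis using that(1) by (simp add: pair_rep_def)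
next
  case False
  then have n: "nest W (fst A)"
    using assms pairs_fst by (auto simp: rel_def pair_rel_def pair_orth_singleton_iff)
  then obtain x where "x \<in> snd A" "\<not> orth x W" "\<not> nest W x"
    using assms(2) by (auto simp: pair_rel_def pair_orth_singleton_iff pair_nest_singleton_iff)
  then have "x \<in> snd A \<and> rel x W"
    using nest_dom pairs_snd[OF assms(1)] assms(2) by (fastforce simp: rel_def pair_rel_def)
  then have "pair_rep A W \<in> snd A \<and> rel (pair_rep A W) W"
    using someI[of "\<lambda>x. x \<in> snd A \<and> rel x W" x] False by (simp add: pair_rep_def)
  then show ?thesis using that(2) False n by blast
qed

lemma pair_rep_rel: "A \<in> pairs \<Longrightarrow> pair_rel A W \<Longrightarrow> rel (pair_rep A W) W"
  by (erule pair_rep_cases) auto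

end

section \<open>Realization\<close>

text \<open>The objects compared by \<open>near\<close> are meant to be nonempty bounded sets of the space of the
  domain, and \<open>near W r A B\<close> says that any point of \<open>A\<close> has distance at most \<open>r\<close> from
  any point of \<open>B\<close>, so that there is an unconditional triangle inequality.\<close>

locale coarse_hierarchy = orthogonality_poset Dom nest orth
  for Dom :: "'i set" and nest orth :: "'i \<Rightarrow> 'i \<Rightarrow> bool" +
  fixes near :: "'i \<Rightarrow> real \<Rightarrow> 'o \<Rightarrow> 'o \<Rightarrow> bool"
    and \<pi> :: "'i \<Rightarrow> 'x \<Rightarrow> 'o" and \<rho> :: "'i \<Rightarrow> 'i \<Rightarrow> 'o"
    and k :: real and M :: "real \<Rightarrow> nat" and rank :: "'i \<Rightarrow> nat" and N m :: nat
  assumes near_sym: "near W r a b \<Longrightarrow> near W r b a"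
    and near_trans: "near W r a b \<Longrightarrow> near W s b c \<Longrightarrow> near W (r + s) a c"
    and near_mono: "near W r a b \<Longrightarrow> r \<le> s \<Longrightarrow> near W s a b"
    and near_nonneg: "near W r a b \<Longrightarrow> 0 \<le> r"
    and k_nonneg: "0 \<le> k"
    and near_self: "W \<in> Dom \<Longrightarrow> near W k (\<pi> W x) (\<pi> W x)"
    and consistency: "rel V W \<Longrightarrow> rel W V \<Longrightarrow> near W k (\<pi> W x) (\<rho> V W) \<or> near V k (\<pi> V x) (\<rho> W V)"
    and bounded_image: "nest V W \<Longrightarrow> V \<noteq> W \<Longrightarrow> near W s (\<pi> W x) (\<pi> W y) \<Longrightarrow>
      \<not> near V k (\<pi> V x) (\<pi> V y) \<Longrightarrow> near W (s + k) (\<pi> W y) (\<rho> V W)"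
    and rho_nest: "nest U V \<Longrightarrow> rel V W \<Longrightarrow> \<not> orth U W \<Longrightarrow> near W k (\<rho> U W) (\<rho> V W)"
    and partial_realization: "\<V> \<subseteq> Dom \<Longrightarrow> pairwise orth \<V> \<Longrightarrow>
      \<exists>x. \<forall>V\<in>\<V>. near V k (\<pi> V x) (\<pi> V (p V)) \<and> (\<forall>W. rel V W \<longrightarrow> near W k (\<pi> W x) (\<rho> V W))"
    and large_links: "W \<in> Dom \<Longrightarrow> near W s (\<pi> W x) (\<pi> W y) \<Longrightarrow>
      \<exists>\<T>. finite \<T> \<and> card \<T> \<le> M s \<and> (\<forall>T\<in>\<T>. nest T W \<and> T \<noteq> W) \<and>
        (\<forall>V. nest V W \<and> V \<noteq> W \<and> \<not> near V k (\<pi> V x) (\<pi> V y) \<longrightarrow> (\<exists>T\<in>\<T>. nest V T))"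
    and top_exists: "W \<in> Dom \<Longrightarrow> \<exists>S. \<forall>V\<in>Dom. nest V S"
    and rank_less: "nest V W \<Longrightarrow> V \<noteq> W \<Longrightarrow> rank V < rank W"
    and rank_le: "W \<in> Dom \<Longrightarrow> rank W \<le> N"
    and orth_bounded: "\<V> \<subseteq> Dom \<Longrightarrow> pairwise orth \<V> \<Longrightarrow> finite \<V> \<and> card \<V> \<le> m"
begin

lemma near_trans_le:
  "near W r a b \<Longrightarrow> near W s b c \<Longrightarrow> r + s \<le> t \<Longrightarrow> near W t a c"
  using near_trans near_mono by blast

text \<open>One point realizing both \<open>U\<close> and \<open>V\<close> has its \<open>W\<close>
  coordinate within \<open>k\<close> of both sets.\<close>

lemma rho_orth:
  assumes "orth U V" "rel U W" "rel V W"
  shows "near W (2 * k) (\<rho> U W) (\<rho> V W)"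
proof -
  have "{U, V} \<subseteq> Dom" "pairwise orth {U, V}"
    using assms orth_dom orth_sym by (auto simp: pairwise_insert)
  from partial_realization[OF this, of undefined] obtain x
    where "near W k (\<pi> W x) (\<rho> U W)" "near W k (\<pi> W x) (\<rho> V W)"
    using assms by auto
  then show ?thesis by (metis near_sym near_trans mult_2)
qed

lemma rel_cases:
  assumes "rel V W" obtains "rel W V" | "nest V W" "V \<noteq> W" "\<not> rel W V"
proof (cases "nest V W")
  case True
  then show ?thesis using that(2) rel_neq[OF assms] by (auto simp: rel_def)
next
  case False
  then show ?thesis using that(1) assms orth_sym by (auto simp: rel_def)
qed

end

text \<open>A consistent tuple is given by a family \<open>\<beta>\<close> of points whose projections are its
  coordinates.\<close>

locale consistent_tuple = coarse_hierarchy Dom nest orth near \<pi> \<rho> k M rank N m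
  for Dom :: "'i set" and nest orth :: "'i \<Rightarrow> 'i \<Rightarrow> bool"
    and near :: "'i \<Rightarrow> real \<Rightarrow> 'o \<Rightarrow> 'o \<Rightarrow> bool"
    and \<pi> :: "'i \<Rightarrow> 'x \<Rightarrow> 'o" and \<rho> k M rank N m +
  fixes \<beta> :: "'i \<Rightarrow> 'x"
  assumes tuple_consistency: "rel V W \<Longrightarrow> rel W V \<Longrightarrow>
      near W k (\<pi> W (\<beta> W)) (\<rho> V W) \<or> near V k (\<pi> V (\<beta> V)) (\<rho> W V)"
    and tuple_bounded_image: "nest V W \<Longrightarrow> V \<noteq> W \<Longrightarrow> near W s (\<pi> W x) (\<pi> W (\<beta> W)) \<Longrightarrow>
      \<not> near V k (\<pi> V x) (\<pi> V (\<beta> V)) \<Longrightarrow> near W (s + k) (\<pi> W (\<beta> W)) (\<rho> V W)"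
begin

section \<open>Domains in which the tuple is missed\<close>

abbreviation b where "b W \<equiv> \<pi> W (\<beta> W)"

definition realizes where
  "realizes x U \<longleftrightarrow> near U k (\<pi> U x) (b U) \<and> (\<forall>W. rel U W \<longrightarrow> near W k (\<pi> W x) (\<rho> U W))"

lemma realizes_exists:
  "\<U> \<subseteq> Dom \<Longrightarrow> pairwise orth \<U> \<Longrightarrow> \<exists>x. \<forall>U\<in>\<U>. realizes x U"
  unfolding realizes_def using partial_realization[of \<U> \<beta>] by auto

text \<open>If \<open>W\<close> beats \<open>U\<close>, a point realizing \<open>U\<close> is far from the tuple in \<open>W\<close>.\<close>

definition beats where
  "beats c W U \<longleftrightarrow> rel U W \<and> \<not> near W c (b W) (\<rho> U W)"

lemma beats_mono: "beats c W U \<Longrightarrow> c' \<le> c \<Longrightarrow> beats c' W U"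
  using near_mono by (auto simp: beats_def)

lemma beats_far:
  assumes "beats c W U" "realizes x U" shows "\<not> near W (c - k) (\<pi> W x) (b W)"
proof
  assume "near W (c - k) (\<pi> W x) (b W)"
  moreover have "near W k (\<pi> W x) (\<rho> U W)" using assms by (simp add: beats_def realizes_def)
  ultimately have "near W c (b W) (\<rho> U W)"
    using near_trans[OF near_sym, of W "c - k" _ _ k] by simp
  then show False using assms by (simp add: beats_def)
qed

text \<open>Closeness to the tuple passes from \<open>W\<close> to a beaten \<open>U\<close>. In the
  transverse case neither \<open>x\<close> nor the tuple is near \<open>\<rho> U W\<close> in
  \<open>W\<close>, so consistency puts both near \<open>\<rho> W U\<close> in \<open>U\<close>; in
  the nested case the bounded image property applies.\<close>

lemma beaten_near:
  assumes B: "beats c W U" and x: "near W s (\<pi> W x) (b W)" and c: "s + k \<le> c" "0 \<le> s"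
  shows "near U (2 * k) (\<pi> U x) (b U)"
proof -
  have far: "\<not> near W (s + k) (b W) (\<rho> U W)" using B c near_mono by (auto simp: beats_def)
  have "rel U W" using B by (simp add: beats_def)
  then show ?thesis
  proof (cases rule: rel_cases)
    case 1
    have "\<not> near W k (b W) (\<rho> U W)" using far near_mono c by fastforce
    then have "near U k (b U) (\<rho> W U)" using tuple_consistency \<open>rel U W\<close> 1 by blast
    moreover have "\<not> near W k (\<pi> W x) (\<rho> U W)" using far x near_sym near_trans by blast
    then have "near U k (\<pi> U x) (\<rho> W U)" using consistency \<open>rel U W\<close> 1 by blast
    ultimately show ?thesis by (metis near_sym near_trans mult_2)
  next
    case 2
    then have "near U k (\<pi> U x) (b U)" using tuple_bounded_image x far by blast
    then show ?thesis using near_mono k_nonneg by fastforce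
  qed
qed

text \<open>Were \<open>W3\<close> orthogonal to or nested in \<open>W1\<close>, the tuple would be
  near \<open>\<rho> W1 W2\<close> in \<open>W2\<close>, against \<open>W2\<close> beating
  \<open>W1\<close>. A point realizing \<open>W1\<close> is far from the tuple in \<open>W2\<close>;
  if the tuple were near \<open>\<rho> W1 W3\<close> in \<open>W3\<close>, this would force it near
  \<open>\<rho> W2 W3\<close>. The loss is taken from \<open>c3\<close> alone.\<close>

lemma beats_trans:
  assumes B3: "beats c3 W3 W2" and B2: "beats c2 W2 W1" and c: "3 * k \<le> c2" "k \<le> c3"
  shows "beats (c3 - 2 * k) W3 W1"
proof -
  have r: "rel W2 W3" "rel W1 W2" using B2 B3 by (auto simp: beats_def)
  have far: "\<not> near W2 (3 * k) (b W2) (\<rho> W1 W2)" using B2 c near_mono by (auto simp: beats_def)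
  have b2: "near W2 k (b W2) (\<rho> W3 W2)" if "rel W3 W2"
    using tuple_consistency[OF that r(1)] B3 c near_mono by (auto simp: beats_def)
  have "\<not> orth W3 W1"
  proof
    assume o: "orth W3 W1"
    have "\<not> nest W2 W3" using o orth_nest r(2) rel_not_orth by blast
    then have "rel W3 W2" using r(1) by (metis rel_cases)
    then have "near W2 (k + 2 * k) (b W2) (\<rho> W1 W2)"
      using b2 rho_orth[OF o] r(2) near_trans by blast
    then show False using far by simp
  qed
  moreover have "\<not> nest W3 W1"
  proof
    assume n: "nest W3 W1"
    have "\<not> nest W2 W3" using n nest_trans r(2) by (auto simp: rel_def)
    then have r3: "rel W3 W2" using r(1) by (metis rel_cases)
    then have "near W2 (k + k) (b W2) (\<rho> W1 W2)"
      using b2 rho_nest[OF n r(2)] near_trans rel_not_orth by blast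
    then show False using far near_mono k_nonneg by fastforce
  qed
  ultimately have r13: "rel W1 W3" using r orth_sym by (auto simp: rel_def)
  have "\<not> near W3 (c3 - 2 * k) (b W3) (\<rho> W1 W3)"
  proof
    assume n: "near W3 (c3 - 2 * k) (b W3) (\<rho> W1 W3)"
    obtain x where x: "realizes x W1"
      using realizes_exists[of "{W1}"] r by (auto simp: rel_def)
    have x3: "near W3 k (\<pi> W3 x) (\<rho> W1 W3)" using x r13 by (simp add: realizes_def)
    have x2: "\<not> near W2 (c2 - k) (\<pi> W2 x) (b W2)" using beats_far B2 x by blast
    have "near W3 c3 (b W3) (\<rho> W2 W3)"
      using r(1)
    proof (cases rule: rel_cases)
      case 1
      have "\<not> near W2 k (\<pi> W2 x) (\<rho> W3 W2)"
        using near_trans_le[OF _ near_sym[OF b2[OF 1]], of k _ "c2 - k"] x2 c by auto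
      then have "near W3 k (\<pi> W3 x) (\<rho> W2 W3)" using consistency r(1) 1 by blast
      then have "near W3 (k + k) (\<rho> W1 W3) (\<rho> W2 W3)" using x3 near_sym near_trans by blast
      then show ?thesis using near_trans_le[OF n] by simp
    next
      case 2
      have "near W3 (c3 - k) (\<pi> W3 x) (b W3)" using near_trans_le[OF x3 near_sym[OF n]] by simp
      moreover have "\<not> near W2 k (\<pi> W2 x) (b W2)"
        using x2 near_mono[of W2 k "\<pi> W2 x" "b W2" "c2 - k"] c k_nonneg by linarith
      ultimately have "near W3 (c3 - k + k) (b W3) (\<rho> W2 W3)" using tuple_bounded_image 2 by blast
      then show ?thesis by simp
    qed
    then show False using B3 by (simp add: beats_def)
  qed
  then show ?thesis using r13 by (simp add: beats_def)
qed

definition unbeaten where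
  "unbeaten c U \<longleftrightarrow> U \<in> Dom \<and> (\<forall>W. \<not> beats c W U)"

lemma unbeaten_mono: "unbeaten c U \<Longrightarrow> c \<le> c' \<Longrightarrow> unbeaten c' U"
  unfolding unbeaten_def using beats_mono by blast

definition max_beats where
  "max_beats c W U \<longleftrightarrow> beats c W U \<and> (\<forall>T. nest W T \<and> beats c T U \<longrightarrow> T = W)"

lemma max_beats_exists:
  assumes "beats c W U" shows "\<exists>T. max_beats c T U"
proof -
  let ?P = "\<lambda>T. beats c T U"
  have bd: "\<forall>T. ?P T \<longrightarrow> rank T < Suc N"
    using rank_le by (auto simp: beats_def rel_def less_Suc_eq_le)
  obtain T where T: "?P T" "\<forall>T'. ?P T' \<longrightarrow> rank T' \<le> rank T"
    using ex_has_greatest_nat[of ?P W rank "Suc N"] assms bd by (metis less_imp_le)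
  have "T' = T" if "nest T T'" "?P T'" for T'
    using rank_less[OF that(1)] T(2) that(2) by force
  then show ?thesis using T by (auto simp: max_beats_def)
qed


section \<open>Infinite chains of maximal beaters do not exist\<close>

definition chain where
  "chain c w \<longleftrightarrow> 6 * k \<le> c \<and> (\<forall>i::nat. max_beats c (w (Suc i)) (w i))"

text \<open>The induction puts the new beater on top, so each step loses \<open>2 * k\<close> from a
  fresh \<open>c\<close> and the loss does not accumulate.\<close>

lemma chain_beats:
  assumes ch: "chain c w"
  shows "i < j \<Longrightarrow> beats (c - 2 * k) (w j) (w i)"
proof (induction j)
  case (Suc j)
  have B: "beats c (w (Suc j)) (w j)" and c: "6 * k \<le> c"
    using ch by (simp_all add: chain_def max_beats_def)
  show ?case
  proof (cases "i = j")
    case True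
    then show ?thesis using B beats_mono k_nonneg by simp
  next
    case False
    then have "beats (c - 2 * k) (w j) (w i)" using Suc by simp
    then show ?thesis using beats_trans[OF B] c k_nonneg by simp
  qed
qed simp

text \<open>By maximality, a domain \<open>T\<close> above \<open>w (i + 1)\<close> does not beat \<open>w i\<close>, so that the tuple is
  close in \<open>T\<close> both to the point realizing \<open>w i\<close> and to \<open>\<rho>\<close> of all later elements.\<close>

lemma chain_near:
  assumes ch: "chain c w"
    and x: "\<And>i. realizes (x i) (w i)"
    and T: "nest (w (Suc i)) T" "T \<noteq> w (Suc i)" and n: "Suc i < n"
  shows "near T (2 * c + 6 * k) (\<pi> T (x i)) (\<pi> T (x n))"
proof -
  have c: "6 * k \<le> c" and w: "\<And>i. max_beats c (w (Suc i)) (w i)"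
    using ch by (simp_all add: chain_def)
  note beats = chain_beats[OF ch]
  have B: "beats c (w (Suc i)) (w i)" using w by (simp add: max_beats_def)
  then have r: "rel (w i) (w (Suc i))" by (simp add: beats_def)
  have "rel (w i) T"
    unfolding rel_def using r[unfolded rel_def] nest_dom[OF T(1)] orth_nest2[OF T(1)]
      nest_trans[OF T(1)] by blast
  moreover have "\<not> beats c T (w i)" using w[of i] T by (auto simp: max_beats_def)
  ultimately have bT: "near T c (b T) (\<rho> (w i) T)" by (simp add: beats_def)
  moreover have "near T k (\<pi> T (x i)) (\<rho> (w i) T)"
    using x[of i] \<open>rel (w i) T\<close> by (simp add: realizes_def)
  ultimately have xT: "near T (c + k) (\<pi> T (x i)) (b T)"
    using near_sym[OF near_trans[OF _ near_sym]] by blast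
  have "\<not> near (w (Suc i)) k (\<pi> (w (Suc i)) (x i)) (b (w (Suc i)))"
    using beats_far[OF B x] near_mono[of _ k _ _ "c - k"] c k_nonneg by fastforce
  then have bT1: "near T (c + k + k) (b T) (\<rho> (w (Suc i)) T)"
    using tuple_bounded_image[OF T(1)] T(2) xT by blast
  have Bn: "beats (c - 2 * k) (w n) (w (Suc i))" using beats[OF n] .
  then have rn: "rel (w (Suc i)) (w n)" by (simp add: beats_def)
  have farn: "\<not> near (w n) (3 * k) (b (w n)) (\<rho> (w (Suc i)) (w n))"
    using Bn c near_mono[of _ "3 * k" _ _ "c - 2 * k"] k_nonneg by (auto simp: beats_def)
  have yn: "near (w n) k (\<pi> (w n) (x n)) (b (w n))" using x by (simp add: realizes_def)
  \<comment> \<open>The position of \<open>T\<close> relative to \<open>w n\<close> decides. Below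
    \<open>w n\<close> the tuple is not near \<open>\<rho> T (w n)\<close>, so bounded image
    applies; otherwise \<open>x n\<close> is near \<open>\<rho> (w n) T\<close>, and the tuple has
    to be brought near the same set.\<close>
  have "near T (c + 5 * k) (\<pi> T (x n)) (b T)"
  proof (cases "nest T (w n)")
    case True
    show ?thesis
    proof (cases "T = w n")
      case True
      then show ?thesis using yn near_mono c k_nonneg by fastforce
    next
      case False
      have "near (w n) k (\<rho> (w (Suc i)) (w n)) (\<rho> T (w n))"
        using rho_nest[OF T(1) rel_if_proper[OF True False]] rn rel_not_orth by blast
      then have "\<not> near (w n) (k + k) (b (w n)) (\<rho> T (w n))"
        using farn near_trans_le[OF _ near_sym, of "w n" "k + k" _ _ k _ "3 * k"] by auto
      then have "near T k (\<pi> T (x n)) (b T)"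
        using tuple_bounded_image[OF True False yn] by blast
      then show ?thesis using near_mono c k_nonneg by fastforce
    qed
  next
    case False
    have "\<not> orth (w n) T" using T orth_nest2 rn rel_not_orth by blast
    then have r: "rel (w n) T" using False rn T nest_dom by (auto simp: rel_def)
    then have "near T (c + 4 * k) (b T) (\<rho> (w n) T)"
    proof (cases rule: rel_cases)
      case 1
      have "near T k (b T) (\<rho> (w n) T)"
      proof (rule ccontr)
        assume "\<not> near T k (b T) (\<rho> (w n) T)"
        then have "near (w n) k (b (w n)) (\<rho> T (w n))" using tuple_consistency r 1 by blast
        moreover have "near (w n) k (\<rho> (w (Suc i)) (w n)) (\<rho> T (w n))"
          using rho_nest[OF T(1) 1] rn rel_not_orth by blast
        ultimately have "near (w n) (3 * k) (b (w n)) (\<rho> (w (Suc i)) (w n))"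
          by (rule near_trans_le[OF _ near_sym]) (use k_nonneg in simp)
        then show False using farn by simp
      qed
      then show ?thesis using near_mono c k_nonneg by fastforce
    next
      case 2
      have "near T k (\<pi> T (x (Suc i))) (\<rho> (w (Suc i)) T)"
        using x[of "Suc i"] rel_if_proper[OF T(1)] T(2) by (auto simp: realizes_def)
      then have "near T (c + 3 * k) (\<pi> T (x (Suc i))) (b T)"
        using near_trans_le[OF _ near_sym[OF bT1]] by simp
      moreover have "\<not> near (w n) k (\<pi> (w n) (x (Suc i))) (b (w n))"
        using beats_far[OF Bn x] near_mono[of "w n" k _ _ "c - 2 * k - k"] c k_nonneg by auto
      ultimately have "near T (c + 3 * k + k) (b T) (\<rho> (w n) T)"
        using tuple_bounded_image 2 by blast
      then show ?thesis by (simp add: add.commute)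
    qed
    moreover have "near T k (\<pi> T (x n)) (\<rho> (w n) T)" using x r by (simp add: realizes_def)
    ultimately have "near T (c + 4 * k + k) (b T) (\<pi> T (x n))"
      by (rule near_trans[OF _ near_sym])
    then have "near T (c + 5 * k) (b T) (\<pi> T (x n))" by (simp add: add.commute)
    then show ?thesis by (rule near_sym)
  qed
  then have "near T (c + 5 * k) (b T) (\<pi> T (x n))" by (rule near_sym)
  then show ?thesis using near_trans_le[OF xT] by simp
qed

text \<open>In \<open>w j\<close> the point \<open>x i\<close> misses the tuple because
  \<open>w j\<close> beats \<open>w i\<close>, while \<open>x n\<close> is near it because
  \<open>x n\<close> is near the tuple in \<open>w n\<close>, which beats
  \<open>w j\<close>.\<close>

lemma chain_far:
  assumes ch: "chain c w"
    and x: "\<And>i. realizes (x i) (w i)" and ij: "i < j" "j < n"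
  shows "\<not> near (w j) k (\<pi> (w j) (x i)) (\<pi> (w j) (x n))"
proof
  have c: "6 * k \<le> c" using ch by (simp add: chain_def)
  assume n: "near (w j) k (\<pi> (w j) (x i)) (\<pi> (w j) (x n))"
  have "near (w n) k (\<pi> (w n) (x n)) (b (w n))" using x by (simp add: realizes_def)
  then have "near (w j) (2 * k) (\<pi> (w j) (x n)) (b (w j))"
    using beaten_near[OF chain_beats[OF ch ij(2)]] c k_nonneg by simp
  then have "near (w j) (c - 2 * k - k) (\<pi> (w j) (x i)) (b (w j))"
    using near_trans_le[OF n] c k_nonneg by simp
  then show False using beats_far[OF chain_beats[OF ch ij(1)] x] by simp
qed

text \<open>The bound must not depend on \<open>n\<close>. Two realizing points are boundedly close
  in \<open>T\<close> but far in each \<open>w j\<close> counted, so every such \<open>w j\<close>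
  lies below one of boundedly many \<open>T'\<close> of smaller rank.\<close>

lemma chain_bounded:
  assumes ch: "chain c w"
  shows "\<exists>g. \<forall>T n I. T \<in> Dom \<and> rank T \<le> r \<and> I \<subseteq> {1..<n} \<and>
    (\<forall>i\<in>I. nest (w i) T \<and> w i \<noteq> T) \<longrightarrow> card I \<le> g"
proof (induction r)
  case 0
  show ?case
  proof (intro exI[of _ 0] allI impI, elim conjE)
    fix T n I
    assume "T \<in> Dom" "rank T \<le> 0" "\<forall>i\<in>I. nest (w i) T \<and> w i \<noteq> T"
    then have "I = {}" using rank_less by fastforce
    then show "card I \<le> 0" by simp
  qed
next
  case (Suc r)
  then obtain g where g: "\<And>T n I. T \<in> Dom \<Longrightarrow> rank T \<le> r \<Longrightarrow> I \<subseteq> {1..<n} \<Longrightarrow>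
    \<forall>i\<in>I. nest (w i) T \<and> w i \<noteq> T \<Longrightarrow> card I \<le> g" by metis
  have "w i \<in> Dom" for i
    using ch by (auto simp: chain_def max_beats_def beats_def rel_def)
  then have "\<exists>x. realizes x (w i)" for i
    using realizes_exists[of "{w i}"] by auto
  then obtain x where x: "\<And>i. realizes (x i) (w i)" by metis
  have inj: "w i \<noteq> w j" if "i < j" for i j
    using chain_beats[OF ch that] rel_neq by (auto simp: beats_def)
  show ?case
  proof (intro exI[of _ "M (2 * c + 6 * k) * (1 + g)"] allI impI, elim conjE)
    fix T n I
    assume T: "T \<in> Dom" "rank T \<le> Suc r" and I: "I \<subseteq> {1..<n}"
      and sub: "\<forall>i\<in>I. nest (w i) T \<and> w i \<noteq> T"
    show "card I \<le> M (2 * c + 6 * k) * (1 + g)"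
    proof (cases "I = {}")
      case False
      have fin: "finite I" using I finite_subset by blast
      \<comment> \<open>Indices start at 1 so that the least one has a predecessor: closeness in
        \<open>T\<close> is known for the point realizing the member just before one properly below
        \<open>T\<close>.\<close>
      define i where "i = Min I - 1"
      have Min: "Min I \<in> I" using fin False by simp
      then have i: "Suc i \<in> I" using I by (auto simp: i_def)
      have le: "Suc i \<le> j" if "j \<in> I" for j
        using that fin Min_le[of I j] I Min unfolding i_def by (auto simp: subset_iff)
      have "near T (2 * c + 6 * k) (\<pi> T (x i)) (\<pi> T (x n))"
        using i I sub by (intro chain_near[OF ch x]) auto
      from large_links[OF T(1) this] obtain \<T> where \<T>: "finite \<T>" "card \<T> \<le> M (2 * c + 6 * k)"
        "\<forall>T'\<in>\<T>. nest T' T \<and> T' \<noteq> T"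
        "\<forall>V. nest V T \<and> V \<noteq> T \<and> \<not> near V k (\<pi> V (x i)) (\<pi> V (x n)) \<longrightarrow> (\<exists>T'\<in>\<T>. nest V T')"
        by blast
      define J where "J = (\<lambda>T'. {j \<in> I. nest (w j) T'})"
      have "I \<subseteq> (\<Union>T'\<in>\<T>. J T')"
      proof
        fix j assume j: "j \<in> I"
        have "i < j" "j < n" using le[OF j] I j by auto
        then have "\<not> near (w j) k (\<pi> (w j) (x i)) (\<pi> (w j) (x n))"
          using chain_far[OF ch x] by blast
        then show "j \<in> (\<Union>T'\<in>\<T>. J T')" using \<T>(4) sub j by (auto simp: J_def)
      qed
      then have "card I \<le> card (\<Union>T'\<in>\<T>. J T')"
        using \<T>(1) fin by (intro card_mono) (auto simp: J_def)
      also have "\<dots> \<le> (\<Sum>T'\<in>\<T>. card (J T'))" using \<T>(1) by (rule card_UN_le)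
      also have "\<dots> \<le> (\<Sum>T'\<in>\<T>. 1 + g)"
      proof (rule sum_mono)
        fix T' assume T': "T' \<in> \<T>"
        \<comment> \<open>A chain does not repeat, so at most one index gives \<open>T'\<close>
          itself; the others fall under the induction hypothesis. This is the source of
          \<open>1 + g\<close>.\<close>
        have "J T' = {j \<in> I. w j = T'} \<union> {j \<in> J T'. w j \<noteq> T'}"
          using nest_refl[of T'] nest_dom \<T>(3) T' unfolding J_def by blast
        then have "card (J T') \<le> card {j \<in> I. w j = T'} + card {j \<in> J T'. w j \<noteq> T'}"
          by (metis card_Un_le)
        moreover have "card {j \<in> I. w j = T'} \<le> 1"
        proof -
          have "j = j'" if "w j = T'" "w j' = T'" for j j'
            using inj that by (metis linorder_neqE_nat)
          then show ?thesis using fin by (simp add: card_le_Suc0_iff_eq)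
        qed
        moreover have "card {j \<in> J T'. w j \<noteq> T'} \<le> g"
        proof (rule g)
          show "T' \<in> Dom" "rank T' \<le> r"
            using \<T>(3) T' nest_dom rank_less T(2) by fastforce+
          show "{j \<in> J T'. w j \<noteq> T'} \<subseteq> {1..<n}" using I by (auto simp: J_def)
        qed (auto simp: J_def)
        ultimately show "card (J T') \<le> 1 + g" by linarith
      qed
      also have "\<dots> \<le> M (2 * c + 6 * k) * (1 + g)"
        using mult_le_mono1[OF \<T>(2), of "1 + g"] by simp
      finally show ?thesis .
    qed simp
  qed
qed

lemma no_chain:
  assumes ch: "chain c w"
  shows False
proof -
  have dom: "w i \<in> Dom" for i
    using ch by (auto simp: chain_def max_beats_def beats_def rel_def)
  obtain S where S: "\<And>V. V \<in> Dom \<Longrightarrow> nest V S" using top_exists[OF dom] by blast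
  have SD: "S \<in> Dom" using S[OF dom] nest_dom by blast
  have neq: "w i \<noteq> S" for i
    using ch S by (auto simp: chain_def max_beats_def beats_def rel_def)
  obtain g where g: "\<And>T n I. T \<in> Dom \<Longrightarrow> rank T \<le> N \<Longrightarrow> I \<subseteq> {1..<n} \<Longrightarrow>
    \<forall>i\<in>I. nest (w i) T \<and> w i \<noteq> T \<Longrightarrow> card I \<le> g"
    using chain_bounded[OF ch, of N] by metis
  \<comment> \<open>The interval has \<open>g + 1\<close> elements, and all the domains it indexes
    are properly below the top one.\<close>
  have "card {1..<g + 2} \<le> g"
    using g[of S "{1..<g + 2}" "g + 2"] SD rank_le S dom neq by blast
  then show False by simp
qed

text \<open>Otherwise dependent choice of maximal beaters, starting at \<open>W\<close>, produces a
  chain. Carrying along that the current domain beats \<open>W\<close> itself costs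
  \<open>2 * k\<close> in total.\<close>

lemma unbeaten_above:
  assumes c: "6 * k \<le> c" and W: "W \<in> Dom"
  shows "\<exists>W'. unbeaten c W' \<and> (W' = W \<or> beats (c - 2 * k) W' W)"
proof (rule ccontr)
  assume neg: "\<not> ?thesis"
  define P where "P = (\<lambda>W'. W' \<in> Dom \<and> (W' = W \<or> beats (c - 2 * k) W' W))"
  have "\<exists>V'. P V' \<and> max_beats c V' V" if V: "P V" for V
  proof -
    obtain V' where V': "max_beats c V' V"
      using neg V max_beats_exists by (metis P_def unbeaten_def)
    then have B: "beats c V' V" by (simp add: max_beats_def)
    then have "beats (c - 2 * k) V' W"
      using V beats_mono[OF B, of "c - 2 * k"] beats_trans[OF B, of "c - 2 * k" W] c k_nonneg
      by (auto simp: P_def)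
    then show ?thesis using V' B by (auto simp: P_def beats_def rel_def)
  qed
  moreover have "P W" using W by (simp add: P_def)
  ultimately obtain w where "\<And>i. max_beats c (w (Suc i)) (w i)"
    using dependent_nat_choice[of "\<lambda>_. P" "\<lambda>_ V V'. max_beats c V' V"] by metis
  then have "chain c w" using c by (simp add: chain_def)
  then show False using no_chain by blast
qed

section \<open>Improving a realized family\<close>

definition potential where
  "potential \<U> = (\<Sum>U\<in>\<U>. Suc N - rank U)"

lemma potential_le:
  assumes "\<U> \<subseteq> Dom" "pairwise orth \<U>" shows "potential \<U> \<le> m * Suc N"
proof -
  have "potential \<U> \<le> of_nat (card \<U>) * Suc N"
    unfolding potential_def by (rule sum_bounded_above) simp
  also have "\<dots> \<le> m * Suc N" using orth_bounded[OF assms] by (intro mult_le_mono1) simp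
  finally show ?thesis .
qed

text \<open>As the members are unbeaten and realized by \<open>x\<close>, a domain \<open>W\<close>
  where \<open>x\<close> misses the tuple is orthogonal to or properly below each of them. It gives
  way to an unbeaten \<open>V\<close> of the same kind. Raising the threshold by
  \<open>4 * k\<close> makes \<open>V\<close>, if different from \<open>W\<close>, beat
  \<open>W\<close> with \<open>c + 2 * k\<close>; this excludes \<open>rel U V\<close>, since there
  the tuple is within \<open>c\<close> of \<open>\<rho> U V\<close>, which is within
  \<open>2 * k\<close> of \<open>\<rho> W V\<close>.\<close>

lemma improve_family:
  assumes c: "6 * k \<le> c" and \<U>: "pairwise orth \<U>" "\<forall>U\<in>\<U>. unbeaten c U"
    and x: "\<forall>U\<in>\<U>. realizes x U"
    and W: "W \<in> Dom" "\<not> near W (c + k) (\<pi> W x) (b W)"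
  shows "\<exists>\<U>'. pairwise orth \<U>' \<and> (\<forall>U\<in>\<U>'. unbeaten (c + 4 * k) U) \<and> potential \<U> < potential \<U>'"
proof -
  have \<U>D: "\<U> \<subseteq> Dom" using \<U> by (auto simp: unbeaten_def)
  have fin: "finite \<U>" using orth_bounded[OF \<U>D \<U>(1)] by simp
  have near_U: "near V c (b V) (\<rho> U V)" if "U \<in> \<U>" "rel U V" for U V
    using \<U>(2) that unfolding unbeaten_def beats_def by blast
  have WU: "orth W U \<or> (nest W U \<and> W \<noteq> U)" if U: "U \<in> \<U>" for U
  proof -
    have "\<not> rel U W"
    proof
      assume "rel U W"
      then have "near W c (b W) (\<rho> U W)" "near W k (\<pi> W x) (\<rho> U W)"
        using near_U U x by (auto simp: realizes_def)
      then show False using W near_sym near_trans_le by (metis add.commute order_refl)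
    qed
    moreover have "W \<noteq> U"
      using x U W near_mono[of W k _ _ "c + k"] c k_nonneg by (auto simp: realizes_def)
    ultimately show ?thesis using W(1) U \<U>D orth_sym by (auto simp: rel_def)
  qed
  obtain V where V: "unbeaten (c + 4 * k) V" "V = W \<or> beats (c + 4 * k - 2 * k) V W"
    using unbeaten_above[of "c + 4 * k" W] c k_nonneg W(1) by auto
  have VU: "orth V U \<or> (nest V U \<and> V \<noteq> U)" if U: "U \<in> \<U>" for U
  proof (cases "V = W")
    case True
    then show ?thesis using WU U by simp
  next
    case False
    then have B: "beats (c + 2 * k) V W" using V(2) by (simp add: add.commute)
    then have r: "rel W V" by (simp add: beats_def)
    have far: "\<not> near V (c + 2 * k) (b V) (\<rho> W V)" using B by (simp add: beats_def)
    have "\<not> rel U V"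
    proof
      assume rU: "rel U V"
      have "near V (2 * k) (\<rho> U V) (\<rho> W V)"
      proof (cases "orth W U")
        case True
        then show ?thesis using rho_orth r rU near_sym by blast
      next
        case False
        then have "near V k (\<rho> W V) (\<rho> U V)"
          using rho_nest rU WU[OF U] r rel_not_orth by blast
        then show ?thesis using near_mono[OF near_sym] k_nonneg by simp
      qed
      then show False using near_U[OF U rU] near_trans_le far by blast
    qed
    moreover have "V \<noteq> U"
    proof
      assume eq: "V = U"
      have WV: "nest W V" "W \<noteq> V" using eq WU[OF U] r rel_not_orth by auto
      have "\<not> near W k (\<pi> W x) (b W)" using W near_mono[of W k _ _ "c + k"] c k_nonneg by fastforce
      moreover have "near V k (\<pi> V x) (b V)" using x U eq by (simp add: realizes_def)
      ultimately have "near V (k + k) (b V) (\<rho> W V)" using tuple_bounded_image WV by blast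
      then show False using far near_mono[of V "k + k" _ _ "c + 2 * k"] c k_nonneg by fastforce
    qed
    ultimately show ?thesis using U \<U>D r orth_sym by (auto simp: rel_def)
  qed
  \<comment> \<open>At most one member lies above \<open>V\<close>, since two would be orthogonal
    with \<open>V\<close> below both. Exchanging it for \<open>V\<close> lowers the rank and so
    raises the potential; if there is none, a positive summand is added.\<close>
  define \<U>' where "\<U>' = insert V {U \<in> \<U>. orth V U}"
  have "pairwise orth \<U>'"
    using \<U>(1) orth_sym by (auto simp: \<U>'_def pairwise_def)
  moreover have "\<forall>U\<in>\<U>'. unbeaten (c + 4 * k) U"
    using V(1) \<U>(2) unbeaten_mono[of c _ "c + 4 * k"] k_nonneg by (auto simp: \<U>'_def)
  moreover have "potential \<U> < potential \<U>'"
  proof -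
    have VD: "V \<in> Dom" using V by (simp add: unbeaten_def)
    have notin: "V \<notin> \<U>" using VU orth_irrefl by blast
    have pos: "rank V < Suc N" using rank_le[OF VD] by simp
    show ?thesis
    proof (cases "\<forall>U\<in>\<U>. orth V U")
      case True
      then have "\<U>' = insert V \<U>" by (auto simp: \<U>'_def)
      then show ?thesis using notin fin pos by (simp add: potential_def)
    next
      case False
      then obtain U where U: "U \<in> \<U>" "nest V U" "V \<noteq> U" using VU by blast
      have "\<U> - {U} \<subseteq> {U \<in> \<U>. orth V U}"
        using U \<U>(1) orth_nest by (auto simp: pairwise_def)
      moreover have "\<not> orth V U" using U orth_not_nest by blast
      ultimately have "{U \<in> \<U>. orth V U} = \<U> - {U}" by blast
      then have "potential \<U>' = (Suc N - rank V) + potential (\<U> - {U})"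
        using notin fin by (simp add: potential_def \<U>'_def)
      moreover have "potential \<U> = (Suc N - rank U) + potential (\<U> - {U})"
        unfolding potential_def using fin U by (simp add: sum.remove)
      ultimately show ?thesis using rank_less[OF U(2,3)] pos by linarith
    qed
  qed
  ultimately show ?thesis by blast
qed

text \<open>The process starts from the empty family with \<open>c = 6 * k\<close>. Each improvement
  adds \<open>4 * k\<close> to \<open>c\<close> and at least 1 to the potential, which never exceeds
  \<open>m * Suc N\<close>.\<close>

theorem realization:
  "\<exists>x. \<forall>W\<in>Dom. near W (7 * k + 4 * k * (m * Suc N)) (\<pi> W x) (b W)"
proof -
  have "\<exists>x. \<forall>W\<in>Dom. near W (c + k + 4 * k * r) (\<pi> W x) (b W)"
    if "6 * k \<le> c" "pairwise orth \<U>" "\<forall>U\<in>\<U>. unbeaten c U" "m * Suc N \<le> potential \<U> + r" for c r \<U>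
    using that
  proof (induction r arbitrary: c \<U>)
    case 0
    obtain x where x: "\<forall>U\<in>\<U>. realizes x U"
      using realizes_exists[of \<U>] 0 by (auto simp: unbeaten_def)
    have "near W (c + k) (\<pi> W x) (b W)" if W: "W \<in> Dom" for W
    proof (rule ccontr)
      assume "\<not> ?thesis"
      then obtain \<U>' where \<U>': "pairwise orth \<U>'" "\<forall>U\<in>\<U>'. unbeaten (c + 4 * k) U"
        "potential \<U> < potential \<U>'" using improve_family 0 x W by blast
      then have "potential \<U>' \<le> m * Suc N"
        using potential_le[of \<U>'] by (auto simp: unbeaten_def)
      then show False using \<U>'(3) 0 by linarith
    qed
    then show ?case by auto
  next
    case (Suc r)
    obtain x where x: "\<forall>U\<in>\<U>. realizes x U"
      using realizes_exists[of \<U>] Suc.prems by (auto simp: unbeaten_def)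
    show ?case
    proof (cases "\<forall>W\<in>Dom. near W (c + k) (\<pi> W x) (b W)")
      case True
      have "c + k \<le> c + k + 4 * k * Suc r" using k_nonneg by simp
      then show ?thesis using True near_mono by blast
    next
      case False
      then obtain \<U>' where \<U>': "pairwise orth \<U>'" "\<forall>U\<in>\<U>'. unbeaten (c + 4 * k) U"
        "potential \<U> < potential \<U>'" using improve_family Suc.prems x by blast
      have "\<exists>x. \<forall>W\<in>Dom. near W (c + 4 * k + k + 4 * k * r) (\<pi> W x) (b W)"
        using Suc.IH[OF _ \<U>'(1,2)] Suc.prems \<U>'(3) k_nonneg by simp
      then show ?thesis by (simp add: algebra_simps)
    qed
  qed
  from this[of "6 * k" "{}" "m * Suc N"] show ?thesis by (simp add: potential_def)
qed

end

context coarse_hierarchy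
begin

section \<open>Gates\<close>

text \<open>The tuple behind a gate is shown consistent with a multiple of \<open>k\<close>; the
  hierarchy is moved to the same constant so that the realization theorem applies.\<close>

lemma coarse_hierarchy_mono:
  assumes "k \<le> k'" shows "coarse_hierarchy Dom nest orth near \<pi> \<rho> k' M rank N m"
proof unfold_locales
  note mono = near_mono[OF _ assms]
  show "0 \<le> k'" using k_nonneg assms by simp
  show "near W k' (\<pi> W x) (\<pi> W x)" if "W \<in> Dom" for W x using mono[OF near_self[OF that]] .
  show "near W k' (\<pi> W x) (\<rho> V W) \<or> near V k' (\<pi> V x) (\<rho> W V)" if "rel V W" "rel W V" for V W x
    using consistency[OF that] mono by blast
  show "near W (s + k') (\<pi> W y) (\<rho> V W)"
    if "nest V W" "V \<noteq> W" "near W s (\<pi> W x) (\<pi> W y)" "\<not> near V k' (\<pi> V x) (\<pi> V y)" for V W s x y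
  proof -
    have "near W (s + k) (\<pi> W y) (\<rho> V W)" using bounded_image[OF that(1-3)] that(4) mono by blast
    then show ?thesis using near_mono assms by simp
  qed
  show "near W k' (\<rho> U W) (\<rho> V W)" if "nest U V" "rel V W" "\<not> orth U W" for U V W
    using mono[OF rho_nest[OF that]] .
  show "\<exists>x. \<forall>V\<in>\<V>. near V k' (\<pi> V x) (\<pi> V (p V)) \<and> (\<forall>W. rel V W \<longrightarrow> near W k' (\<pi> W x) (\<rho> V W))"
    if "\<V> \<subseteq> Dom" "pairwise orth \<V>" for \<V> p
    using partial_realization[OF that] mono by meson
  show "\<exists>\<T>. finite \<T> \<and> card \<T> \<le> M s \<and> (\<forall>T\<in>\<T>. nest T W \<and> T \<noteq> W) \<and>
        (\<forall>V. nest V W \<and> V \<noteq> W \<and> \<not> near V k' (\<pi> V x) (\<pi> V y) \<longrightarrow> (\<exists>T\<in>\<T>. nest V T))"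
    if "W \<in> Dom" "near W s (\<pi> W x) (\<pi> W y)" for W s x y
    using large_links[OF that] mono by meson
qed (fact near_sym near_trans near_mono near_nonneg top_exists rank_less rank_le orth_bounded)+

lemma near_rho_comparable:
  assumes "rel U W" "rel V W" "nest U V \<or> nest V U \<or> orth U V"
  shows "near W (2 * k) (\<rho> U W) (\<rho> V W)"
proof -
  have le: "near W (2 * k) (\<rho> U W) (\<rho> V W)" if "nest U V" "rel U W" "rel V W" for U V
    using near_mono[OF rho_nest[OF that(1,3)]] rel_not_orth that k_nonneg by simp
  show ?thesis using assms le[of U V] near_sym[OF le[of V U]] rho_orth by blast
qed

section \<open>Comparing the sets assigned to pairs\<close>

definition pair_rho where
  "pair_rho A W = \<rho> (pair_rep A W) W"

lemma pair_rho_singleton: "rel V W \<Longrightarrow> pair_rho (V, {}) W = \<rho> V W"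
  by (simp add: pair_rho_def pair_rep_singleton)

text \<open>Whatever the two representatives are, they are comparable or orthogonal, and then their
  sets are close. The combination of \<open>rel (fst B) W\<close> with \<open>W\<close> below
  \<open>fst A\<close> cannot occur, since \<open>fst A\<close> lies below
  \<open>fst B\<close>.\<close>

lemma pair_rho_nest:
  assumes A: "A \<in> pairs" and B: "B \<in> pairs" and AB: "pair_nest A B"
    and BW: "pair_rel B W" and AW: "\<not> pair_orth A (W, {})"
  shows "near W (2 * k) (pair_rho A W) (pair_rho B W)"
proof -
  have relA: "pair_rel A W"
    using BW AW AB pair_nest_trans unfolding pair_rel_def by blast
  let ?u = "pair_rep A W" and ?v = "pair_rep B W"
  have "nest ?u ?v \<or> nest ?v ?u \<or> orth ?u ?v"
  proof (rule pair_rep_cases[OF A relA]; rule pair_rep_cases[OF B BW])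
    assume "?u = fst A" "?v = fst B"
    then show ?thesis using AB by (simp add: pair_nest_def)
  next
    assume h: "?u = fst A" "?v \<in> snd B"
    then consider "orth ?v (fst A)" | x where "x \<in> snd A" "nest ?v x"
      using AB by (auto simp: pair_nest_def)
    then show ?thesis
      using h(1) orth_sym nest_trans[OF _ pairs_snd[OF A]] by cases auto
  next
    assume h: "rel (fst B) W" "nest W (fst A)"
    then show ?thesis using AB nest_trans by (auto simp: pair_nest_def rel_def)
  next
    assume h: "nest W (fst A)" "?u \<in> snd A" "?v \<in> snd B" "rel ?v W"
    have "\<not> orth ?v (fst A)" using orth_nest2[OF h(1)] rel_not_orth(1)[OF h(4)] by blast
    then obtain x where x: "x \<in> snd A" "nest ?v x"
      using AB h(3) by (auto simp: pair_nest_def)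
    then show ?thesis
      using h(2) pairs_snd_pairwise[OF A] orth_nest orth_sym unfolding pairwise_def by metis
  qed
  then show ?thesis
    unfolding pair_rho_def using near_rho_comparable pair_rep_rel A relA B BW by blast
qed

text \<open>Again the representatives are comparable or orthogonal. If the first components are
  orthogonal, \<open>W\<close> is below neither, so they are the representatives. If
  \<open>fst B\<close> lies below some \<open>x\<close> in \<open>snd A\<close>, it represents
  \<open>B\<close>, and the representative of \<open>A\<close> lies above it, equals
  \<open>x\<close> or is orthogonal to \<open>x\<close>.\<close>

lemma pair_rho_orth:
  assumes A: "A \<in> pairs" and B: "B \<in> pairs" and AB: "pair_orth A B"
    and AW: "pair_rel A W" and BW: "pair_rel B W"
  shows "near W (2 * k) (pair_rho A W) (pair_rho B W)"
proof -
  have below: "nest (pair_rep A W) (pair_rep B W) \<or> nest (pair_rep B W) (pair_rep A W) \<or>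
      orth (pair_rep A W) (pair_rep B W)"
    if A: "A \<in> pairs" and B: "B \<in> pairs" and AW: "pair_rel A W" and BW: "pair_rel B W"
      and x: "x \<in> snd A" "nest (fst B) x" for A B x
  proof (rule pair_rep_cases[OF B BW])
    assume "nest W (fst B)"
    then have "pair_orth A (W, {})" using nest_trans x by (auto simp: pair_orth_singleton_iff)
    then show ?thesis using AW by (simp add: pair_rel_def)
  next
    assume v: "pair_rep B W = fst B"
    show ?thesis
    proof (rule pair_rep_cases[OF A AW])
      assume "pair_rep A W = fst A"
      then show ?thesis using v nest_trans[OF x(2) pairs_snd[OF A x(1)]] by simp
    next
      assume "pair_rep A W \<in> snd A"
      then show ?thesis
        using v x pairs_snd_pairwise[OF A] orth_nest orth_sym unfolding pairwise_def by metis
    qed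
  qed
  consider "orth (fst A) (fst B)" | x where "x \<in> snd A" "nest (fst B) x"
    | y where "y \<in> snd B" "nest (fst A) y"
    using AB by (auto simp: pair_orth_def)
  then have "nest (pair_rep A W) (pair_rep B W) \<or> nest (pair_rep B W) (pair_rep A W) \<or>
      orth (pair_rep A W) (pair_rep B W)"
  proof cases
    case 1
    then have "\<not> nest W (fst A)" "\<not> nest W (fst B)"
      using AW BW orth_nest[of W "fst A" "fst B"] orth_nest2[of W "fst B" "fst A"] orth_sym
      by (auto simp: pair_rel_def pair_orth_singleton_iff)
    then have "pair_rep A W = fst A" "pair_rep B W = fst B"
      using pair_rep_cases[OF A AW] pair_rep_cases[OF B BW] by metis+
    then show ?thesis using 1 by simp
  next
    case 2
    then show ?thesis using below[OF A B AW BW] by blast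
  next
    case 3
    then show ?thesis using below[OF B A BW AW] orth_sym by blast
  qed
  then show ?thesis
    unfolding pair_rho_def using near_rho_comparable pair_rep_rel A AW B BW by blast
qed

text \<open>A domain \<open>V\<close> with \<open>pair_rel A V\<close> false is orthogonal to
  \<open>A\<close> or contained in it, so regarding \<open>V\<close> as a pair reduces the claim to
  the two preceding comparisons. It settles consistency between \<open>V\<close> and
  \<open>W\<close> whatever the coordinate at \<open>V\<close> is.\<close>

lemma pair_rho_uncontrolled:
  assumes A: "A \<in> pairs" and AW: "pair_rel A W" and AV: "\<not> pair_rel A V" and VW: "rel V W"
  shows "near W (2 * k) (pair_rho A W) (\<rho> V W)"
proof -
  have V: "(V, {}) \<in> pairs" "pair_rel (V, {}) W" "\<not> pair_orth (V, {}) (W, {})"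
    using VW by (simp_all add: pairs_singleton pair_rel_singleton rel_dom pair_orth_singletons
        rel_not_orth)
  consider "pair_orth A (V, {})" | "pair_nest (V, {}) A"
    using AV VW by (auto simp: pair_rel_def rel_def)
  then have "near W (2 * k) (pair_rho A W) (pair_rho (V, {}) W)"
    using pair_rho_orth[OF A V(1) _ AW V(2)] near_sym[OF pair_rho_nest[OF V(1) A _ AW V(3)]]
    by cases auto
  then show ?thesis using VW by (simp add: pair_rho_singleton)
qed

text \<open>The first two summands come from realizing a tuple that is consistent up to
  \<open>6 * k\<close>; the last is the distance from that tuple to \<open>pair_rho\<close>.\<close>

definition gate_const where
  "gate_const = 7 * (6 * k) + 4 * (6 * k) * (m * Suc N) + 3 * k"

text \<open>The tuple takes its coordinates from \<open>z\<close> in domains controlled by no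
  \<open>A\<close>, and otherwise from one of two points attached to a controlling \<open>A\<close>.
  There are two because \<open>fst A\<close> is not orthogonal to the elements of
  \<open>snd A\<close> below it, so partial realization does not treat them together. Coordinates
  taken from one point inherit its consistency; in the other cases a comparison of relative
  projections decides.\<close>

lemma gate:
  assumes \<A>: "\<A> \<subseteq> pairs" "pairwise pair_orth \<A>"
  obtains y where
    "\<And>A W. A \<in> \<A> \<Longrightarrow> pair_rel A W \<Longrightarrow> near W gate_const (\<pi> W y) (pair_rho A W)"
    "\<And>W. W \<in> Dom \<Longrightarrow> (\<And>A. A \<in> \<A> \<Longrightarrow> \<not> pair_rel A W) \<Longrightarrow> near W gate_const (\<pi> W y) (\<pi> W z)"
proof -
  have "\<exists>t. \<forall>W. rel (fst A) W \<longrightarrow> near W k (\<pi> W t) (\<rho> (fst A) W)" if "A \<in> \<A>" for A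
    using partial_realization[of "{fst A}"] pairs_fst that \<A>(1) by fastforce
  then obtain t where t: "\<And>A W. A \<in> \<A> \<Longrightarrow> rel (fst A) W \<Longrightarrow> near W k (\<pi> W (t A)) (\<rho> (fst A) W)"
    by metis
  have "\<exists>u. \<forall>x\<in>snd A. \<forall>W. rel x W \<longrightarrow> near W k (\<pi> W u) (\<rho> x W)" if A: "A \<in> \<A>" for A
  proof -
    have "snd A \<subseteq> Dom" using pairs_snd nest_dom A \<A>(1) by blast
    moreover have "pairwise orth (snd A)" using pairs_snd_pairwise A \<A>(1) by blast
    ultimately show ?thesis using partial_realization[of "snd A" undefined] by blast
  qed
  then obtain u where u: "\<And>A x W. A \<in> \<A> \<Longrightarrow> x \<in> snd A \<Longrightarrow> rel x W \<Longrightarrow>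
      near W k (\<pi> W (u A)) (\<rho> x W)"
    by metis
  define g where "g = (\<lambda>A W. if rel (fst A) W then t A else u A)"
  define ctrl where "ctrl = (\<lambda>W. SOME A. A \<in> \<A> \<and> pair_rel A W)"
  define \<beta> where "\<beta> = (\<lambda>W. if \<exists>A\<in>\<A>. pair_rel A W then g (ctrl W) W else z)"
  have g: "near W k (\<pi> W (g A W)) (pair_rho A W)" if A: "A \<in> \<A>" "pair_rel A W" for A W
  proof (rule pair_rep_cases[of A W])
    show "A \<in> pairs" "pair_rel A W" using A \<A>(1) by auto
  qed (use t[OF A(1)] u[OF A(1)] in \<open>auto simp: pair_rho_def g_def\<close>)
  have ctrl: "ctrl W \<in> \<A> \<and> pair_rel (ctrl W) W \<and> \<beta> W = g (ctrl W) W"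
    if "A \<in> \<A>" "pair_rel A W" for A W
    using someI[of "\<lambda>A. A \<in> \<A> \<and> pair_rel A W" A] that by (auto simp: ctrl_def \<beta>_def)
  \<comment> \<open>Choosing another controlling pair moves the set by at most \<open>2 * k\<close>,
    because the family is pairwise orthogonal.\<close>
  have \<beta>: "near W (3 * k) (\<pi> W (\<beta> W)) (pair_rho A W)" if A: "A \<in> \<A>" "pair_rel A W" for A W
  proof -
    have c: "ctrl W \<in> \<A>" "pair_rel (ctrl W) W" "\<beta> W = g (ctrl W) W" using ctrl[OF A] by auto
    then have n: "near W k (\<pi> W (\<beta> W)) (pair_rho (ctrl W) W)" using g by simp
    show ?thesis
    proof (cases "ctrl W = A")
      case True
      then show ?thesis using near_mono[OF n] k_nonneg by simp
    next
      case False
      then have "pair_orth (ctrl W) A" using \<A>(2) c(1) A(1) by (auto simp: pairwise_def)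
      then have "near W (2 * k) (pair_rho (ctrl W) W) (pair_rho A W)"
        using pair_rho_orth c A \<A>(1) by blast
      then show ?thesis using near_trans_le[OF n] by simp
    qed
  qed
  have unctrl: "near W (5 * k) (\<pi> W (\<beta> W)) (\<rho> V W)"
    if "A \<in> \<A>" "pair_rel A W" "\<not> pair_rel A V" "rel V W" for A V W
    using near_trans_le[OF \<beta>[OF that(1,2)] pair_rho_uncontrolled[OF _ that(2-4)]] that(1) \<A>(1) by auto
  \<comment> \<open>If one \<open>A\<close> uses different points for \<open>V\<close> and
    \<open>W\<close>, the domain not related to \<open>fst A\<close> lies below
    \<open>fst A\<close>, so its set in the other domain is near that of
    \<open>fst A\<close>.\<close>
  have mixed: "near W (5 * k) (\<pi> W (\<beta> W)) (\<rho> V W) \<or>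
      (rel W V \<and> near V (5 * k) (\<pi> V (\<beta> V)) (\<rho> W V))"
    if A: "A \<in> \<A>" "pair_rel A W" "pair_rel A V" and VW: "rel V W"
      and ne: "rel (fst A) V \<noteq> rel (fst A) W" for A V W
  proof -
    have *: "near W (5 * k) (\<pi> W (\<beta> W)) (\<rho> V W)"
      if "pair_rel A W" "pair_rel A V" "rel V W" "rel (fst A) W" "\<not> rel (fst A) V" for V W
    proof -
      have "nest V (fst A)" using pair_rep_cases[of A V] A(1) \<A>(1) that by blast
      then have "near W k (\<rho> V W) (pair_rho A W)"
        using rho_nest[OF _ that(4)] that(3,4) rel_not_orth by (simp add: pair_rho_def pair_rep_def)
      then show ?thesis using near_trans_le[OF \<beta>[OF A(1) that(1)] near_sym] k_nonneg by simp
    qed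
    show ?thesis
    proof (cases "rel (fst A) W")
      case True
      then show ?thesis using *[OF A(2,3) VW] ne by simp
    next
      case False
      then have "nest W (fst A)" using pair_rep_cases[of A W] A \<A>(1) by blast
      then have "\<not> nest V W" using False ne nest_trans by (auto simp: rel_def)
      then have "rel W V" using VW orth_sym by (auto simp: rel_def)
      then show ?thesis using *[OF A(3,2)] False ne by simp
    qed
  qed
  have same: "near V (4 * k) (\<pi> V (g A W)) (\<pi> V (\<beta> V))"
    if A: "A \<in> \<A>" "pair_rel A V" and eq: "rel (fst A) V = rel (fst A) W" for A V W
  proof -
    have "g A W = g A V" using eq by (simp add: g_def)
    then show ?thesis using near_trans_le[OF g[OF A] near_sym[OF \<beta>[OF A]]] by simp
  qed
  have free: "\<beta> W = z" if "\<not> (\<exists>A\<in>\<A>. pair_rel A W)" for W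
    using that by (simp add: \<beta>_def)
  have C1: "near W (6 * k) (\<pi> W (\<beta> W)) (\<rho> V W) \<or> near V (6 * k) (\<pi> V (\<beta> V)) (\<rho> W V)"
    if VW: "rel V W" "rel W V" for V W
  proof -
    have "near W (5 * k) (\<pi> W (\<beta> W)) (\<rho> V W) \<or> near V (5 * k) (\<pi> V (\<beta> V)) (\<rho> W V)"
    proof (cases "\<exists>A\<in>\<A>. pair_rel A W")
      case True
      define A where "A = ctrl W"
      have A: "A \<in> \<A>" "pair_rel A W" "\<beta> W = g A W" using True ctrl by (auto simp: A_def)
      consider "\<not> pair_rel A V" | "pair_rel A V" "rel (fst A) V \<noteq> rel (fst A) W"
        | "pair_rel A V" "rel (fst A) V = rel (fst A) W" by blast
      then show ?thesis
      proof cases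
        case 1
        then show ?thesis using unctrl A VW by blast
      next
        case 2
        then show ?thesis using mixed A VW by blast
      next
        case 3
        consider "near W k (\<pi> W (g A W)) (\<rho> V W)" | "near V k (\<pi> V (g A W)) (\<rho> W V)"
          using consistency VW by blast
        then show ?thesis
        proof cases
          case 1
          then show ?thesis using A(3) near_mono[OF 1, of "5 * k"] k_nonneg by simp
        next
          case 2
          then show ?thesis using near_trans_le[OF near_sym[OF same[OF A(1) 3]] 2] by simp
        qed
      qed
    next
      case False
      show ?thesis
      proof (cases "\<exists>A\<in>\<A>. pair_rel A V")
        case True
        then show ?thesis using unctrl[of _ V W] False VW by blast
      next
        case F: False
        consider "near W k (\<pi> W z) (\<rho> V W)" | "near V k (\<pi> V z) (\<rho> W V)"
          using consistency VW by blast
        then show ?thesis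
          using near_mono[of _ k _ _ "5 * k"] k_nonneg free[OF False] free[OF F] by cases auto
      qed
    qed
    then show ?thesis using near_mono[of _ "5 * k" _ _ "6 * k"] k_nonneg by auto
  qed
  have C2: "near W (s + 6 * k) (\<pi> W (\<beta> W)) (\<rho> V W)"
    if VW: "nest V W" "V \<noteq> W" and s: "near W s (\<pi> W x) (\<pi> W (\<beta> W))"
      and far: "\<not> near V (6 * k) (\<pi> V x) (\<pi> V (\<beta> V))" for V W s x
  proof -
    have s0: "0 \<le> s" using near_nonneg s by blast
    have r: "rel V W" "\<not> rel W V" using VW rel_if_proper by (auto simp: rel_def)
    have direct: ?thesis if "near W (5 * k) (\<pi> W (\<beta> W)) (\<rho> V W)"
      using near_mono[OF that] s0 k_nonneg by simp
    show ?thesis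
    proof (cases "\<exists>A\<in>\<A>. pair_rel A W")
      case True
      define A where "A = ctrl W"
      have A: "A \<in> \<A>" "pair_rel A W" "\<beta> W = g A W" using True ctrl by (auto simp: A_def)
      consider "\<not> pair_rel A V" | "pair_rel A V" "rel (fst A) V \<noteq> rel (fst A) W"
        | "pair_rel A V" "rel (fst A) V = rel (fst A) W" by blast
      then show ?thesis
      proof cases
        case 1
        then show ?thesis using unctrl A r direct by blast
      next
        case 2
        then show ?thesis using mixed A r direct by blast
      next
        case 3
        have "\<not> near V k (\<pi> V x) (\<pi> V (g A W))"
          using far near_trans_le[OF _ same[OF A(1) 3], of k _ "6 * k"] k_nonneg by auto
        then have "near W (s + k) (\<pi> W (\<beta> W)) (\<rho> V W)" using bounded_image VW s A(3) by simp
        then show ?thesis using near_mono[of W "s + k" _ _ "s + 6 * k"] k_nonneg by simp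
      qed
    next
      case False
      \<comment> \<open>Being orthogonal to or contained in \<open>A\<close> is inherited by smaller
        domains, so an uncontrolled \<open>W\<close> has only uncontrolled domains below it.\<close>
      have "\<not> (\<exists>A\<in>\<A>. pair_rel A V)"
      proof
        assume "\<exists>A\<in>\<A>. pair_rel A V"
        then obtain A where A: "A \<in> \<A>" "pair_rel A V" by blast
        have VW': "pair_nest (V, {}) (W, {})" using VW by (simp add: pair_nest_singletons)
        have "W \<in> Dom" using VW nest_dom by blast
        then consider "pair_orth A (W, {})" | "pair_nest (W, {}) A"
          using False A(1) by (auto simp: pair_rel_def)
        then show False
          using A(2) pair_orth_nest[OF VW'] pair_orth_sym pair_nest_trans[OF VW']
          unfolding pair_rel_def by cases blast+
      qed
      then have eq: "\<beta> V = z" "\<beta> W = z" using free False by auto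
      have "\<not> near V k (\<pi> V x) (\<pi> V z)"
        using far eq near_mono[of V k _ _ "6 * k"] k_nonneg by auto
      then have "near W (s + k) (\<pi> W (\<beta> W)) (\<rho> V W)" using bounded_image VW s eq by simp
      then show ?thesis using near_mono[of W "s + k" _ _ "s + 6 * k"] k_nonneg by simp
    qed
  qed
  interpret h: coarse_hierarchy Dom nest orth near \<pi> \<rho> "6 * k" M rank N m
    using coarse_hierarchy_mono k_nonneg by simp
  interpret consistent_tuple Dom nest orth near \<pi> \<rho> "6 * k" M rank N m \<beta>
    by unfold_locales (fact C1 C2)+
  obtain y where y: "\<And>W. W \<in> Dom \<Longrightarrow>
      near W (7 * (6 * k) + 4 * (6 * k) * (m * Suc N)) (\<pi> W y) (\<pi> W (\<beta> W))"
    using realization by auto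
  show ?thesis
  proof (rule that[of y])
    show "near W gate_const (\<pi> W y) (pair_rho A W)" if "A \<in> \<A>" "pair_rel A W" for A W
      unfolding gate_const_def
      by (rule near_trans[OF y \<beta>[OF that]]) (use that in \<open>simp add: pair_rel_def\<close>)
    show "near W gate_const (\<pi> W y) (\<pi> W z)" if "W \<in> Dom" "\<And>A. A \<in> \<A> \<Longrightarrow> \<not> pair_rel A W" for W
      using near_mono[OF y[OF that(1)], of gate_const] free[of W] that k_nonneg
      by (auto simp: gate_const_def)
  qed
qed

section \<open>Large links and complexity for pairs\<close>

text \<open>The domains \<open>V\<close> produced can carry a pair formed with the elements of
  \<open>X\<close> below \<open>V\<close>. A \<open>T\<close> not yet of this kind and below no
  \<open>x\<close> is controlled by \<open>A\<close>, so \<open>y\<close> and \<open>y'\<close> are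
  close there and large links lead to boundedly many domains of smaller rank. Below an
  \<open>x\<close> nothing is contained in \<open>A\<close>, and the empty cover will do.\<close>

lemma clean_cover:
  assumes A: "A \<in> pairs"
    and close: "\<And>W. pair_rel A W \<Longrightarrow> near W s (\<pi> W y) (\<pi> W y')"
    and T: "nest T (fst A)"
    and r: "rank T < r"
  shows "\<exists>\<W>. finite \<W> \<and> card \<W> \<le> Suc (M s) ^ r \<and>
    (\<forall>V\<in>\<W>. nest V T \<and> (\<forall>x\<in>snd A. orth x V \<or> (nest x V \<and> V \<noteq> fst A)) \<and> (V = fst A \<longrightarrow> snd A = {})) \<and>
    (\<forall>Q. pair_nest (Q, {}) A \<and> nest Q T \<and> \<not> near Q k (\<pi> Q y) (\<pi> Q y') \<longrightarrow> (\<exists>V\<in>\<W>. nest Q V))"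
  using T r
proof (induction r arbitrary: T)
  case (Suc r)
  consider "\<forall>x\<in>snd A. orth x T \<or> (nest x T \<and> T \<noteq> fst A)" | x where "x \<in> snd A" "nest T x"
    | x where "x \<in> snd A" "\<not> orth x T" "\<forall>x\<in>snd A. \<not> nest T x" by blast
  then show ?case
  proof cases
    case 1
    moreover have "T = fst A \<longrightarrow> snd A = {}"
      using 1 pairs_snd[OF A] orth_not_nest by blast
    ultimately show ?thesis
      using nest_refl nest_dom Suc.prems(1)
      by (intro exI[of _ "{T}"]) (auto simp: Suc_le_eq simp del: power_Suc)
  next
    case (2 x)
    have "False" if Q: "pair_nest (Q, {}) A" "nest Q T" for Q
      using that 2 nest_trans orth_not_nest orth_sym unfolding pair_nest_singleton_iff by blast
    then show ?thesis by (intro exI[of _ "{}"]) auto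
  next
    case (3 x)
    have TD: "T \<in> Dom" using Suc.prems(1) nest_dom by blast
    have "pair_rel A T"
      using 3 TD Suc.prems(1) orth_not_nest orth_sym
      unfolding pair_rel_def pair_orth_singleton_iff pair_nest_singleton_iff by blast
    from large_links[OF TD close[OF this]] obtain \<T> where \<T>: "finite \<T>" "card \<T> \<le> M s"
      "\<forall>T'\<in>\<T>. nest T' T \<and> T' \<noteq> T"
      "\<forall>V. nest V T \<and> V \<noteq> T \<and> \<not> near V k (\<pi> V y) (\<pi> V y') \<longrightarrow> (\<exists>T'\<in>\<T>. nest V T')"
      by blast
    have "\<exists>\<W>. finite \<W> \<and> card \<W> \<le> Suc (M s) ^ r \<and>
      (\<forall>V\<in>\<W>. nest V T' \<and> (\<forall>x\<in>snd A. orth x V \<or> (nest x V \<and> V \<noteq> fst A)) \<and> (V = fst A \<longrightarrow> snd A = {})) \<and>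
      (\<forall>Q. pair_nest (Q, {}) A \<and> nest Q T' \<and> \<not> near Q k (\<pi> Q y) (\<pi> Q y') \<longrightarrow> (\<exists>V\<in>\<W>. nest Q V))"
      if T': "T' \<in> \<T>" for T'
    proof (rule Suc.IH)
      show "nest T' (fst A)" using \<T>(3) T' nest_trans Suc.prems(1) by blast
      show "rank T' < r" using \<T>(3) T' rank_less Suc.prems(2) by fastforce
    qed
    then obtain \<W> where \<W>: "\<And>T'. T' \<in> \<T> \<Longrightarrow> finite (\<W> T') \<and> card (\<W> T') \<le> Suc (M s) ^ r \<and>
      (\<forall>V\<in>\<W> T'. nest V T' \<and> (\<forall>x\<in>snd A. orth x V \<or> (nest x V \<and> V \<noteq> fst A)) \<and> (V = fst A \<longrightarrow> snd A = {})) \<and>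
      (\<forall>Q. pair_nest (Q, {}) A \<and> nest Q T' \<and> \<not> near Q k (\<pi> Q y) (\<pi> Q y') \<longrightarrow> (\<exists>V\<in>\<W> T'. nest Q V))"
      by metis
    show ?thesis
    proof (intro exI[of _ "\<Union>T'\<in>\<T>. \<W> T'"] conjI allI impI)
      show "finite (\<Union>T'\<in>\<T>. \<W> T')" using \<T>(1) \<W> by blast
      have "card (\<Union>T'\<in>\<T>. \<W> T') \<le> (\<Sum>T'\<in>\<T>. card (\<W> T'))" using \<T>(1) by (rule card_UN_le)
      also have "\<dots> \<le> of_nat (card \<T>) * Suc (M s) ^ r" using \<W> by (intro sum_bounded_above) simp
      also have "\<dots> \<le> Suc (M s) * Suc (M s) ^ r" using \<T>(2) by (intro mult_le_mono1) simp
      finally show "card (\<Union>T'\<in>\<T>. \<W> T') \<le> Suc (M s) ^ Suc r" by simp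
      show "\<forall>V\<in>\<Union>T'\<in>\<T>. \<W> T'. nest V T \<and> (\<forall>x\<in>snd A. orth x V \<or> (nest x V \<and> V \<noteq> fst A)) \<and> (V = fst A \<longrightarrow> snd A = {})"
      proof
        fix V assume "V \<in> (\<Union>T'\<in>\<T>. \<W> T')"
        then obtain T' where T': "T' \<in> \<T>" "V \<in> \<W> T'" by blast
        then show "nest V T \<and> (\<forall>x\<in>snd A. orth x V \<or> (nest x V \<and> V \<noteq> fst A)) \<and> (V = fst A \<longrightarrow> snd A = {})"
          using \<W>[OF T'(1)] \<T>(3) nest_trans[of V T' T] by blast
      qed
      fix Q assume Q: "pair_nest (Q, {}) A \<and> nest Q T \<and> \<not> near Q k (\<pi> Q y) (\<pi> Q y')"
      then have "Q \<noteq> T" using 3 by (auto simp: pair_nest_singleton_iff)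
      then obtain T' where "T' \<in> \<T>" "nest Q T'" using Q \<T>(4) by blast
      then show "\<exists>V\<in>\<Union>T'\<in>\<T>. \<W> T'. nest Q V" using \<W>[of T'] Q by blast
    qed
  qed
qed simp

text \<open>Two points project close to each other in the domains transverse to some element of \<open>X\<close>
  once they are replaced by their gates to \<open>(T, X)\<close>, which does not change them in the domains
  nested in \<open>(T, X)\<close>. Hence the large links axiom can be iterated below \<open>T\<close> until it only
  yields domains that support a pair nested in \<open>(T, X)\<close>.\<close>

lemma pair_large_links:
  assumes A: "A \<in> pairs" "snd A \<noteq> {}"
  shows "\<exists>\<T>. finite \<T> \<and> card \<T> \<le> Suc (M (2 * gate_const)) ^ Suc N \<and>
    (\<forall>B\<in>\<T>. B \<in> pairs \<and> pair_nest B A \<and> B \<noteq> A) \<and>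
    (\<forall>Q. pair_nest (Q, {}) A \<and> \<not> near Q (k + 2 * gate_const) (\<pi> Q x) (\<pi> Q x') \<longrightarrow>
      (\<exists>B\<in>\<T>. pair_nest (Q, {}) B))"
proof -
  have "\<exists>y. (\<forall>W. pair_rel A W \<longrightarrow> near W gate_const (\<pi> W y) (pair_rho A W)) \<and>
      (\<forall>W. pair_nest (W, {}) A \<longrightarrow> near W gate_const (\<pi> W y) (\<pi> W z))" for z
  proof -
    have "{A} \<subseteq> pairs" "pairwise pair_orth {A}" using A by auto
    then obtain y where
      "\<And>C W. C \<in> {A} \<Longrightarrow> pair_rel C W \<Longrightarrow> near W gate_const (\<pi> W y) (pair_rho C W)"
      "\<And>W. W \<in> Dom \<Longrightarrow> (\<And>C. C \<in> {A} \<Longrightarrow> \<not> pair_rel C W) \<Longrightarrow>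
        near W gate_const (\<pi> W y) (\<pi> W z)"
      by (rule gate[where z = z]) blast
    moreover have "W \<in> Dom \<and> \<not> pair_rel A W" if "pair_nest (W, {}) A" for W
      using that nest_dom by (auto simp: pair_rel_def pair_nest_def)
    ultimately show ?thesis by blast
  qed
  then obtain y y' where
    y: "\<And>W. pair_rel A W \<Longrightarrow> near W gate_const (\<pi> W y) (pair_rho A W)"
       "\<And>W. pair_nest (W, {}) A \<Longrightarrow> near W gate_const (\<pi> W y) (\<pi> W x)" and
    y': "\<And>W. pair_rel A W \<Longrightarrow> near W gate_const (\<pi> W y') (pair_rho A W)"
       "\<And>W. pair_nest (W, {}) A \<Longrightarrow> near W gate_const (\<pi> W y') (\<pi> W x')"
    by metis
  have close: "near W (2 * gate_const) (\<pi> W y) (\<pi> W y')" if "pair_rel A W" for W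
    using near_trans_le[OF y(1)[OF that] near_sym[OF y'(1)[OF that]]] by simp
  have far: "\<not> near Q k (\<pi> Q y) (\<pi> Q y')"
    if Q: "pair_nest (Q, {}) A" "\<not> near Q (k + 2 * gate_const) (\<pi> Q x) (\<pi> Q x')" for Q
  proof
    assume "near Q k (\<pi> Q y) (\<pi> Q y')"
    then have "near Q (k + gate_const) (\<pi> Q y) (\<pi> Q x')" using near_trans y'(2)[OF Q(1)] by blast
    then show False using Q(2) near_trans_le[OF near_sym[OF y(2)[OF Q(1)]]] by simp
  qed
  have TD: "fst A \<in> Dom" using pairs_fst A by blast
  obtain \<W> where \<W>: "finite \<W>" "card \<W> \<le> Suc (M (2 * gate_const)) ^ Suc N"
    "\<forall>V\<in>\<W>. nest V (fst A) \<and> (\<forall>x\<in>snd A. orth x V \<or> (nest x V \<and> V \<noteq> fst A)) \<and> (V = fst A \<longrightarrow> snd A = {})"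
    "\<forall>Q. pair_nest (Q, {}) A \<and> nest Q (fst A) \<and> \<not> near Q k (\<pi> Q y) (\<pi> Q y') \<longrightarrow> (\<exists>V\<in>\<W>. nest Q V)"
    using clean_cover[OF A(1) close nest_refl[OF TD], of "Suc N"] rank_le[OF TD]
    by (auto simp: less_Suc_eq_le)
  \<comment> \<open>Elements of \<open>snd A\<close> orthogonal to \<open>V\<close> impose nothing
    below \<open>V\<close>, so just those nested in \<open>V\<close> are kept. A \<open>V\<close>
    above no domain contained in \<open>A\<close> would give an empty pair; \<open>\<W>'\<close>
    discards it.\<close>
  define B where "B = (\<lambda>V. (V, {x \<in> snd A. nest x V}))"
  define \<W>' where "\<W>' = {V \<in> \<W>. \<exists>Q. pair_nest (Q, {}) A \<and> nest Q V}"
  have below: "pair_nest (Q, {}) (B V)" if "pair_nest (Q, {}) A" "nest Q V" for Q V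
    using that by (auto simp: B_def pair_nest_singleton_iff)
  show ?thesis
  proof (intro exI[of _ "B ` \<W>'"] conjI allI impI ballI)
    have fin: "finite \<W>'" using \<W>(1) by (simp add: \<W>'_def)
    then show "finite (B ` \<W>')" by simp
    have "card (B ` \<W>') \<le> card \<W>'" using fin by (rule card_image_le)
    also have "\<dots> \<le> card \<W>" using \<W>(1) by (intro card_mono) (auto simp: \<W>'_def)
    finally show "card (B ` \<W>') \<le> Suc (M (2 * gate_const)) ^ Suc N" using \<W>(2) by simp
  next
    fix C assume "C \<in> B ` \<W>'"
    then obtain V Q where V: "V \<in> \<W>" "C = B V" and Q: "pair_nest (Q, {}) A" "nest Q V"
      by (auto simp: \<W>'_def)
    have VD: "V \<in> Dom" using Q(2) nest_dom by blast
    have "pairwise orth (snd (B V))"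
      using pairs_snd_pairwise[OF A(1)] by (auto simp: B_def pairwise_def)
    moreover have "nest Q V \<and> (\<forall>x\<in>snd (B V). orth Q x)"
      using below[OF Q] orth_sym by (auto simp: pair_nest_singleton_iff B_def)
    ultimately show "C \<in> pairs"
      using VD V(2) by (auto simp: pairs_def B_def)
    have VA: "nest V (fst A)" using \<W>(3) V(1) by blast
    have "orth x V \<or> (\<exists>x'\<in>snd (B V). nest x x')" if x: "x \<in> snd A" for x
    proof -
      have "orth x V \<or> nest x V" using \<W>(3) V(1) x by blast
      moreover have "nest x x" using pairs_snd[OF A(1) x] nest_dom nest_refl by blast
      ultimately show ?thesis using x by (auto simp: B_def)
    qed
    then show "pair_nest C A"
      using VA by (simp add: pair_nest_def V(2) B_def)
    have "V \<noteq> fst A" using \<W>(3) V(1) A(2) by blast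
    then show "C \<noteq> A" by (metis V(2) B_def fst_conv)
  next
    fix Q assume Q: "pair_nest (Q, {}) A \<and> \<not> near Q (k + 2 * gate_const) (\<pi> Q x) (\<pi> Q x')"
    then obtain V where "V \<in> \<W>" "nest Q V"
      using \<W>(4) far by (auto simp: pair_nest_singleton_iff)
    then show "\<exists>C\<in>B ` \<W>'. pair_nest (Q, {}) C" using Q below by (auto simp: \<W>'_def)
  qed
qed

section \<open>Finite complexity of pairs\<close>

definition weight where
  "weight X = (\<Sum>x\<in>X. Suc m ^ rank x)"

lemma weight_le:
  assumes "X \<subseteq> Dom" "pairwise orth X" "\<forall>x\<in>X. rank x \<le> n"
  shows "weight X \<le> m * Suc m ^ n"
proof -
  have "weight X \<le> of_nat (card X) * Suc m ^ n"
    unfolding weight_def using assms(3) by (intro sum_bounded_above power_increasing) auto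
  also have "\<dots> \<le> m * Suc m ^ n" using orth_bounded[OF assms(1,2)] by (intro mult_le_mono1) simp
  finally show ?thesis .
qed

text \<open>At most \<open>m\<close> pairwise orthogonal domains lie below one \<open>x\<close>, so
  with powers of \<open>m + 1\<close> they weigh less together than \<open>x\<close>, unless
  \<open>x\<close> is among them and then it is alone. Splitting \<open>Y\<close> according to the
  elements of \<open>X\<close> above, equality throughout would give \<open>Y = X\<close>.\<close>

lemma weight_less:
  assumes X: "X \<subseteq> Dom" "pairwise orth X" and Y: "Y \<subseteq> Dom" "pairwise orth Y"
    and YX: "\<forall>y\<in>Y. \<exists>x\<in>X. nest y x" and ne: "X \<noteq> Y"
  shows "weight Y < weight X"
proof -
  define F where "F = (\<lambda>x. {y \<in> Y. nest y x})"
  have fin: "finite X" "finite Y" using orth_bounded X Y by auto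
  have F_self: "F x = {x}" if "x \<in> F x" for x
    using that Y(2) orth_not_nest by (auto simp: F_def pairwise_def)
  have F_less: "weight (F x) < Suc m ^ rank x" if "x \<notin> F x" for x
  proof (cases "F x = {}")
    case False
    have rk: "rank y < rank x" if "y \<in> F x" for y
      using that \<open>x \<notin> F x\<close> rank_less by (auto simp: F_def)
    then obtain n where n: "rank x = Suc n" using False by (metis all_not_in_conv less_nat_zero_code not0_implies_Suc)
    have "weight (F x) \<le> m * Suc m ^ n"
      using Y rk n by (intro weight_le) (auto simp: F_def pairwise_def less_Suc_eq_le)
    also have "\<dots> < Suc m ^ rank x" by (simp add: n)
    finally show ?thesis .
  qed (simp add: weight_def)
  have F_le: "weight (F x) \<le> Suc m ^ rank x" for x
    using F_self[of x] F_less[of x] by (cases "x \<in> F x") (auto simp: weight_def)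
  have Un: "Y = (\<Union>x\<in>X. F x)" using YX by (auto simp: F_def)
  have "F x \<inter> F x' = {}" if "x \<in> X" "x' \<in> X" "x \<noteq> x'" for x x'
    using X(2) that orth_nest orth_not_nest unfolding F_def pairwise_def by blast
  then have "weight (\<Union>x\<in>X. F x) = (\<Sum>x\<in>X. weight (F x))"
    unfolding weight_def using fin by (intro sum.UNION_disjoint) (auto simp: F_def)
  moreover have "(\<Sum>x\<in>X. weight (F x)) < (\<Sum>x\<in>X. Suc m ^ rank x)"
  proof (rule sum_strict_mono_ex1)
    show "\<exists>x\<in>X. weight (F x) < Suc m ^ rank x"
    proof (rule ccontr)
      assume "\<not> ?thesis"
      then have "\<forall>x\<in>X. F x = {x}" using F_less F_self by blast
      then have "Y = X" using Un by auto
      then show False using ne by simp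
    qed
  qed (use fin F_le in auto)
  ultimately show ?thesis using Un by (simp add: weight_def)
qed

text \<open>A lexicographic order in one number: the factor exceeds every weight, so the rank of the
  first component dominates. For equal first components the larger pair has the lighter second
  component, hence the subtraction.\<close>

definition pair_rank :: "'i \<times> 'i set \<Rightarrow> int" where
  "pair_rank A = int (rank (fst A)) * int (Suc (m * Suc m ^ N)) - int (weight (snd A))"

lemma pair_weight_less:
  assumes "A \<in> pairs" shows "weight (snd A) < Suc (m * Suc m ^ N)"
proof -
  have "snd A \<subseteq> Dom" using pairs_snd[OF assms] nest_dom by blast
  then show ?thesis
    using weight_le[OF _ pairs_snd_pairwise[OF assms]] rank_le by (auto simp: less_Suc_eq_le)
qed

lemma pair_rank_less:
  assumes A: "A \<in> pairs" and B: "B \<in> pairs" and AB: "pair_nest A B" "A \<noteq> B"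
  shows "pair_rank A < pair_rank B"
proof (cases "fst A = fst B")
  case True
  have "\<forall>y\<in>snd B. \<exists>x\<in>snd A. nest y x" using pair_nest_same_fst[OF A B AB(1) True] by blast
  moreover have "snd A \<noteq> snd B" using True AB(2) by (simp add: prod_eq_iff)
  moreover have "snd A \<subseteq> Dom" "snd B \<subseteq> Dom" using pairs_snd A B nest_dom by blast+
  ultimately have "weight (snd B) < weight (snd A)"
    using weight_less pairs_snd_pairwise A B by blast
  then show ?thesis using True by (simp add: pair_rank_def)
next
  case False
  let ?c = "Suc (m * Suc m ^ N)"
  have "Suc (rank (fst A)) \<le> rank (fst B)"
    using rank_less False AB(1) by (simp add: pair_nest_def Suc_le_eq)
  then have "Suc (rank (fst A)) * ?c \<le> rank (fst B) * ?c" by (rule mult_le_mono1)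
  then have "int (rank (fst A)) * int ?c + int ?c \<le> int (rank (fst B)) * int ?c"
    by (metis mult_Suc of_nat_add of_nat_le_iff of_nat_mult add.commute)
  moreover have "int (weight (snd B)) < int ?c"
    using pair_weight_less[OF B] by (simp only: of_nat_less_iff)
  ultimately show ?thesis unfolding pair_rank_def by linarith
qed

lemma pair_rank_bounds:
  assumes A: "A \<in> pairs"
  shows "pair_rank A \<in> {- int (Suc (m * Suc m ^ N)) .. int (N * Suc (m * Suc m ^ N))}"
proof -
  let ?c = "Suc (m * Suc m ^ N)"
  have "rank (fst A) * ?c \<le> N * ?c" using rank_le[OF pairs_fst[OF A]] by (rule mult_le_mono1)
  then have "int (rank (fst A)) * int ?c \<le> int (N * ?c)" by (metis of_nat_le_iff of_nat_mult)
  moreover have "0 \<le> int (rank (fst A)) * int ?c" by simp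
  moreover have "int (weight (snd A)) < int ?c"
    using pair_weight_less[OF A] by (simp only: of_nat_less_iff)
  ultimately show ?thesis unfolding pair_rank_def atLeastAtMost_iff by linarith
qed

lemma pair_finite_complexity:
  "\<exists>n. \<forall>\<C>. \<C> \<subseteq> pairs \<and> pairwise (\<lambda>A B. pair_nest A B \<or> pair_nest B A) \<C> \<longrightarrow> finite \<C> \<and> card \<C> \<le> n"
proof (intro exI allI impI, elim conjE)
  fix \<C> assume \<C>: "\<C> \<subseteq> pairs" "pairwise (\<lambda>A B. pair_nest A B \<or> pair_nest B A) \<C>"
  let ?I = "{- int (Suc (m * Suc m ^ N)) .. int (N * Suc (m * Suc m ^ N))}"
  have inj: "inj_on pair_rank \<C>"
    using \<C> pair_rank_less unfolding inj_on_def pairwise_def by (metis less_irrefl subset_iff)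
  have sub: "pair_rank ` \<C> \<subseteq> ?I" using pair_rank_bounds \<C> by blast
  then have "finite \<C>" using inj finite_imageD finite_subset by blast
  moreover have "card \<C> \<le> card ?I" using card_inj_on_le[OF inj sub] by simp
  ultimately show "finite \<C> \<and> card \<C> \<le> card ?I" by simp
qed

end

section \<open>Almost hierarchically hyperbolic spaces as coarse hierarchies\<close>

definition near_in :: "('x, 'c, 'i) hierarchy \<Rightarrow> 'i \<Rightarrow> real \<Rightarrow> 'c set \<Rightarrow> 'c set \<Rightarrow> bool" where
  "near_in H W r A B \<longleftrightarrow> W \<in> Dom H \<and> A \<subseteq> spc H W \<and> A \<noteq> {} \<and> B \<subseteq> spc H W \<and> B \<noteq> {} \<and>
     (\<forall>a\<in>A. \<forall>b\<in>B. hdist H W a b \<le> r)"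

lemma set_dist_lt_iff:
  assumes "Metric_space M d" "A \<subseteq> M" "A \<noteq> {}" "B \<subseteq> M" "B \<noteq> {}"
  shows "set_dist d A B < r \<longleftrightarrow> (\<exists>a\<in>A. \<exists>b\<in>B. d a b < r)"
proof -
  have "bdd_below ((\<lambda>(a, b). d a b) ` (A \<times> B))"
    using Metric_space.nonneg[OF assms(1)] by (intro bdd_belowI[of _ 0]) auto
  then show ?thesis using assms unfolding set_dist_def by (subst cINF_less_iff) auto
qed

lemma set_dist_nonneg:
  assumes "Metric_space M d" "A \<noteq> {}" "B \<noteq> {}"
  shows "0 \<le> set_dist d A B"
  unfolding set_dist_def using assms Metric_space.nonneg[OF assms(1)]
  by (intro cINF_greatest) auto

lemma set_dist_le:
  assumes "Metric_space M d" "a \<in> A" "b \<in> B" "d a b \<le> r"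
  shows "set_dist d A B \<le> r"
proof -
  have "bdd_below ((\<lambda>(a, b). d a b) ` (A \<times> B))"
    using Metric_space.nonneg[OF assms(1)] by (intro bdd_belowI[of _ 0]) auto
  then have "set_dist d A B \<le> d a b"
    unfolding set_dist_def using assms(2,3) by (intro cINF_lower2[where x = "(a, b)"]) auto
  then show ?thesis using assms(4) by simp
qed

lemma set_dist_zero:
  assumes "A \<noteq> {}" "B \<noteq> {}" shows "set_dist (\<lambda>_ _. 0) A B = 0"
  using assms by (simp add: set_dist_def case_prod_unfold)

locale almost_hierarchy =
  fixes H :: "('x::metric_space, 'c, 'i) hierarchy" and \<xi> \<delta> K \<kappa> lam E \<alpha> :: real and n :: nat
  assumes basic: "orthogonality_basic H"
    and bounded: "bounded_orthogonality_ax \<xi> H"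
    and \<xi>: "\<xi> \<ge> 0" and hyperbolic: "W \<in> Dom H \<Longrightarrow> hyperbolic_space \<delta> (spc H W) (hdist H W)"
    and projections: "projections_ax \<xi> K H"
    and nesting: "nesting_ax \<xi> H"
    and complexity: "finite_complexity_ax n H"
    and \<kappa>: "\<kappa> \<ge> 0" and consistent: "consistency_ax \<xi> \<kappa> H"
    and lam: "lam \<ge> 1" and E: "E \<ge> max \<xi> \<kappa>" and links: "large_links_ax lam E H"
    and geodesic_image: "bounded_geodesic_image_ax E H"
    and realization_ax: "partial_realization_ax \<alpha> H"
begin

definition nestD where "nestD V W \<longleftrightarrow> V \<in> Dom H \<and> W \<in> Dom H \<and> nest H V W"
definition orthD where "orthD V W \<longleftrightarrow> V \<in> Dom H \<and> W \<in> Dom H \<and> orth H V W"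

sublocale orthogonality_poset "Dom H" nestD orthD
proof
  show "nestD V V" if "V \<in> Dom H" for V
    using nesting that by (auto simp: nesting_ax_def reflp_on_def nestD_def)
  show "V = W" if "nestD V W" "nestD W V" for V W
    using nesting that by (auto simp: nesting_ax_def antisymp_on_def nestD_def)
  show "nestD U W" if "nestD U V" "nestD V W" for U V W
    using nesting that unfolding nesting_ax_def transp_on_def nestD_def by blast
  show "orthD W V" if "orthD V W" for V W
    using basic that by (auto simp: orthogonality_basic_def symp_on_def orthD_def)
  show "\<not> orthD V V" for V
    using basic by (auto simp: orthogonality_basic_def irreflp_on_def orthD_def)
  show "orthD V U" if "nestD V W" "orthD W U" for U V W
    using basic that unfolding orthogonality_basic_def orthD_def nestD_def by blast
qed (auto simp: nestD_def orthD_def)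

lemma metric: "W \<in> Dom H \<Longrightarrow> Metric_space (spc H W) (hdist H W)"
  using hyperbolic by (simp add: hyperbolic_space_def)

lemma rel_iff:
  assumes "V \<in> Dom H" "W \<in> Dom H"
  shows "rel V W \<longleftrightarrow> pnest H V W \<or> transverse H V W"
  using assms rel_if_proper[of V W] nest_refl[of V]
  by (auto simp: rel_def pnest_def transverse_def nestD_def orthD_def)

lemma rel_both_iff:
  assumes "V \<in> Dom H" "W \<in> Dom H"
  shows "rel V W \<and> rel W V \<longleftrightarrow> transverse H V W"
  using assms orth_sym[of V W] orth_sym[of W V]
  by (auto simp: rel_def transverse_def nestD_def orthD_def)

lemma proj_valid:
  assumes "W \<in> Dom H"
  shows "proj H W x \<subseteq> spc H W" "proj H W x \<noteq> {}" "diam_le (hdist H W) (proj H W x) \<xi>"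
  using projections assms by (auto simp: projections_ax_def)

lemma rho_valid:
  assumes "rel V W"
  shows "rho H V W \<subseteq> spc H W" "rho H V W \<noteq> {}" "diam_le (hdist H W) (rho H V W) \<xi>"
proof -
  have D: "V \<in> Dom H" "W \<in> Dom H" using assms rel_dom by auto
  have n: "\<And>V W. V \<in> Dom H \<Longrightarrow> W \<in> Dom H \<Longrightarrow> pnest H V W \<Longrightarrow>
      rho H V W \<subseteq> spc H W \<and> rho H V W \<noteq> {} \<and> diam_le (hdist H W) (rho H V W) \<xi>"
    using nesting unfolding nesting_ax_def by blast
  have t: "\<And>V W. V \<in> Dom H \<Longrightarrow> W \<in> Dom H \<Longrightarrow> transverse H V W \<Longrightarrow>
      rho H V W \<subseteq> spc H W \<and> rho H V W \<noteq> {} \<and> diam_le (hdist H W) (rho H V W) \<xi>"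
    using consistent unfolding consistency_ax_def by blast
  show "rho H V W \<subseteq> spc H W" "rho H V W \<noteq> {}" "diam_le (hdist H W) (rho H V W) \<xi>"
    using assms rel_iff[OF D] n[OF D] t[OF D] by auto
qed

lemma near_in_sym: "near_in H W r A B \<Longrightarrow> near_in H W r B A"
  unfolding near_in_def using Metric_space.commute[OF metric] by metis

lemma near_in_trans:
  assumes "near_in H W r A B" "near_in H W s B C" shows "near_in H W (r + s) A C"
proof -
  have W: "W \<in> Dom H" and sub: "A \<subseteq> spc H W" "B \<subseteq> spc H W" "C \<subseteq> spc H W"
    using assms by (auto simp: near_in_def)
  obtain b where b: "b \<in> B" using assms by (auto simp: near_in_def)
  have "hdist H W a c \<le> r + s" if "a \<in> A" "c \<in> C" for a c
  proof -
    have "hdist H W a c \<le> hdist H W a b + hdist H W b c"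
      using Metric_space.triangle[OF metric[OF W]] that b sub by blast
    then show ?thesis using assms that b unfolding near_in_def by (smt (verit))
  qed
  then show ?thesis using assms by (auto simp: near_in_def)
qed

lemma near_in_mono: "near_in H W r A B \<Longrightarrow> r \<le> s \<Longrightarrow> near_in H W s A B"
  unfolding near_in_def by (meson order_trans)

lemma near_in_nonneg: "near_in H W r A B \<Longrightarrow> 0 \<le> r"
  unfolding near_in_def using Metric_space.nonneg[OF metric] by (meson all_not_in_conv order_trans)

lemma near_in_set_dist:
  assumes "near_in H W r A B" shows "set_dist (hdist H W) A B \<le> r"
proof -
  obtain a b where "a \<in> A" "b \<in> B" "hdist H W a b \<le> r" "W \<in> Dom H"
    using assms unfolding near_in_def by blast
  then show ?thesis using set_dist_le[OF metric] by blast
qed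

text \<open>The diameters pay for passing from one pair of points to all pairs, and the 1 for an
  infimum that may not be attained.\<close>

lemma set_dist_near_in:
  assumes W: "W \<in> Dom H"
    and A: "A \<subseteq> spc H W" "A \<noteq> {}" "diam_le (hdist H W) A r"
    and B: "B \<subseteq> spc H W" "B \<noteq> {}" "diam_le (hdist H W) B s"
    and t: "set_dist (hdist H W) A B \<le> t"
  shows "near_in H W (t + r + s + 1) A B"
proof -
  obtain a b where ab: "a \<in> A" "b \<in> B" "hdist H W a b < t + 1"
    using set_dist_lt_iff[OF metric[OF W] A(1,2) B(1,2), of "t + 1"] t by auto
  have "hdist H W x y \<le> t + r + s + 1" if "x \<in> A" "y \<in> B" for x y
  proof -
    have "hdist H W x y \<le> hdist H W x a + hdist H W a y"
      using Metric_space.triangle[OF metric[OF W]] that ab A B by blast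
    also have "hdist H W a y \<le> hdist H W a b + hdist H W b y"
      using Metric_space.triangle[OF metric[OF W]] that ab A B by blast
    finally show ?thesis using A(3) B(3) ab that unfolding diam_le_def by (smt (verit))
  qed
  then show ?thesis using assms by (auto simp: near_in_def)
qed

lemma proj_near_rho:
  assumes "rel V W" "pt_dist H W x (rho H V W) \<le> t"
  shows "near_in H W (t + 2 * \<xi> + 1) (proj H W x) (rho H V W)"
proof -
  have W: "W \<in> Dom H" using assms rel_dom by blast
  from set_dist_near_in[OF W proj_valid[OF W] rho_valid[OF assms(1)] assms(2)[unfolded pt_dist_def]]
  show ?thesis by (rule near_in_mono) simp
qed

definition coarse_const where "coarse_const = 3 * \<kappa> + E + \<bar>\<alpha>\<bar> + 2 * \<xi> + 1"

lemma coarse_const_ge: "0 \<le> E" "\<xi> \<le> coarse_const" "\<kappa> + 2 * \<xi> + 1 \<le> coarse_const" "2 * \<kappa> + E \<le> coarse_const" "2 * \<xi> + E + 1 \<le> coarse_const"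
  "\<alpha> + 2 * \<xi> + 1 \<le> coarse_const" "E + 2 * \<xi> + 1 \<le> coarse_const"
  using \<xi> \<kappa> E by (auto simp: coarse_const_def)

text \<open>If neither coordinate in \<open>W\<close> is near \<open>rho H V W\<close>, consistency
  ties the \<open>V\<close> coordinates to the images of the \<open>W\<close> coordinates under
  \<open>rho_map\<close>. On a geodesic joining the latter, a bounded image would make the
  \<open>V\<close> coordinates close; so it passes near \<open>rho H V W\<close>, at a point within
  \<open>s\<close> of the coordinate of \<open>y\<close>.\<close>

lemma coarse_bounded_image:
  assumes VW: "nestD V W" "V \<noteq> W" and near: "near_in H W s (proj H W x) (proj H W y)"
    and far: "\<not> near_in H V coarse_const (proj H V x) (proj H V y)"
  shows "near_in H W (s + coarse_const) (proj H W y) (rho H V W)"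
proof -
  have D: "V \<in> Dom H" "W \<in> Dom H" and pn: "pnest H V W"
    using VW by (auto simp: nestD_def pnest_def)
  have r: "rel V W" using VW rel_if_proper by blast
  have s: "0 \<le> s" using near_in_nonneg near by blast
  have alt: "pt_dist H W z (rho H V W) \<le> \<kappa> \<or>
      diam_le (hdist H V) (proj H V z \<union> (\<Union>p\<in>proj H W z. rho_map H W V p)) \<kappa>" for z
    using consistent D pn unfolding consistency_ax_def by blast
  show ?thesis
  proof (cases "pt_dist H W x (rho H V W) \<le> \<kappa> \<or> pt_dist H W y (rho H V W) \<le> \<kappa>")
    case True
    then show ?thesis
    proof
      assume "pt_dist H W x (rho H V W) \<le> \<kappa>"
      from near_in_trans[OF near_in_sym[OF near] proj_near_rho[OF r this]]
      show ?thesis by (rule near_in_mono) (use coarse_const_ge in auto)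
    next
      assume "pt_dist H W y (rho H V W) \<le> \<kappa>"
      from proj_near_rho[OF r this] show ?thesis by (rule near_in_mono) (use coarse_const_ge s in auto)
    qed
  next
    case False
    then have dx: "diam_le (hdist H V) (proj H V x \<union> (\<Union>p\<in>proj H W x. rho_map H W V p)) \<kappa>"
      and dy: "diam_le (hdist H V) (proj H V y \<union> (\<Union>p\<in>proj H W y. rho_map H W V p)) \<kappa>"
      using alt by blast+
    obtain p q where pq: "p \<in> proj H W x" "q \<in> proj H W y"
      using proj_valid(2)[OF D(2)] by blast
    then have pqs: "p \<in> spc H W" "q \<in> spc H W" using proj_valid(1)[OF D(2)] by auto
    then obtain G where "geodesic_segment (spc H W) (hdist H W) p q G"
      using hyperbolic[OF D(2)] unfolding hyperbolic_space_def by blast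
    then obtain a b g where g: "a \<le> b" "geodesic (spc H W) (hdist H W) {a..b} g" "g a = p" "g b = q"
      unfolding geodesic_segment_def by blast
    have gsub: "g ` {a..b} \<subseteq> spc H W" using g(2) by (simp add: geodesic_def)
    consider "diam_le (hdist H V) (\<Union>p\<in>g ` {a..b}. rho_map H W V p) E"
      | t where "t \<in> {a..b}" "set_dist (hdist H W) {g t} (rho H V W) \<le> E"
      using geodesic_image D pn g(2) unfolding bounded_geodesic_image_ax_def by blast
    then show ?thesis
    proof cases
      case 1
      have rm: "rho_map H W V p \<subseteq> spc H V" "rho_map H W V p \<noteq> {}" if "p \<in> spc H W" for p
        using nesting D pn that unfolding nesting_ax_def by blast+
      obtain p' q' where p': "p' \<in> rho_map H W V p" and q': "q' \<in> rho_map H W V q"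
        using rm(2) pqs by blast
      have pq': "p' \<in> spc H V" "q' \<in> spc H V" using rm(1) pqs p' q' by auto
      have ends: "a \<in> {a..b}" "b \<in> {a..b}" using g(1) by auto
      have "p' \<in> (\<Union>p\<in>g ` {a..b}. rho_map H W V p)" "q' \<in> (\<Union>p\<in>g ` {a..b}. rho_map H W V p)"
        using p' q' g(3,4) ends by (metis UN_iff image_eqI)+
      then have d1: "hdist H V p' q' \<le> E" using 1 unfolding diam_le_def by blast
      have "hdist H V u v \<le> coarse_const" if u: "u \<in> proj H V x" and v: "v \<in> proj H V y" for u v
      proof -
        have uv: "u \<in> spc H V" "v \<in> spc H V" using proj_valid(1)[OF D(1)] u v by auto
        have "hdist H V u p' \<le> \<kappa>" using dx u p' pq unfolding diam_le_def by blast
        moreover have "hdist H V q' v \<le> \<kappa>" using dy v q' pq unfolding diam_le_def by blast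
        moreover have "hdist H V u v \<le> hdist H V u p' + hdist H V p' v"
          "hdist H V p' v \<le> hdist H V p' q' + hdist H V q' v"
          using Metric_space.triangle[OF metric[OF D(1)]] uv pq' by blast+
        ultimately show ?thesis using d1 coarse_const_ge by linarith
      qed
      then have "near_in H V coarse_const (proj H V x) (proj H V y)"
        using proj_valid D by (simp add: near_in_def)
      then show ?thesis using far by simp
    next
      case (2 t)
      have gt: "g t \<in> spc H W" using gsub 2 by auto
      have "diam_le (hdist H W) {g t} 0"
        using Metric_space.mdist_zero[OF metric[OF D(2)] gt] by (simp add: diam_le_def)
      then have n1: "near_in H W (E + 0 + \<xi> + 1) {g t} (rho H V W)"
        using set_dist_near_in[OF D(2) _ _ _ rho_valid[OF r] 2(2)] gt by blast
      have isom: "hdist H W (g u) (g v) = \<bar>u - v\<bar>" if "u \<in> {a..b}" "v \<in> {a..b}" for u v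
        using g(2) that by (simp add: geodesic_def)
      have "hdist H W q (g t) = \<bar>b - t\<bar>" "hdist H W p q = \<bar>a - b\<bar>"
        using isom[of b t] isom[of a b] g 2(1) by auto
      moreover have "hdist H W p q \<le> s" using near pq by (simp add: near_in_def)
      ultimately have "hdist H W q (g t) \<le> s" using 2(1) by auto
      then have n2: "near_in H W s {q} {g t}" using D gt pqs by (simp add: near_in_def)
      have n3: "near_in H W \<xi> (proj H W y) {q}"
        using proj_valid[OF D(2), of y] pq D pqs by (auto simp: near_in_def diam_le_def)
      from near_in_trans[OF n3 near_in_trans[OF n2 n1]]
      show ?thesis by (rule near_in_mono) (use coarse_const_ge in auto)
    qed
  qed
qed

text \<open>The rank is the largest size of a chain of domains nested in \<open>W\<close>; adding
  \<open>W\<close> to a longest chain for \<open>V\<close> gives the strict increase.\<close>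

lemma rank_exists:
  obtains rank where "\<And>V W. nestD V W \<Longrightarrow> V \<noteq> W \<Longrightarrow> rank V < rank W" "\<And>W. rank W \<le> n"
proof -
  define Ch where "Ch = (\<lambda>W. {C. (\<forall>V\<in>C. nestD V W) \<and> pairwise (\<lambda>V W. nestD V W \<or> nestD W V) C})"
  have Ch: "finite C \<and> card C \<le> n" if "C \<in> Ch W" for C W
  proof -
    have "C \<subseteq> Dom H" "pairwise (\<lambda>V W. nest H V W \<or> nest H W V) C"
      using that by (auto simp: Ch_def nestD_def pairwise_def)
    then show ?thesis using complexity unfolding finite_complexity_ax_def by blast
  qed
  define rank where "rank = (\<lambda>W. Max (card ` Ch W))"
  have fin: "finite (card ` Ch W)" for W
    by (rule finite_subset[of _ "{..n}"]) (use Ch in auto)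
  have ne: "{} \<in> Ch W" for W by (simp add: Ch_def)
  have "rank V < rank W" if VW: "nestD V W" "V \<noteq> W" for V W
  proof -
    obtain C where C: "C \<in> Ch V" "rank V = card C"
      using Max_in[OF fin] ne[of V] unfolding rank_def by (metis empty_iff image_iff)
    have "W \<notin> C" using C VW nest_antisym by (auto simp: Ch_def)
    moreover have "insert W C \<in> Ch W"
      using C VW nest_trans[OF _ VW(1)] nest_refl[of W]
      by (auto simp: Ch_def pairwise_insert nestD_def)
    then have "card (insert W C) \<le> rank W" unfolding rank_def using fin by (intro Max_ge) auto
    ultimately show ?thesis using C Ch[OF C(1)] by simp
  qed
  moreover have "rank W \<le> n" for W
    unfolding rank_def using fin ne[of W] Ch by (intro Max.boundedI) auto
  ultimately show ?thesis using that by blast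
qed

lemma coarse_hierarchy_exists:
  obtains M rank m where
    "coarse_hierarchy (Dom H) nestD orthD (near_in H) (proj H) (rho H) coarse_const M rank n m"
proof -
  obtain rank where rank: "\<And>V W. nestD V W \<Longrightarrow> V \<noteq> W \<Longrightarrow> rank V < rank W" "\<And>W. rank W \<le> n"
    using rank_exists by blast
  have "coarse_hierarchy (Dom H) nestD orthD (near_in H) (proj H) (rho H) coarse_const
      (\<lambda>s. nat \<lfloor>lam * s + lam\<rfloor>) rank n (nat \<lfloor>\<xi>\<rfloor>)"
  proof (unfold_locales, goal_cases)
    case (1 W r a b) then show ?case by (rule near_in_sym)
  next
    case (2 W r a b s d) then show ?case by (rule near_in_trans)
  next
    case (3 W r a b s) then show ?case by (rule near_in_mono)
  next
    case (4 W r a b) then show ?case by (rule near_in_nonneg)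
  next
    case 5 show ?case using coarse_const_ge \<xi> by linarith
  next
    case (6 W x)
    have "near_in H W \<xi> (proj H W x) (proj H W x)"
      using proj_valid[OF 6, of x] 6 by (simp add: near_in_def diam_le_def)
    then show ?case using near_in_mono coarse_const_ge by blast
  next
    case (7 V W x)
    have D: "V \<in> Dom H" "W \<in> Dom H" using 7 rel_dom by auto
    have t: "transverse H V W" using rel_both_iff[OF D] 7 by simp
    then have "min (pt_dist H W x (rho H V W)) (pt_dist H V x (rho H W V)) \<le> \<kappa>"
      using consistent D unfolding consistency_ax_def by blast
    then consider "pt_dist H W x (rho H V W) \<le> \<kappa>" | "pt_dist H V x (rho H W V) \<le> \<kappa>" by linarith
    then show ?case
      using near_in_mono[OF proj_near_rho[OF 7(1)]] near_in_mono[OF proj_near_rho[OF 7(2)]] coarse_const_ge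
      by cases blast+
  next
    case (8 V W s x y) then show ?case by (rule coarse_bounded_image)
  next
    case (9 U V W)
    have D: "U \<in> Dom H" "V \<in> Dom H" "W \<in> Dom H" using 9 nest_dom rel_dom by auto
    have r: "rel U W" using rel_below 9 by blast
    have "nest H U V \<and> (pnest H V W \<or> transverse H V W \<and> \<not> orth H W U)"
      using 9 rel_iff[OF D(2,3)] D orth_sym[of W U] by (auto simp: nestD_def orthD_def)
    then have "set_dist (hdist H W) (rho H U W) (rho H V W) \<le> \<kappa>"
      using consistent D unfolding consistency_ax_def by blast
    from set_dist_near_in[OF D(3) rho_valid[OF r] rho_valid[OF 9(2)] this]
    show ?case by (rule near_in_mono) (use coarse_const_ge in simp)
  next
    case (10 \<V> p)
    have "\<exists>q. \<forall>V\<in>\<V>. q V \<in> proj H V (p V)"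
      using proj_valid(2) 10 by (intro bchoice) blast
    then obtain q where q: "\<And>V. V \<in> \<V> \<Longrightarrow> q V \<in> proj H V (p V)" by blast
    have "pairwise (orth H) \<V>" using 10(2) by (auto simp: pairwise_def orthD_def)
    then obtain x where x: "\<And>V. V \<in> \<V> \<Longrightarrow> pt_dist H V x {q V} \<le> \<alpha>"
      "\<And>V W. V \<in> \<V> \<Longrightarrow> W \<in> Dom H \<Longrightarrow> pnest H V W \<Longrightarrow> pt_dist H W x (rho H V W) \<le> \<alpha>"
      "\<And>V W. V \<in> \<V> \<Longrightarrow> W \<in> Dom H \<Longrightarrow> transverse H W V \<Longrightarrow> pt_dist H W x (rho H V W) \<le> \<alpha>"
      using realization_ax[unfolded partial_realization_ax_def, rule_format, of \<V> q] 10(1) q by blast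
    have "near_in H V coarse_const (proj H V x) (proj H V (p V))" if V: "V \<in> \<V>" for V
    proof -
      have D: "V \<in> Dom H" using V 10 by blast
      have qs: "q V \<in> spc H V" using proj_valid(1)[OF D] q[OF V] by blast
      have "diam_le (hdist H V) {q V} 0"
        using Metric_space.mdist_zero[OF metric[OF D] qs] by (simp add: diam_le_def)
      then have n1: "near_in H V (\<alpha> + \<xi> + 0 + 1) (proj H V x) {q V}"
        using set_dist_near_in[OF D proj_valid[OF D] _ _ _ x(1)[OF V, unfolded pt_dist_def]] qs by blast
      have n2: "near_in H V \<xi> {q V} (proj H V (p V))"
        using proj_valid[OF D, of "p V"] q[OF V] D qs by (auto simp: near_in_def diam_le_def)
      from near_in_trans[OF n1 n2] show ?thesis by (rule near_in_mono) (use coarse_const_ge in simp)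
    qed
    moreover have "near_in H W coarse_const (proj H W x) (rho H V W)" if V: "V \<in> \<V>" and r: "rel V W" for V W
    proof -
      have D: "V \<in> Dom H" "W \<in> Dom H" using r rel_dom by auto
      have "pnest H V W \<or> transverse H W V"
        using r rel_iff[OF D] rel_both_iff[OF D] rel_both_iff[OF D(2,1)] by blast
      then have "pt_dist H W x (rho H V W) \<le> \<alpha>" using x(2,3) V D by blast
      from proj_near_rho[OF r this] show ?thesis by (rule near_in_mono) (use coarse_const_ge in simp)
    qed
    ultimately show ?case by blast
  next
    case (11 W s x y)
    define N where "N = lam * pt_dist H W x (proj H W y) + lam"
    obtain \<T> where \<T>: "\<T> \<subseteq> nested_in H W - {W}" "finite \<T>" "int (card \<T>) \<le> \<lfloor>N\<rfloor>"
      "\<And>T. T \<in> nested_in H W - {W} \<Longrightarrow> (\<exists>T'\<in>\<T>. T \<in> nested_in H T') \<or> pt_dist H T x (proj H T y) < E"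
      using links[unfolded large_links_ax_def Let_def, rule_format, OF 11(1), of x y]
      unfolding N_def by blast
    have "pt_dist H W x (proj H W y) \<le> s" using near_in_set_dist[OF 11(2)] by (simp add: pt_dist_def)
    then have "N \<le> lam * s + lam" using lam by (simp add: N_def)
    then have "int (card \<T>) \<le> \<lfloor>lam * s + lam\<rfloor>" using \<T>(3) floor_mono by force
    then have card: "card \<T> \<le> nat \<lfloor>lam * s + lam\<rfloor>" by linarith
    have cover: "\<exists>T\<in>\<T>. nestD V T"
      if V: "nestD V W" "V \<noteq> W" "\<not> near_in H V coarse_const (proj H V x) (proj H V y)" for V
    proof -
      have D: "V \<in> Dom H" using V by (simp add: nestD_def)
      have "\<not> pt_dist H V x (proj H V y) < E"
      proof
        assume "pt_dist H V x (proj H V y) < E"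
        then have "set_dist (hdist H V) (proj H V x) (proj H V y) \<le> E" by (simp add: pt_dist_def)
        from set_dist_near_in[OF D proj_valid[OF D] proj_valid[OF D] this]
        have "near_in H V coarse_const (proj H V x) (proj H V y)" by (rule near_in_mono) (use coarse_const_ge in simp)
        then show False using V by simp
      qed
      then show ?thesis
        using \<T>(4)[of V] \<T>(1) V by (auto simp: nested_in_def nestD_def)
    qed
    have "\<forall>T\<in>\<T>. nestD T W \<and> T \<noteq> W" using \<T>(1) 11(1) by (auto simp: nested_in_def nestD_def)
    then show ?case using \<T>(2) card cover by blast
  next
    case (12 W)
    then show ?case using nesting unfolding nesting_ax_def nestD_def by blast
  next
    case (13 V W) then show ?case by (rule rank(1))
  next
    case (14 W) then show ?case using rank(2) by simp
  next
    case (15 \<V>)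
    have "pairwise (orth H) \<V>" using 15(2) by (auto simp: pairwise_def orthD_def)
    then have "finite \<V> \<and> real (card \<V>) \<le> \<xi>"
      using bounded 15(1) unfolding bounded_orthogonality_ax_def by blast
    then show ?case by (simp add: le_nat_floor)
  qed
  then show ?thesis by (rule that)
qed

end

section \<open>Adding containers\<close>

lemma singleton_hyperbolic:
  assumes "0 \<le> \<delta>" shows "hyperbolic_space \<delta> {u} (\<lambda>_ _. 0)"
proof -
  have "Metric_space {u} (\<lambda>_ _. 0)" by (auto simp: Metric_space_def)
  moreover have "geodesic_segment {u} (\<lambda>_ _. 0) u u {u}"
    unfolding geodesic_segment_def geodesic_def
    by (intro exI[of _ 0] exI[of _ "\<lambda>_. u"]) (auto simp: is_interval_def)
  moreover have "\<exists>q\<in>G2 \<union> G3. (0::real) \<le> \<delta>"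
    if "geodesic_segment {u} (\<lambda>_ _. 0) y z G2" for y z G2 G3
  proof -
    have "G2 \<noteq> {}" using that by (auto simp: geodesic_segment_def)
    then show ?thesis using assms by auto
  qed
  ultimately show ?thesis unfolding hyperbolic_space_def by blast
qed

section \<open>The enlarged structure\<close>

fun to_pair :: "'i + 'i \<times> 'i set \<Rightarrow> 'i \<times> 'i set" where
  "to_pair (Inl W) = (W, {})"
| "to_pair (Inr A) = A"

context almost_hierarchy
begin

text \<open>Pairs with empty second component are the old domains; a second copy would violate
  antisymmetry. From a new one-point space to an old one, \<open>rho_map\<close> takes the whole
  space as its value: it is nonempty, and since the single point is at distance 0 from
  \<open>rho\<close>, consistency and geodesic image hold for any value.\<close>

definition completion :: "('x, 'c, 'i + 'i \<times> 'i set) hierarchy" where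
  "completion = \<lparr>Dom = Inl ` Dom H \<union> Inr ` {A \<in> pairs. snd A \<noteq> {}},
     spc = case_sum (spc H) (\<lambda>_. {undefined}),
     hdist = case_sum (hdist H) (\<lambda>_ _ _. 0),
     nest = (\<lambda>A B. pair_nest (to_pair A) (to_pair B)),
     orth = (\<lambda>A B. pair_orth (to_pair A) (to_pair B)),
     proj = case_sum (proj H) (\<lambda>_ _. {undefined}),
     rho = (\<lambda>A. case_sum (\<lambda>W. rho H (pair_rep (to_pair A) W) W) (\<lambda>_. {undefined})),
     rho_map = (\<lambda>W V p. case V of
         Inl V' \<Rightarrow> (case W of Inl W' \<Rightarrow> rho_map H W' V' p | Inr _ \<Rightarrow> spc H V')
       | Inr _ \<Rightarrow> {undefined})\<rparr>"

abbreviation "R \<equiv> completion"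

lemma R_simps [simp]:
  "Dom R = Inl ` Dom H \<union> Inr ` {A \<in> pairs. snd A \<noteq> {}}"
  "spc R (Inl W) = spc H W" "spc R (Inr A) = {undefined}"
  "hdist R (Inl W) = hdist H W" "hdist R (Inr A) = (\<lambda>_ _. 0)"
  "nest R B C \<longleftrightarrow> pair_nest (to_pair B) (to_pair C)"
  "orth R B C \<longleftrightarrow> pair_orth (to_pair B) (to_pair C)"
  "proj R (Inl W) = proj H W" "proj R (Inr A) = (\<lambda>_. {undefined})"
  "rho R B (Inl W) = rho H (pair_rep (to_pair B) W) W" "rho R B (Inr A) = {undefined}"
  "rho_map R (Inl W) (Inl V) p = rho_map H W V p" "rho_map R (Inr A) (Inl V) p = spc H V"
  "rho_map R B (Inr A) p = {undefined}"
  by (simp_all add: completion_def fun_eq_iff)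

lemma pt_dist_R [simp]:
  "pt_dist R (Inl W) x S = pt_dist H W x S" "S \<noteq> {} \<Longrightarrow> pt_dist R (Inr A) x S = 0"
  by (simp_all add: pt_dist_def set_dist_zero)

lemma to_pair_pairs: "B \<in> Dom R \<Longrightarrow> to_pair B \<in> pairs"
  by (auto simp: pairs_singleton)

lemma to_pair_inj: "B \<in> Dom R \<Longrightarrow> C \<in> Dom R \<Longrightarrow> to_pair B = to_pair C \<Longrightarrow> B = C"
  by auto

lemma to_pair_surj:
  assumes "A \<in> pairs" shows "\<exists>B\<in>Dom R. to_pair B = A"
proof (cases "snd A = {}")
  case True
  then have "to_pair (Inl (fst A)) = A" by (simp add: prod_eq_iff)
  then show ?thesis using pairs_fst[OF assms] by (intro bexI[of _ "Inl (fst A)"]) auto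
next
  case False
  then show ?thesis using assms by (intro bexI[of _ "Inr A"]) auto
qed

lemma nest_Inl: "V \<in> Dom H \<Longrightarrow> W \<in> Dom H \<Longrightarrow> nest R (Inl V) (Inl W) \<longleftrightarrow> nest H V W"
  by (simp add: pair_nest_singletons nestD_def)

lemma orth_Inl: "V \<in> Dom H \<Longrightarrow> W \<in> Dom H \<Longrightarrow> orth R (Inl V) (Inl W) \<longleftrightarrow> orth H V W"
  by (simp add: pair_orth_singletons orthD_def)

lemma pnest_Inl: "V \<in> Dom H \<Longrightarrow> W \<in> Dom H \<Longrightarrow> pnest R (Inl V) (Inl W) \<longleftrightarrow> pnest H V W"
  unfolding pnest_def using nest_Inl by simp

lemma transverse_Inl:
  "V \<in> Dom H \<Longrightarrow> W \<in> Dom H \<Longrightarrow> transverse R (Inl V) (Inl W) \<longleftrightarrow> transverse H V W"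
  unfolding transverse_def using nest_Inl orth_Inl by simp

lemma pair_rel_iff:
  assumes B: "B \<in> Dom R" and W: "W \<in> Dom H"
  shows "pair_rel (to_pair B) W \<longleftrightarrow> pnest R B (Inl W) \<or> transverse R B (Inl W)"
proof -
  have p: "to_pair B \<in> pairs" "(W, {}) \<in> pairs"
    using to_pair_pairs[OF B] W by (auto simp: pairs_singleton)
  have "B = Inl W" if "to_pair B = (W, {})"
    using to_pair_inj[OF B, of "Inl W"] W that by simp
  then have "\<not> pair_orth (to_pair B) (W, {})" "\<not> pair_nest (W, {}) (to_pair B)"
    if "pair_nest (to_pair B) (W, {})" "B \<noteq> Inl W"
    using that pair_orth_not_nest[OF p] pair_nest_antisym[OF p] by blast+
  then show ?thesis
    using W p pair_nest_refl by (auto simp: pair_rel_def pnest_def transverse_def)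
qed

lemma rho_R_valid:
  assumes B: "B \<in> Dom R" and W: "W \<in> Dom R" and BW: "pnest R B W \<or> transverse R B W"
  shows "rho R B W \<subseteq> spc R W \<and> rho R B W \<noteq> {} \<and> diam_le (hdist R W) (rho R B W) \<xi>"
proof (cases W)
  case (Inl W')
  then have "W' \<in> Dom H" using W by auto
  then have "rel (pair_rep (to_pair B) W') W'"
    using pair_rep_rel[OF to_pair_pairs[OF B]] pair_rel_iff[OF B] BW Inl by blast
  then show ?thesis using rho_valid Inl by simp
next
  case (Inr A)
  then show ?thesis using \<xi> by (simp add: diam_le_def)
qed

lemma rho_R_Inl:
  assumes "V \<in> Dom H" "W \<in> Dom H" "pnest H V W \<or> transverse H V W"
  shows "rho R (Inl V) (Inl W) = rho H V W"
  using assms rel_iff by (simp add: pair_rep_singleton)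

lemma transverse_sym:
  assumes "V \<in> Dom R" "W \<in> Dom R" "transverse R V W" shows "transverse R W V"
  using assms pair_orth_sym by (auto simp: transverse_def)

lemma completion_orthogonality: "orthogonality_basic R"
  unfolding orthogonality_basic_def
proof (intro conjI ballI impI)
  show "symp_on (Dom R) (orth R)"
    unfolding symp_on_def using pair_orth_sym by (simp del: R_simps(1))
  show "irreflp_on (Dom R) (orth R)"
    unfolding irreflp_on_def using pair_orth_irrefl to_pair_pairs by (simp del: R_simps(1))
  show "orth R V U" if "nest R V W \<and> orth R W U" for V W U
    using that pair_orth_nest unfolding R_simps by blast
  fix V W assume "V \<in> Dom R" "W \<in> Dom R" "orth R V W"
  then show "\<not> nest R V W" "\<not> nest R W V"
    using pair_orth_not_nest pair_orth_sym to_pair_pairs by (simp_all del: R_simps(1))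
qed

lemma completion_containers: "containers_ax R"
  unfolding containers_ax_def
proof (intro ballI impI)
  fix T U assume T: "T \<in> Dom R" and U: "U \<in> nested_in R T"
    and ne: "{V \<in> nested_in R T. orth R V U} \<noteq> {}"
  obtain V where V: "V \<in> Dom R" "pair_nest (to_pair V) (to_pair T)"
    "pair_orth (to_pair V) (to_pair U)"
    using ne unfolding nested_in_def R_simps(6,7) by blast
  have "U \<in> Dom R" "pair_nest (to_pair U) (to_pair T)"
    using U unfolding nested_in_def R_simps(6,7) by blast+
  from pair_container[OF to_pair_pairs[OF T] to_pair_pairs[OF this(1)] this(2) to_pair_pairs[OF V(1)] V(2,3)]
  obtain C where C: "C \<in> pairs" "pair_nest C (to_pair T)" "C \<noteq> to_pair T" "snd C \<noteq> {}"
    "\<forall>V\<in>pairs. pair_nest V (to_pair T) \<and> pair_orth V (to_pair U) \<longrightarrow> pair_nest V C"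
    by blast
  have "Inr C \<in> nested_in R T - {T}" using C(1-4) by (auto simp: nested_in_def)
  moreover have "\<forall>V\<in>Dom R. orth R V U \<and> nest R V T \<longrightarrow> nest R V (Inr C)"
    using C(5) to_pair_pairs by (simp del: R_simps(1))
  ultimately show "\<exists>W\<in>nested_in R T - {T}. \<forall>V\<in>Dom R. orth R V U \<and> nest R V T \<longrightarrow> nest R V W"
    by blast
qed

lemma completion_projections:
  assumes "0 \<le> K" shows "projections_ax \<xi> K R"
  unfolding projections_ax_def
proof (intro ballI)
  fix W assume W: "W \<in> Dom R"
  show "(\<forall>x. proj R W x \<subseteq> spc R W \<and> proj R W x \<noteq> {} \<and> diam_le (hdist R W) (proj R W x) \<xi>) \<and>
        (\<forall>x y. pt_dist R W x (proj R W y) \<le> K * dist x y + K) \<and>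
        quasiconvex K (spc R W) (hdist R W) (\<Union>x. proj R W x)"
  proof (cases W)
    case (Inl V)
    then have "V \<in> Dom H" using W by auto
    then show ?thesis using Inl projections by (simp add: projections_ax_def)
  next
    case (Inr A)
    then show ?thesis
      using assms \<xi> by (simp add: diam_le_def quasiconvex_def set_dist_zero)
  qed
qed

lemma completion_nesting: "nesting_ax \<xi> R"
  unfolding nesting_ax_def
proof (intro conjI ballI impI)
  show "reflp_on (Dom R) (nest R)"
    unfolding reflp_on_def using pair_nest_refl to_pair_pairs by (simp del: R_simps(1))
  show "antisymp_on (Dom R) (nest R)"
    unfolding antisymp_on_def
    using pair_nest_antisym to_pair_pairs to_pair_inj by (metis R_simps(6))
  show "transp_on (Dom R) (nest R)"
    unfolding transp_on_def using pair_nest_trans by (metis R_simps(6))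
  show "Dom R = {} \<or> (\<exists>S\<in>Dom R. \<forall>W\<in>Dom R. nest R W S)"
  proof (cases "Dom H = {}")
    case True
    then have "pairs = {}" using pairs_fst by auto
    then show ?thesis using True by simp
  next
    case False
    then obtain S where S: "S \<in> Dom H" "\<And>W. W \<in> Dom H \<Longrightarrow> nest H W S"
      using nesting unfolding nesting_ax_def by blast
    have "nest R W (Inl S)" if W: "W \<in> Dom R" for W
      using S pairs_fst[OF to_pair_pairs[OF W]] by (simp add: pair_nest_def nestD_def)
    then show ?thesis using S(1) by (intro disjI2 bexI[of _ "Inl S"]) auto
  qed
next
  fix V W assume VW: "V \<in> Dom R" "W \<in> Dom R" "pnest R V W"
  then show "rho R V W \<subseteq> spc R W" "rho R V W \<noteq> {}" "diam_le (hdist R W) (rho R V W) \<xi>"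
    using rho_R_valid by blast+
  fix p assume p: "p \<in> spc R W"
  have sub: "rho_map R W V p \<subseteq> spc R V \<and> rho_map R W V p \<noteq> {}"
  proof (cases V)
    case V: (Inl V')
    then have V': "V' \<in> Dom H" using VW by auto
    show ?thesis
    proof (cases W)
      case (Inl W')
      then have W': "W' \<in> Dom H" using VW by auto
      then have "pnest H V' W'" using pnest_Inl V' VW V Inl by simp
      then show ?thesis using nesting V' W' p V Inl unfolding nesting_ax_def by simp
    next
      case (Inr A)
      then show ?thesis using V proj_valid[OF V'] by auto
    qed
  qed auto
  then show "rho_map R W V p \<subseteq> spc R V" "rho_map R W V p \<noteq> {}" by auto
qed

lemma completion_geodesic_image:
  assumes "E \<le> E'" shows "bounded_geodesic_image_ax E' R"
  unfolding bounded_geodesic_image_ax_def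
proof (intro ballI impI allI)
  fix V W I g assume VW: "V \<in> Dom R" "W \<in> Dom R" "pnest R V W"
    and g: "geodesic (spc R W) (hdist R W) I g"
  have E0: "0 \<le> E'" using coarse_const_ge(1) assms by simp
  show "diam_le (hdist R V) (\<Union>p\<in>g ` I. rho_map R W V p) E' \<or>
    (\<exists>p\<in>g ` I. set_dist (hdist R W) {p} (rho R V W) \<le> E')"
  proof (cases V)
    case V: (Inl V')
    then have V': "V' \<in> Dom H" using VW by auto
    show ?thesis
    proof (cases W)
      case (Inl W')
      then have W': "W' \<in> Dom H" using VW by auto
      then have pn: "pnest H V' W'" using pnest_Inl V' VW V Inl by simp
      have g': "geodesic (spc H W') (hdist H W') I g" using g Inl by simp
      from geodesic_image[unfolded bounded_geodesic_image_ax_def] V' W' pn g'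
      consider "diam_le (hdist H V') (\<Union>p\<in>g ` I. rho_map H W' V' p) E"
        | p where "p \<in> g ` I" "set_dist (hdist H W') {p} (rho H V' W') \<le> E" by blast
      then show ?thesis
      proof cases
        case 1
        then have "diam_le (hdist H V') (\<Union>p\<in>g ` I. rho_map H W' V' p) E'"
          using assms unfolding diam_le_def by (meson order_trans)
        then show ?thesis using V Inl by simp
      next
        case 2
        have "rho R V W = rho H V' W'" using rho_R_Inl[OF V' W'] pn V Inl by blast
        then show ?thesis using 2 assms Inl by (intro disjI2 bexI[of _ p]) auto
      qed
    next
      case (Inr A)
      obtain t where "t \<in> I" using g by (auto simp: geodesic_def)
      then show ?thesis
        using Inr E0 by (intro disjI2 bexI[of _ "g t"]) (auto simp: set_dist_zero)
    qed
  next
    case (Inr A)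
    then show ?thesis using E0 by (simp add: diam_le_def)
  qed
qed

lemma completion_consistency_basic:
  assumes V: "V \<in> Dom R" and W: "W \<in> Dom R"
  shows "transverse R V W \<Longrightarrow> min (pt_dist R W x (rho R V W)) (pt_dist R V x (rho R W V)) \<le> \<kappa>"
    and "pnest R V W \<Longrightarrow> pt_dist R W x (rho R V W) \<le> \<kappa> \<or>
      diam_le (hdist R V) (proj R V x \<union> (\<Union>p\<in>proj R W x. rho_map R W V p)) \<kappa>"
proof -
  show "min (pt_dist R W x (rho R V W)) (pt_dist R V x (rho R W V)) \<le> \<kappa>" if t: "transverse R V W"
  proof (cases V)
    case V': (Inl V')
    show ?thesis
    proof (cases W)
      case W': (Inl W')
      have D: "V' \<in> Dom H" "W' \<in> Dom H" using V W V' W' by auto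
      have t: "transverse H V' W'" "transverse H W' V'"
        using t transverse_sym[OF V W t] transverse_Inl D V' W' by auto
      then have "rho R V W = rho H V' W'" "rho R W V = rho H W' V'"
        using rho_R_Inl D V' W' by blast+
      moreover have "min (pt_dist H W' x (rho H V' W')) (pt_dist H V' x (rho H W' V')) \<le> \<kappa>"
        using consistent D t unfolding consistency_ax_def by blast
      ultimately show ?thesis using V' W' by simp
    next
      case (Inr A)
      then show ?thesis using \<kappa> by simp
    qed
  next
    case (Inr A)
    then show ?thesis using \<kappa> by simp
  qed
  show "pt_dist R W x (rho R V W) \<le> \<kappa> \<or>
      diam_le (hdist R V) (proj R V x \<union> (\<Union>p\<in>proj R W x. rho_map R W V p)) \<kappa>" if pn: "pnest R V W"
  proof (cases V)
    case V': (Inl V')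
    show ?thesis
    proof (cases W)
      case W': (Inl W')
      have D: "V' \<in> Dom H" "W' \<in> Dom H" using V W V' W' by auto
      have pn: "pnest H V' W'" using pn pnest_Inl D V' W' by simp
      then have "rho R V W = rho H V' W'" using rho_R_Inl D V' W' by blast
      moreover have "pt_dist H W' x (rho H V' W') \<le> \<kappa> \<or>
        diam_le (hdist H V') (proj H V' x \<union> (\<Union>p\<in>proj H W' x. rho_map H W' V' p)) \<kappa>"
        using consistent D pn unfolding consistency_ax_def by blast
      ultimately show ?thesis using V' W' by simp
    next
      case (Inr A)
      then show ?thesis using \<kappa> by simp
    qed
  next
    case (Inr A)
    then show ?thesis using \<kappa> by (simp add: diam_le_def)
  qed
qed

lemma completion_uniqueness:
  assumes "uniqueness_ax \<theta> H" shows "uniqueness_ax \<theta> R"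
  unfolding uniqueness_ax_def
proof (intro allI impI)
  fix \<kappa>' :: real and x y :: 'x assume "0 \<le> \<kappa>'" "\<theta> \<kappa>' \<le> dist x y"
  then obtain V where "V \<in> Dom H" "\<kappa>' \<le> pt_dist H V x (proj H V y)"
    using assms unfolding uniqueness_ax_def by blast
  then show "\<exists>V\<in>Dom R. \<kappa>' \<le> pt_dist R V x (proj R V y)"
    by (intro bexI[of _ "Inl V"]) auto
qed

lemma completion_includes: "includes_along Inl H R"
  unfolding includes_along_def
  using nest_Inl orth_Inl rho_R_Inl by (auto simp del: R_simps(6,7,10))

lemma completion_new_points: "\<forall>W\<in>Dom R - Inl ` Dom H. \<exists>p. spc R W = {p}"
  by auto

end

section \<open>Axioms that rest on the coarse estimates\<close>

locale coarse_almost_hierarchy = almost_hierarchy H \<xi> \<delta> K \<kappa> lam E \<alpha> n +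
  coarse: coarse_hierarchy "Dom H" nestD orthD "near_in H" "proj H" "rho H" coarse_const M rank n m
  for H :: "('x::metric_space, 'c, 'i) hierarchy" and \<xi> \<delta> K \<kappa> lam E \<alpha> n M rank m
begin

lemma pair_rho_R:
  assumes "near_in H W r (proj H W x) (coarse.pair_rho (to_pair B) W)"
  shows "pt_dist R (Inl W) x (rho R B (Inl W)) \<le> r"
  using near_in_set_dist[OF assms] by (simp add: coarse.pair_rho_def pt_dist_def)

lemma completion_consistency:
  "consistency_ax \<xi> (\<kappa> + 2 * coarse_const) R"
proof -
  have le: "\<kappa> \<le> \<kappa> + 2 * coarse_const" and c0: "0 \<le> \<kappa> + 2 * coarse_const"
    using coarse.k_nonneg \<kappa> by auto
  have nest: "set_dist (hdist R W) (rho R U W) (rho R V W) \<le> \<kappa> + 2 * coarse_const"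
    if D: "U \<in> Dom R" "V \<in> Dom R" "W \<in> Dom R"
      and UV: "nest R U V \<and> (pnest R V W \<or> transverse R V W \<and> \<not> orth R W U)" for U V W
  proof (cases W)
    case (Inl W')
    then have W': "W' \<in> Dom H" using D by auto
    have p: "to_pair U \<in> pairs" "to_pair V \<in> pairs" "to_pair W \<in> pairs"
      using D to_pair_pairs by blast+
    have "pair_rel (to_pair V) W'" using pair_rel_iff[OF D(2) W'] UV Inl by blast
    moreover have "\<not> pair_orth (to_pair U) (to_pair W)"
      using UV pair_orth_sym pair_orth_not_nest[OF p(1,3)] pair_nest_trans
      unfolding pnest_def R_simps by blast
    ultimately have "near_in H W' (2 * coarse_const) (coarse.pair_rho (to_pair U) W')
        (coarse.pair_rho (to_pair V) W')"
      using coarse.pair_rho_nest[OF p(1,2)] UV Inl by simp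
    from near_in_set_dist[OF this] show ?thesis
      using \<kappa> Inl by (simp add: coarse.pair_rho_def)
  next
    case (Inr A)
    then show ?thesis using c0 by (simp add: set_dist_zero)
  qed
  show ?thesis
    unfolding consistency_ax_def
  proof (intro conjI ballI impI allI)
    fix V W assume D: "V \<in> Dom R" "W \<in> Dom R"
    {
      assume t: "transverse R V W"
      show "rho R V W \<subseteq> spc R W" "rho R V W \<noteq> {}" "diam_le (hdist R W) (rho R V W) \<xi>"
        "rho R W V \<subseteq> spc R V" "rho R W V \<noteq> {}" "diam_le (hdist R V) (rho R W V) \<xi>"
        using rho_R_valid D t transverse_sym[OF D t] by blast+
      show "min (pt_dist R W x (rho R V W)) (pt_dist R V x (rho R W V)) \<le> \<kappa> + 2 * coarse_const" for x
        using completion_consistency_basic(1)[OF D t, of x] le by linarith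
    }
    fix x assume pn: "pnest R V W"
    show "pt_dist R W x (rho R V W) \<le> \<kappa> + 2 * coarse_const \<or>
      diam_le (hdist R V) (proj R V x \<union> (\<Union>p\<in>proj R W x. rho_map R W V p)) (\<kappa> + 2 * coarse_const)"
      using completion_consistency_basic(2)[OF D pn, of x] le unfolding diam_le_def by (meson order_trans)
  qed (use nest in blast)
qed

lemma completion_complexity: "\<exists>n. finite_complexity_ax n R"
proof -
  obtain n where n: "\<And>\<C>. \<C> \<subseteq> pairs \<Longrightarrow>
      pairwise (\<lambda>A B. pair_nest A B \<or> pair_nest B A) \<C> \<Longrightarrow> finite \<C> \<and> card \<C> \<le> n"
    using coarse.pair_finite_complexity by blast
  have "finite \<C> \<and> card \<C> \<le> n"
    if \<C>: "\<C> \<subseteq> Dom R" "pairwise (\<lambda>V W. nest R V W \<or> nest R W V) \<C>" for \<C>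
  proof -
    have inj: "inj_on to_pair \<C>" using to_pair_inj \<C>(1) unfolding inj_on_def by blast
    have "to_pair ` \<C> \<subseteq> pairs" using to_pair_pairs \<C>(1) by blast
    moreover have "pairwise (\<lambda>A B. pair_nest A B \<or> pair_nest B A) (to_pair ` \<C>)"
      using \<C>(2) by (auto simp: pairwise_def)
    ultimately have "finite (to_pair ` \<C>) \<and> card (to_pair ` \<C>) \<le> n" by (rule n)
    then show ?thesis using inj finite_imageD card_image by metis
  qed
  then show ?thesis unfolding finite_complexity_ax_def by blast
qed

text \<open>In a new domain all distances are 0, so \<open>link_const\<close> itself bounds the
  number of links there and has to dominate the bound for pairs.\<close>

definition link_const where
  "link_const = max lam (real (Suc (M (2 * coarse.gate_const)) ^ Suc n))"

text \<open>It has to reach the old threshold \<open>E\<close>, strictly exceed the threshold in the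
  links of pairs, and dominate the new consistency constant
  \<open>\<kappa> + 2 * coarse_const\<close>.\<close>

definition far_const where
  "far_const = E + 3 * coarse_const + \<bar>2 * coarse.gate_const\<bar> + 1"

text \<open>Below an old domain the old links suffice, since new domains have distance 0 and stay
  under the threshold. Below a new one the links of pairs are used, and the distance condition on
  \<open>rho\<close> is trivial in a point.\<close>

lemma completion_large_links: "large_links_ax link_const far_const R"
  unfolding large_links_ax_def Let_def
proof (intro ballI allI)
  fix W x x' assume W: "W \<in> Dom R"
  let ?N = "link_const * pt_dist R W x (proj R W x') + link_const"
  have far: "E \<le> far_const" "coarse_const + 2 * coarse.gate_const < far_const" "0 < far_const"
    using coarse.k_nonneg coarse_const_ge(1) by (auto simp: far_const_def)
  show "\<exists>\<T>. \<T> \<subseteq> nested_in R W - {W} \<and> finite \<T> \<and> int (card \<T>) \<le> \<lfloor>?N\<rfloor> \<and>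
      (\<forall>T\<in>nested_in R W - {W}. (\<exists>T'\<in>\<T>. T \<in> nested_in R T') \<or> pt_dist R T x (proj R T x') < far_const) \<and>
      (\<forall>T'\<in>\<T>. pt_dist R W x (rho R T' W) \<le> ?N)"
  proof (cases W)
    case (Inl V)
    then have V: "V \<in> Dom H" using W by auto
    define N where "N = lam * pt_dist H V x (proj H V x') + lam"
    obtain \<T> where \<T>: "\<T> \<subseteq> nested_in H V - {V}" "finite \<T>" "int (card \<T>) \<le> \<lfloor>N\<rfloor>"
      "\<And>T. T \<in> nested_in H V - {V} \<Longrightarrow> (\<exists>T'\<in>\<T>. T \<in> nested_in H T') \<or> pt_dist H T x (proj H T x') < E"
      "\<And>T'. T' \<in> \<T> \<Longrightarrow> pt_dist H V x (rho H T' V) \<le> N"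
      using links[unfolded large_links_ax_def Let_def, rule_format, OF V, of x x']
      unfolding N_def by blast
    have "0 \<le> pt_dist H V x (proj H V x')"
      unfolding pt_dist_def
      by (rule set_dist_nonneg[OF metric[OF V] proj_valid(2)[OF V] proj_valid(2)[OF V]])
    moreover have "lam \<le> link_const" unfolding link_const_def by (rule max.cobounded1)
    ultimately have NN: "N \<le> ?N"
      unfolding N_def Inl pt_dist_R R_simps by (intro add_mono mult_right_mono)
    have TD: "T \<in> Dom H" "pnest H T V" if "T \<in> \<T>" for T
      using \<T>(1) that by (auto simp: nested_in_def pnest_def)
    show ?thesis
    proof (intro exI[of _ "Inl ` \<T>"] conjI ballI)
      show "Inl ` \<T> \<subseteq> nested_in R W - {W}"
        using \<T>(1) V Inl nest_Inl[OF _ V] by (auto simp: nested_in_def simp del: R_simps(6))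
      show "finite (Inl ` \<T>)" using \<T>(2) by simp
      have "int (card \<T>) \<le> \<lfloor>?N\<rfloor>" using \<T>(3) floor_mono[OF NN] by linarith
      then show "int (card (Inl ` \<T>)) \<le> \<lfloor>?N\<rfloor>" by (simp only: card_image[OF inj_Inl])
      show "(\<exists>T'\<in>Inl ` \<T>. T \<in> nested_in R T') \<or> pt_dist R T x (proj R T x') < far_const"
        if T: "T \<in> nested_in R W - {W}" for T
      proof (cases T)
        case T': (Inl T')
        then have "T' \<in> Dom H" using T by (auto simp: nested_in_def)
        then have "T' \<in> nested_in H V - {V}"
          using T T' V Inl nest_Inl[of T' V] by (auto simp: nested_in_def simp del: R_simps(6))
        then consider T'' where "T'' \<in> \<T>" "T' \<in> nested_in H T''" | "pt_dist H T' x (proj H T' x') < E"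
          using \<T>(4) by blast
        then show ?thesis
        proof cases
          case (1 T'')
          then have "T \<in> nested_in R (Inl T'')"
            using T' nest_Inl[of T' T''] TD(1) by (auto simp: nested_in_def simp del: R_simps(6))
          then show ?thesis using 1 by blast
        next
          case 2
          then show ?thesis using T' far by simp
        qed
      next
        case (Inr A)
        then show ?thesis using far by simp
      qed
      fix T :: "'i + 'i \<times> 'i set" assume "T \<in> Inl ` \<T>"
      then obtain T' where T': "T = Inl T'" "T' \<in> \<T>" by blast
      then have "rho R T W = rho H T' V" using rho_R_Inl[OF TD(1) V] TD Inl by blast
      then show "pt_dist R W x (rho R T W) \<le> ?N" using \<T>(5)[OF T'(2)] NN Inl by simp
    qed
  next
    case (Inr A)
    then have A: "A \<in> pairs" "snd A \<noteq> {}" using W by auto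
    have N: "?N = link_const" using Inr by simp
    obtain \<T> where \<T>: "finite \<T>" "card \<T> \<le> Suc (M (2 * coarse.gate_const)) ^ Suc n"
      "\<And>B. B \<in> \<T> \<Longrightarrow> B \<in> pairs \<and> pair_nest B A \<and> B \<noteq> A"
      "\<And>Q. pair_nest (Q, {}) A \<Longrightarrow>
        \<not> near_in H Q (coarse_const + 2 * coarse.gate_const) (proj H Q x) (proj H Q x') \<Longrightarrow>
        \<exists>B\<in>\<T>. pair_nest (Q, {}) B"
      using coarse.pair_large_links[OF A, of x x'] by blast
    obtain f where f: "\<And>B. B \<in> pairs \<Longrightarrow> f B \<in> Dom R \<and> to_pair (f B) = B"
      using to_pair_surj by metis
    show ?thesis
    proof (intro exI[of _ "f ` \<T>"] conjI ballI)
      have "f B \<in> nested_in R W - {W}" if "B \<in> \<T>" for B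
        using \<T>(3)[OF that] f[of B] Inr by (auto simp: nested_in_def simp del: R_simps(1))
      then show "f ` \<T> \<subseteq> nested_in R W - {W}" by blast
      show "finite (f ` \<T>)" using \<T>(1) by simp
      have "card (f ` \<T>) \<le> Suc (M (2 * coarse.gate_const)) ^ Suc n"
        using card_image_le[OF \<T>(1), of f] \<T>(2) by linarith
      then have "real (card (f ` \<T>)) \<le> link_const"
        unfolding link_const_def by (intro max.coboundedI2) (simp only: of_nat_le_iff)
      then show "int (card (f ` \<T>)) \<le> \<lfloor>?N\<rfloor>" unfolding N by (simp add: le_floor_iff)
      show "pt_dist R W x (rho R T W) \<le> ?N" for T
        using lam Inr by (simp add: link_const_def)
      fix T assume T: "T \<in> nested_in R W - {W}"
      show "(\<exists>T'\<in>f ` \<T>. T \<in> nested_in R T') \<or> pt_dist R T x (proj R T x') < far_const"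
      proof (cases T)
        case Q: (Inl Q)
        have QA: "pair_nest (Q, {}) A" "T \<in> Dom R" using T Q Inr by (auto simp: nested_in_def)
        show ?thesis
        proof (cases "near_in H Q (coarse_const + 2 * coarse.gate_const) (proj H Q x) (proj H Q x')")
          case True
          then have "pt_dist H Q x (proj H Q x') \<le> coarse_const + 2 * coarse.gate_const"
            unfolding pt_dist_def by (rule near_in_set_dist)
          then show ?thesis using Q far(2) by simp
        next
          case False
          then obtain B where B: "B \<in> \<T>" "pair_nest (Q, {}) B" using \<T>(4) QA(1) by blast
          then have "T \<in> nested_in R (f B)"
            using f[of B] \<T>(3)[OF B(1)] QA(2) Q unfolding nested_in_def by simp
          then show ?thesis using B(1) by blast
        qed
      next
        case (Inr B)
        then show ?thesis using far by simp
      qed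
    qed
  qed
qed

text \<open>The point \<open>z\<close> realizes the prescribed coordinates in the old members. The
  gate to all members at once keeps them, as an old member is nested in itself and orthogonal to the
  others, hence controlled by none; wherever \<open>rho\<close> is prescribed in an old domain, the
  gate supplies it.\<close>

lemma completion_partial_realization:
  "partial_realization_ax (coarse.gate_const + coarse_const) R"
  unfolding partial_realization_ax_def
proof (intro allI impI, elim conjE)
  fix \<V> and p assume \<V>: "\<V> \<subseteq> Dom R" "pairwise (orth R) \<V>"
    and p: "\<forall>V\<in>\<V>. p V \<in> (\<Union>x. proj R V x)"
  let ?r = "coarse.gate_const + coarse_const"
  have "\<forall>W. Inl W \<in> \<V> \<longrightarrow> (\<exists>x. p (Inl W) \<in> proj H W x)" using p by force
  then obtain P where P: "\<And>W. Inl W \<in> \<V> \<Longrightarrow> p (Inl W) \<in> proj H W (P W)" by metis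
  have "{W. Inl W \<in> \<V>} \<subseteq> Dom H" using \<V>(1) by auto
  moreover have "pairwise orthD {W. Inl W \<in> \<V>}"
  proof (rule pairwiseI)
    fix U W assume "U \<in> {W. Inl W \<in> \<V>}" "W \<in> {W. Inl W \<in> \<V>}" "U \<noteq> W"
    then have "orth R (Inl U) (Inl W)" using pairwiseD[OF \<V>(2), of "Inl U" "Inl W"] by simp
    then show "orthD U W" by (simp add: pair_orth_singletons)
  qed
  ultimately have "\<exists>z. \<forall>V\<in>{W. Inl W \<in> \<V>}. near_in H V coarse_const (proj H V z) (proj H V (P V)) \<and>
      (\<forall>W. rel V W \<longrightarrow> near_in H W coarse_const (proj H W z) (rho H V W))"
    by (rule coarse.partial_realization)
  then obtain z where z: "\<And>W. Inl W \<in> \<V> \<Longrightarrow> near_in H W coarse_const (proj H W z) (proj H W (P W))"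
    by blast
  have "to_pair ` \<V> \<subseteq> pairs" using to_pair_pairs \<V>(1) by blast
  moreover have "pairwise pair_orth (to_pair ` \<V>)" using \<V>(2) by (auto simp: pairwise_def)
  ultimately obtain y where
    y: "\<And>A W. A \<in> to_pair ` \<V> \<Longrightarrow> pair_rel A W \<Longrightarrow>
        near_in H W coarse.gate_const (proj H W y) (coarse.pair_rho A W)"
      "\<And>W. W \<in> Dom H \<Longrightarrow> (\<And>A. A \<in> to_pair ` \<V> \<Longrightarrow> \<not> pair_rel A W) \<Longrightarrow>
        near_in H W coarse.gate_const (proj H W y) (proj H W z)"
    by (rule coarse.gate[where z = z]) blast
  have g0: "0 \<le> coarse.gate_const" using coarse.k_nonneg by (simp add: coarse.gate_const_def)
  have r0: "0 \<le> ?r" "coarse.gate_const \<le> ?r" using g0 coarse.k_nonneg by auto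
  have own: "pt_dist R V y {p V} \<le> ?r" if V: "V \<in> \<V>" for V
  proof (cases V)
    case (Inl W)
    then have W: "W \<in> Dom H" using V \<V>(1) by auto
    have "\<not> pair_rel A W" if A: "A \<in> to_pair ` \<V>" for A
    proof -
      obtain B where B: "B \<in> \<V>" "A = to_pair B" using A by blast
      show ?thesis
      proof (cases "B = V")
        case True
        then show ?thesis using B Inl W nest_refl by (simp add: pair_rel_def pair_nest_singletons)
      next
        case False
        then have "orth R B V" using pairwiseD[OF \<V>(2) B(1) V] by simp
        then have "pair_orth A (W, {})" using B(2) Inl by simp
        then show ?thesis by (simp add: pair_rel_def)
      qed
    qed
    then have "near_in H W coarse.gate_const (proj H W y) (proj H W z)" using y(2) W by blast
    from near_in_trans[OF this z] have "near_in H W ?r (proj H W y) (proj H W (P W))"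
      using V Inl by simp
    then have "near_in H W ?r (proj H W y) {p V}"
      using P[of W] V Inl by (auto simp: near_in_def)
    from near_in_set_dist[OF this] show ?thesis using Inl by (simp add: pt_dist_def)
  next
    case (Inr A)
    then show ?thesis using r0 by simp
  qed
  have others: "pt_dist R W y (rho R V W) \<le> ?r"
    if V: "V \<in> \<V>" and W: "W \<in> Dom R" and VW: "pnest R V W \<or> transverse R V W" for V W
  proof (cases W)
    case (Inl W')
    then have "W' \<in> Dom H" using W by auto
    then have "pair_rel (to_pair V) W'" using pair_rel_iff V \<V>(1) VW Inl by blast
    then have "near_in H W' coarse.gate_const (proj H W' y) (coarse.pair_rho (to_pair V) W')"
      using y(1) V by blast
    from order_trans[OF pair_rho_R[OF this] r0(2)] show ?thesis unfolding Inl .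
  next
    case (Inr A)
    then show ?thesis using r0 by simp
  qed
  show "\<exists>x. \<forall>V\<in>\<V>. pt_dist R V x {p V} \<le> ?r \<and>
      (\<forall>W\<in>Dom R. pnest R V W \<longrightarrow> pt_dist R W x (rho R V W) \<le> ?r) \<and>
      (\<forall>W\<in>Dom R. transverse R W V \<longrightarrow> pt_dist R W x (rho R V W) \<le> ?r)"
    using own others transverse_sym \<V>(1) by (intro exI[of _ y]) blast
qed

lemma completion_hierarchy_axioms:
  assumes "quasigeodesic_space (UNIV :: 'x set) dist" "0 \<le> \<delta>" "0 \<le> K" "uniqueness_ax \<theta> H"
  shows "hierarchy_axioms \<xi> R"
  unfolding hierarchy_axioms_def
proof (intro conjI)
  have "hyperbolic_space \<delta> (spc R W) (hdist R W)" if "W \<in> Dom R" for W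
    using that by (cases W) (auto simp: hyperbolic singleton_hyperbolic[OF assms(2)])
  then show "\<exists>\<delta>\<ge>0. \<forall>W\<in>Dom R. hyperbolic_space \<delta> (spc R W) (hdist R W)" using assms(2) by blast
  have "link_const \<ge> 1" using lam by (simp add: link_const_def)
  moreover have "far_const \<ge> max \<xi> (\<kappa> + 2 * coarse_const)" "E \<le> far_const"
    using E \<xi> \<kappa> coarse.k_nonneg by (auto simp: far_const_def)
  moreover have "0 \<le> \<kappa> + 2 * coarse_const" using \<kappa> coarse.k_nonneg by simp
  ultimately show "\<exists>\<kappa>0\<ge>0. consistency_ax \<xi> \<kappa>0 R \<and>
      (\<exists>lam\<ge>1. \<exists>E. E \<ge> max \<xi> \<kappa>0 \<and> large_links_ax lam E R \<and> bounded_geodesic_image_ax E R)"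
    using completion_consistency completion_large_links completion_geodesic_image by blast
qed (use assms \<xi> completion_projections completion_nesting completion_complexity
      completion_partial_realization completion_uniqueness in blast)+

end

theorem theoremA1:
  fixes \<SS> :: "('x::metric_space, 'c, 'i) hierarchy"
  assumes "almost_HHS \<SS>"
  shows "\<exists>\<RR> :: ('x, 'c, 'i + 'i \<times> 'i set) hierarchy.
           HHS \<RR> \<and> includes_along Inl \<SS> \<RR> \<and>
           (\<forall>W\<in>Dom \<RR> - Inl ` Dom \<SS>. \<exists>p. spc \<RR> W = {p})"
proof -
  obtain \<xi> where basic: "orthogonality_basic \<SS>" and ax: "hierarchy_axioms \<xi> \<SS>"
    and bounded: "bounded_orthogonality_ax \<xi> \<SS>"
    using assms by (auto simp: almost_HHS_def)
  obtain \<delta> K n \<kappa> lam E \<alpha> \<theta> where const: "\<xi> \<ge> 0" "\<delta> \<ge> 0" "K \<ge> 0" "\<kappa> \<ge> 0" "lam \<ge> 1" "E \<ge> max \<xi> \<kappa>"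
    and qg: "quasigeodesic_space (UNIV :: 'x set) dist"
    and hyp: "\<And>W. W \<in> Dom \<SS> \<Longrightarrow> hyperbolic_space \<delta> (spc \<SS> W) (hdist \<SS> W)"
    and rest: "projections_ax \<xi> K \<SS>" "nesting_ax \<xi> \<SS>" "finite_complexity_ax n \<SS>"
      "consistency_ax \<xi> \<kappa> \<SS>" "large_links_ax lam E \<SS>" "bounded_geodesic_image_ax E \<SS>"
      "partial_realization_ax \<alpha> \<SS>"
    and uniq: "uniqueness_ax \<theta> \<SS>"
    using ax unfolding hierarchy_axioms_def by blast
  interpret almost_hierarchy \<SS> \<xi> \<delta> K \<kappa> lam E \<alpha> n
    by unfold_locales (fact basic bounded const hyp rest)+
  obtain M rank m where
    coarse: "coarse_hierarchy (Dom \<SS>) nestD orthD (near_in \<SS>) (proj \<SS>) (rho \<SS>) coarse_const M rank n m"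
    by (rule coarse_hierarchy_exists)
  interpret coarse_almost_hierarchy \<SS> \<xi> \<delta> K \<kappa> lam E \<alpha> n M rank m
    by (intro coarse_almost_hierarchy.intro coarse) unfold_locales
  have "HHS completion"
    unfolding HHS_def
    using completion_orthogonality completion_containers
      completion_hierarchy_axioms[OF qg const(2,3) uniq] by blast
  then show ?thesis using completion_includes completion_new_points by blast
qed

end
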